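(* Let $\boldsymbol{\zeta}_v=(\zeta_{1,v},\ldots,\zeta_{k+1,v})$, $v>0$, be a family of threshold dependent perturbed chi-square risks (defined in the context) with coefficients $\rho_{j,v}\in\mathbb{R}\setminus\{0\}$, $1\le j\le k$, $v>0$, and Gaussian random matrices $\mathcal{W}_v$, $v>0$; here $\zeta_{1,v}=\zeta_1$ does not depend on $v$. Denote the first row of $\mathcal{W}_v$ by $\boldsymbol{W}_v$ and assume that Assumption A (see the context) holds for every $v>0$. Let the distribution function $G$ of $\zeta_1$ be in the Gumbel max-domain of attraction with positive scaling function $w(\cdot)$, i.e. $$\lim_{v\to\infty}\frac{1-G(v+x/w(v))}{1-G(v)}=\exp(-x),\qquad x\in\mathbb{R}.$$ (i) Assume that $$\lim_{v\to\infty}4v\,w(v)(1-\rho_{j,v})=\lambda_j\in[0,\infty),\qquad 1\le j\le k,$$ and that, as $v\to\infty$, $$w(v)\sqrt v\,\boldsymbol{W}_v\xrightarrow{d}\boldsymbol{U},\qquad \sqrt{w(v)}\,\boldsymbol{W}_v\xrightarrow{p}\boldsymbol{0}=(0,\ldots,0)\in\mathbb{R}^k$$ for a random vector $\boldsymbol{U}=(U_1,\ldots,U_k)\in\mathbb{R}^k$. Then for any $x\in\mathbb{R}$, as $v\to\infty$, $$\Big(w(v)(\zeta_{2,v}-v),\ldots,w(v)(\zeta_{k+1,v}-v)\Big)\Big|\Big(\zeta_1=v+\frac{x}{w(v)}\Big)\xrightarrow{d}\Big(2U_1-\frac{\lambda_1}{2}+x,\ldots,2U_k-\frac{\lambda_k}{2}+x\Big).\qquad(\ast)$$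 (ii) If $(\ast)$ holds for any $x\in[0,\infty)$, then, as $v\to\infty$, $$\Big(w(v)(\zeta_1-v),w(v)(\zeta_{2,v}-v),\ldots,w(v)(\zeta_{k+1,v}-v)\Big)\Big|(\zeta_1>v)\xrightarrow{d}\Big(E,\ E+2U_1-\frac{\lambda_1}{2},\ldots,E+2U_k-\frac{\lambda_k}{2}\Big),$$ with $E$ a unit exponential random variable independent of $\boldsymbol{U}$.
   Context: Let $m\ge2$ and $k\ge1$ be fixed integers. Threshold dependent perturbed chi-square risk: for each $v>0$ let $\rho_{j,v}\in\mathbb{R}\setminus\{0\}$, $1\le j\le k$, and let $\mathcal{W}_v=\{W_{ij,v}\}_{1\le i\le m,1\le j\le k}$ be an $m\times k$ matrix of centered (not necessarily standard) Gaussian random variables. Put $$\zeta_{1,v}=\zeta_1=\sum_{i=1}^mX_{i1}^2,\qquad \zeta_{j+1,v}=\sum_{i=1}^m(\rho_{j,v}X_{i1}+W_{ij,v})^2,\quad 1\le j\le k,$$ where $(X_{11},\ldots,X_{m1})$ is a random vector not depending on $v$. Assumption A (for given $v$): the random vector $(X_{11},\ldots,X_{m1})$ and the Gaussian random matrix $\mathcal{W}_v$ are mutually independent; the rows of $\mathcal{W}_v$ are independent and identically distributed as a centered $k$-dimensional Gaussian random vector; and $\zeta_1$ has a continuous distribution function $G$ which has support on $[0,\infty)$. (The variables $X_{11},\ldots,X_{m1}$ are not assumed independent or Gaussian.) The symbols $\xrightarrow{d}$ and $\xrightarrow{p}$ denote convergence in distribution and in probability. The notation $\boldsymbol{Y}_v\,|\,(A_v)\xrightarrow{d}\boldsymbol{Y}$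 means that random vectors having the conditional distribution of $\boldsymbol{Y}_v$ given $A_v$ converge in distribution to $\boldsymbol{Y}$ as $v\to\infty$. *)

theory Defs
  imports "HOL-Probability.Probability"
begin

section \<open>Chi-square risks\<close>

text \<open>
  The index types \<open>'m\<close> and \<open>'k\<close> play the roles of \<open>{1..m}\<close> and \<open>{1..k}\<close>. An \<open>m\<close> by \<open>k\<close> matrix is
  an element of \<open>real^'k^'m\<close>, so that \<open>B $ i\<close> is its \<open>i\<close>-th row. The risk vector
  \<open>(\<zeta>\<^sub>1, \<dots>, \<zeta>\<^bsub>k+1\<^esub>)\<close> is represented as a pair in \<open>real \<times> real^'k\<close>.
\<close>

definition chi_square :: "real^'m \<Rightarrow> real" where
  "chi_square x = (\<Sum>i\<in>UNIV. (x $ i)\<^sup>2)"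

definition perturbed_chi_square :: "real^'k \<Rightarrow> real^'m \<Rightarrow> real^'k^'m \<Rightarrow> real^'k" where
  "perturbed_chi_square r x B = (\<chi> j. \<Sum>i\<in>UNIV. (r $ j * x $ i + B $ i $ j)\<^sup>2)"


section \<open>Probabilistic notions\<close>

text \<open>Weak convergence of laws along a filter; the library's \<open>weak_conv_m\<close> is restricted to
  sequences of laws on the real line.\<close>

definition conv_in_distribution ::
    "('i \<Rightarrow> 'a::topological_space measure) \<Rightarrow> 'a measure \<Rightarrow> 'i filter \<Rightarrow> bool" where
  "conv_in_distribution \<mu> \<nu> F \<longleftrightarrow>
     (\<forall>f :: 'a \<Rightarrow> real. continuous_on UNIV f \<longrightarrow> bounded (range f) \<longrightarrow>
        ((\<lambda>v. integral\<^sup>L (\<mu> v) f) \<longlongrightarrow> integral\<^sup>L \<nu> f) F)"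

definition conv_in_probability ::
    "'a measure \<Rightarrow> ('i \<Rightarrow> 'a \<Rightarrow> 'b::real_normed_vector) \<Rightarrow> 'b \<Rightarrow> 'i filter \<Rightarrow> bool" where
  "conv_in_probability M Y c F \<longleftrightarrow>
     (\<forall>\<epsilon>>0. ((\<lambda>v. measure M {\<omega> \<in> space M. norm (Y v \<omega> - c) > \<epsilon>}) \<longlongrightarrow> 0) F)"

text \<open>The library's \<open>indep_var\<close> requires both variables to have the same range type.\<close>

definition independent_variables ::
    "'a measure \<Rightarrow> ('a \<Rightarrow> 'b::topological_space) \<Rightarrow> ('a \<Rightarrow> 'c::topological_space) \<Rightarrow> bool" where
  "independent_variables M Y Z \<longleftrightarrow>
     Y \<in> borel_measurable M \<and> Z \<in> borel_measurable M \<and>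
     prob_space.indep_set M {Y -` A \<inter> space M | A. A \<in> sets borel}
                            {Z -` B \<inter> space M | B. B \<in> sets borel}"

text \<open>Every linear combination of the components is a centered, possibly degenerate, normal
  variable.\<close>

definition centered_gaussian_vector :: "'a measure \<Rightarrow> ('a \<Rightarrow> real^'k) \<Rightarrow> bool" where
  "centered_gaussian_vector M Y \<longleftrightarrow>
     Y \<in> borel_measurable M \<and>
     (\<forall>a. (\<exists>\<sigma>>0. distributed M lborel (\<lambda>\<omega>. a \<bullet> Y \<omega>) (normal_density 0 \<sigma>)) \<or>
          (AE \<omega> in M. a \<bullet> Y \<omega> = 0))"

definition measure_support :: "'a::topological_space measure \<Rightarrow> 'a set" where
  "measure_support \<mu> = {x. \<forall>S. open S \<longrightarrow> x \<in> S \<longrightarrow> emeasure \<mu> S > 0}"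

definition gumbel_MDA :: "(real \<Rightarrow> real) \<Rightarrow> (real \<Rightarrow> real) \<Rightarrow> bool" where
  "gumbel_MDA G w \<longleftrightarrow>
     (\<forall>v>0. w v > 0) \<and>
     (\<forall>x. ((\<lambda>v. (1 - G (v + x / w v)) / (1 - G v)) \<longlongrightarrow> exp (- x)) at_top)"

definition regular_cond_distribution ::
    "'a measure \<Rightarrow> ('a \<Rightarrow> 'b::topological_space) \<Rightarrow> ('a \<Rightarrow> real) \<Rightarrow> (real \<Rightarrow> 'b measure) \<Rightarrow> bool" where
  "regular_cond_distribution M Y Z K \<longleftrightarrow>
     K \<in> borel \<rightarrow>\<^sub>M prob_algebra borel \<and>
     (\<forall>A\<in>sets borel. \<forall>B\<in>sets borel.
        emeasure M {\<omega> \<in> space M. Z \<omega> \<in> A \<and> Y \<omega> \<in> B} =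
        (\<integral>\<^sup>+z. emeasure (K z) B * indicator A z \<partial>(distr M borel Z)))"


section \<open>The model\<close>

definition assumption_A ::
    "'a measure \<Rightarrow> ('a \<Rightarrow> real^'m) \<Rightarrow> ('a \<Rightarrow> real^'k^'m) \<Rightarrow> bool" where
  "assumption_A M X W \<longleftrightarrow>
     independent_variables M X W \<and>
     prob_space.indep_vars M (\<lambda>i. borel) (\<lambda>i \<omega>. W \<omega> $ i) UNIV \<and>
     (\<forall>i i'. distr M borel (\<lambda>\<omega>. W \<omega> $ i) = distr M borel (\<lambda>\<omega>. W \<omega> $ i')) \<and>
     (\<forall>i. centered_gaussian_vector M (\<lambda>\<omega>. W \<omega> $ i)) \<and>
     continuous_on UNIV (cdf (distr M borel (\<lambda>\<omega>. chi_square (X \<omega>)))) \<and>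
     measure_support (distr M borel (\<lambda>\<omega>. chi_square (X \<omega>))) \<subseteq> {0..}"

text \<open>
  The event \<open>\<zeta>\<^sub>1 = y\<close> has probability zero, and a regular conditional distribution given \<open>\<zeta>\<^sub>1\<close> is
  determined only almost everywhere, so conditioning on \<open>\<zeta>\<^sub>1 = y\<close> at every single \<open>y \<ge> 0\<close> requires
  the choice of a version. We take a regular conditional distribution \<open>Q\<close> of \<open>X\<close> given
  \<open>\<zeta>\<^sub>1 = chi_square X\<close> such that \<open>Q y\<close> lives on the fibre \<open>chi_square x = y\<close> for every (rather than
  almost every) \<open>y \<ge> 0\<close>; since \<open>W\<close> is independent of \<open>X\<close>, the conditional law of \<open>(X, W)\<close> given
  \<open>\<zeta>\<^sub>1 = y\<close> is the product of \<open>Q y\<close> and the law of \<open>W\<close>.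
\<close>

definition fibre_cond_distribution ::
    "'a measure \<Rightarrow> ('a \<Rightarrow> real^'m) \<Rightarrow> (real \<Rightarrow> (real^'m) measure) \<Rightarrow> bool" where
  "fibre_cond_distribution M X Q \<longleftrightarrow>
     regular_cond_distribution M X (\<lambda>\<omega>. chi_square (X \<omega>)) Q \<and>
     (\<forall>y\<ge>0. AE x in Q y. chi_square x = y)"

definition cond_risk_law ::
    "'a measure \<Rightarrow> (real \<Rightarrow> (real^'m) measure) \<Rightarrow> ('a \<Rightarrow> real^'k^'m) \<Rightarrow> real^'k \<Rightarrow> real \<Rightarrow>
     (real^'k) measure" where
  "cond_risk_law M Q W r y =
     distr (Q y \<Otimes>\<^sub>M distr M borel W) borel (\<lambda>(x, B). perturbed_chi_square r x B)"

text \<open>Convergence in distribution of \<open>w(v) (\<zeta>\<^bsub>j+1,v\<^esub> - v)\<close>, \<open>j = 1, \<dots>, k\<close>, given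
  \<open>\<zeta>\<^sub>1 = v + x / w(v)\<close>, to \<open>2 U\<^sub>j - \<lambda>\<^sub>j / 2 + x\<close>, \<open>j = 1, \<dots>, k\<close>.\<close>

definition cond_risk_limit ::
    "'a measure \<Rightarrow> (real \<Rightarrow> (real^'m) measure) \<Rightarrow> (real \<Rightarrow> 'a \<Rightarrow> real^'k^'m) \<Rightarrow> (real \<Rightarrow> real^'k) \<Rightarrow>
     (real \<Rightarrow> real) \<Rightarrow> 'b measure \<Rightarrow> ('b \<Rightarrow> real^'k) \<Rightarrow> real^'k \<Rightarrow> real \<Rightarrow> bool" where
  "cond_risk_limit M Q W \<rho> w N U lam x \<longleftrightarrow>
     conv_in_distribution
       (\<lambda>v. distr (cond_risk_law M Q (W v) (\<rho> v) (v + x / w v)) borel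
              (\<lambda>z. \<chi> j. w v * (z $ j - v)))
       (distr N borel (\<lambda>\<omega>. \<chi> j. 2 * U \<omega> $ j - lam $ j / 2 + x))
       at_top"


section \<open>The conditional law of the risks\<close>

lemma borel_measurable_vec_nth [measurable]: "(\<lambda>x::('a::euclidean_space)^'n. x $ i) \<in> borel_measurable borel"
  by (intro borel_measurable_continuous_onI continuous_intros)

lemma borel_measurable_chi_square [measurable]: "chi_square \<in> borel_measurable borel"
  unfolding chi_square_def by measurable

lemma borel_measurable_perturbed_chi_square [measurable]:
  "(\<lambda>(x, B). perturbed_chi_square r x B) \<in> borel_measurable (borel \<Otimes>\<^sub>M borel)"
  unfolding borel_prod perturbed_chi_square_def split_beta
  by (intro borel_measurable_continuous_onI continuous_intros)

lemma regular_cond_distribution_cond_risk_law: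
  fixes X :: "'a \<Rightarrow> real^'m" and W :: "'a \<Rightarrow> real^'k^'m"
  assumes M: "prob_space M" and ind: "independent_variables M X W"
    and Q: "regular_cond_distribution M X (\<lambda>\<omega>. chi_square (X \<omega>)) Q"
  shows "regular_cond_distribution M (\<lambda>\<omega>. perturbed_chi_square r (X \<omega>) (W \<omega>))
           (\<lambda>\<omega>. chi_square (X \<omega>)) (cond_risk_law M Q W r)"
proof -
  interpret prob_space M by fact
  have X[measurable]: "X \<in> borel_measurable M" and W[measurable]: "W \<in> borel_measurable M"
    using ind by (auto simp: independent_variables_def)
  have Qm[measurable]: "Q \<in> borel \<rightarrow>\<^sub>M prob_algebra borel"
    using Q by (simp add: regular_cond_distribution_def)
  have Qs: "sets (Q y) = sets borel" and Qp: "prob_space (Q y)" for y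
    using measurable_space[OF Qm, of y] by (auto simp: space_prob_algebra)
  let ?PX = "distr M borel X" and ?PW = "distr M borel W"
  let ?G = "distr M borel (\<lambda>\<omega>. chi_square (X \<omega>))"
  have PW: "prob_space ?PW" and PX: "prob_space ?PX" and PG: "prob_space ?G"
    by (auto intro!: prob_space_distr)
  interpret PW: prob_space ?PW by fact
  interpret PX: prob_space ?PX by fact
  interpret G: prob_space ?G by fact
  interpret GW: pair_sigma_finite ?G ?PW ..
  interpret XW: pair_sigma_finite ?PX ?PW ..
  have PWa: "?PW \<in> space (prob_algebra borel)"
    using PW by (simp add: space_prob_algebra)
  have Km: "cond_risk_law M Q W r \<in> borel \<rightarrow>\<^sub>M prob_algebra borel"
    unfolding cond_risk_law_def
  proof (rule measurable_distr_prob_space2[where M="borel \<Otimes>\<^sub>M borel"])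
    show "(\<lambda>y. Q y \<Otimes>\<^sub>M ?PW) \<in> borel \<rightarrow>\<^sub>M prob_algebra (borel \<Otimes>\<^sub>M borel)"
      using Qm PWa by (intro measurable_pair_prob) auto
  qed (measurable)
  moreover
  have "emeasure M {\<omega> \<in> space M. chi_square (X \<omega>) \<in> A \<and> perturbed_chi_square r (X \<omega>) (W \<omega>) \<in> B} =
        (\<integral>\<^sup>+z. emeasure (cond_risk_law M Q W r z) B * indicator A z \<partial>?G)"
    if [measurable]: "A \<in> sets borel" "B \<in> sets borel" for A B
  proof -
    let ?S = "{p \<in> space (?PX \<Otimes>\<^sub>M ?PW). chi_square (fst p) \<in> A \<and>
                perturbed_chi_square r (fst p) (snd p) \<in> B}"
    have pm[measurable]: "(\<lambda>p. perturbed_chi_square r (fst p) (snd p)) \<in> borel_measurable (borel \<Otimes>\<^sub>M borel)"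
      using borel_measurable_perturbed_chi_square[of r] by (simp add: split_beta)
    have S[measurable]: "?S \<in> sets (?PX \<Otimes>\<^sub>M ?PW)"
      by measurable
    have joint: "?PX \<Otimes>\<^sub>M ?PW = distr M (borel \<Otimes>\<^sub>M borel) (\<lambda>\<omega>. (X \<omega>, W \<omega>))"
    proof (rule pair_measure_eqI)
      fix A' B' assume "A' \<in> sets ?PX" "B' \<in> sets ?PW"
      then have [measurable]: "A' \<in> sets borel" "B' \<in> sets borel" by auto
      have "prob ((X -` A' \<inter> space M) \<inter> (W -` B' \<inter> space M)) =
            prob (X -` A' \<inter> space M) * prob (W -` B' \<inter> space M)"
        using ind by (intro indep_setD) (auto simp: independent_variables_def)
      moreover have "(\<lambda>\<omega>. (X \<omega>, W \<omega>)) -` (A' \<times> B') \<inter> space M =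
            (X -` A' \<inter> space M) \<inter> (W -` B' \<inter> space M)"
        by auto
      ultimately show "emeasure ?PX A' * emeasure ?PW B' =
            emeasure (distr M (borel \<Otimes>\<^sub>M borel) (\<lambda>\<omega>. (X \<omega>, W \<omega>))) (A' \<times> B')"
        by (subst (1 2 3) emeasure_distr) (simp_all add: emeasure_eq_measure ennreal_mult)
    qed (auto intro: PX.sigma_finite_measure_axioms PW.sigma_finite_measure_axioms)
    have slice: "emeasure ?PX ((\<lambda>x. (x, b)) -` ?S) =
        (\<integral>\<^sup>+z. emeasure (Q z) {x. perturbed_chi_square r x b \<in> B} * indicator A z \<partial>?G)" for b
    proof -
      have pb[measurable]: "(\<lambda>x. perturbed_chi_square r x b) \<in> borel_measurable borel"
        using measurable_Pair_compose_split[OF borel_measurable_perturbed_chi_square,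
            of "\<lambda>x. x" borel "\<lambda>_. b"] by simp
      have Bb: "{x. perturbed_chi_square r x b \<in> B} \<in> sets borel"
        using measurable_sets[OF pb, of B] by (simp add: vimage_def)
      have Ab: "{x. chi_square x \<in> A} \<in> sets (borel :: (real^'m) measure)"
        using measurable_sets[OF borel_measurable_chi_square, of A] by (simp add: vimage_def)
      have "(\<lambda>x. (x, b)) -` ?S = {x. chi_square x \<in> A} \<inter> {x. perturbed_chi_square r x b \<in> B}"
        by (auto simp: space_pair_measure)
      also have "emeasure ?PX \<dots> =
          emeasure M {\<omega> \<in> space M. chi_square (X \<omega>) \<in> A \<and> X \<omega> \<in> {x. perturbed_chi_square r x b \<in> B}}"
        using Ab Bb by (subst emeasure_distr) (auto intro!: arg_cong[where f="emeasure M"])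
      also have "\<dots> = (\<integral>\<^sup>+z. emeasure (Q z) {x. perturbed_chi_square r x b \<in> B} * indicator A z \<partial>?G)"
        using Q Bb \<open>A \<in> sets borel\<close> unfolding regular_cond_distribution_def by blast
      finally show ?thesis .
    qed
    have cond: "emeasure (cond_risk_law M Q W r z) B =
        (\<integral>\<^sup>+b. emeasure (Q z) {x. perturbed_chi_square r x b \<in> B} \<partial>?PW)" for z
    proof -
      interpret Qz: prob_space "Q z" by (rule Qp)
      interpret QW: pair_sigma_finite "Q z" ?PW ..
      have sq: "sets (Q z \<Otimes>\<^sub>M ?PW) = sets (borel \<Otimes>\<^sub>M borel)"
        by (intro sets_pair_measure_cong) (auto simp: Qs)
      have f: "(\<lambda>(x, B). perturbed_chi_square r x B) \<in> borel_measurable (Q z \<Otimes>\<^sub>M ?PW)"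
        using borel_measurable_perturbed_chi_square measurable_cong_sets[OF sq refl] by blast
      have "space (Q z) = UNIV" using sets_eq_imp_space_eq[OF Qs] by simp
      then show ?thesis
        unfolding cond_risk_law_def
        using measurable_sets[OF f, of B]
        by (subst emeasure_distr[OF f], simp, subst QW.emeasure_pair_measure_alt2)
           (auto intro!: nn_integral_cong arg_cong[where f="emeasure (Q z)"] simp: space_pair_measure)
    qed
    have kern: "(\<lambda>(z, b). emeasure (Q z) {x. perturbed_chi_square r x b \<in> B} * indicator A z)
        \<in> borel_measurable (?G \<Otimes>\<^sub>M ?PW)"
    proof -
      have "(SIGMA p:space (?G \<Otimes>\<^sub>M ?PW). {x. perturbed_chi_square r x (snd p) \<in> B}) =
          {p. perturbed_chi_square r (snd p) (snd (fst p)) \<in> B}"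
        by (auto simp: space_pair_measure)
      moreover have "{p. perturbed_chi_square r (snd p) (snd (fst p)) \<in> B} \<in> sets ((?G \<Otimes>\<^sub>M ?PW) \<Otimes>\<^sub>M borel)"
      proof -
        have "(\<lambda>p. perturbed_chi_square r (snd p) (snd (fst p))) \<in> borel_measurable ((?G \<Otimes>\<^sub>M ?PW) \<Otimes>\<^sub>M borel)"
          by (rule measurable_compose[of "\<lambda>p. (snd p, snd (fst p))", OF _ pm, simplified]) measurable
        from measurable_sets[OF this, of B] show ?thesis
          by (simp add: vimage_def space_pair_measure)
      qed
      ultimately have "(\<lambda>p. emeasure (Q (fst p)) {x. perturbed_chi_square r x (snd p) \<in> B})
          \<in> borel_measurable (?G \<Otimes>\<^sub>M ?PW)"
        by (intro emeasure_measurable_subprob_algebra2[where N=borel])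
           (simp, intro measurable_prob_algebraD measurable_compose[OF measurable_fst], simp)
      then show ?thesis
        by (simp add: split_beta)
    qed
    have "{\<omega> \<in> space M. chi_square (X \<omega>) \<in> A \<and> perturbed_chi_square r (X \<omega>) (W \<omega>) \<in> B} =
        (\<lambda>\<omega>. (X \<omega>, W \<omega>)) -` ?S \<inter> space M"
      by (auto simp: space_pair_measure)
    then have "emeasure M {\<omega> \<in> space M. chi_square (X \<omega>) \<in> A \<and> perturbed_chi_square r (X \<omega>) (W \<omega>) \<in> B} =
        emeasure (?PX \<Otimes>\<^sub>M ?PW) ?S"
      using S unfolding joint by (subst emeasure_distr) (auto simp: space_pair_measure)
    also have "\<dots> = (\<integral>\<^sup>+b. emeasure ?PX ((\<lambda>x. (x, b)) -` ?S) \<partial>?PW)"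
      by (rule XW.emeasure_pair_measure_alt2[OF S])
    also have "\<dots> = (\<integral>\<^sup>+b. (\<integral>\<^sup>+z. emeasure (Q z) {x. perturbed_chi_square r x b \<in> B} * indicator A z \<partial>?G) \<partial>?PW)"
      by (simp only: slice)
    also have "\<dots> = (\<integral>\<^sup>+z. (\<integral>\<^sup>+b. emeasure (Q z) {x. perturbed_chi_square r x b \<in> B} * indicator A z \<partial>?PW) \<partial>?G)"
      using kern by (intro GW.Fubini') (simp add: split_beta)
    also have "\<dots> = (\<integral>\<^sup>+z. emeasure (cond_risk_law M Q W r z) B * indicator A z \<partial>?G)"
      by (auto intro!: nn_integral_cong simp: cond split: split_indicator)
    finally show ?thesis .
  qed
  ultimately show ?thesis
    by (simp add: regular_cond_distribution_def)
qed

end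

theory Submission
  imports Defs
begin

text \<open>
  Given \<open>\<zeta>\<^sub>1 = y\<close>, the vector \<open>X\<close> lies on the sphere of radius \<open>sqrt y\<close>, and nothing is known about
  its direction. The direction is irrelevant, because the law of \<open>W\<close>, whose rows are independent copies
  of one centered Gaussian vector, is invariant under orthogonal maps acting on the row index
  (\<open>distr_rotate_rows\<close>), while such a map can carry \<open>X\<close> to the point \<open>sqrt y\<close> on a coordinate axis
  without changing the sums of squares \<open>\<Sum>\<^sub>i (\<rho>\<^sub>j X\<^sub>i + W\<^bsub>ij\<^esub>)\<^sup>2\<close>. Hence the conditional law of the risks
  depends on \<open>y\<close> only (\<open>cond_risk_law_eq_distr\<close>), and with \<open>y = v + s / w(v)\<close> the normalized \<open>j\<close>-th
  risk has the law of
  \<open>w v (\<rho>\<^sub>j\<^sup>2 - 1) + \<rho>\<^sub>j\<^sup>2 s + 2 \<rho>\<^sub>j w sqrt(v + s/w) W\<^bsub>1j\<^esub> + w \<Sum>\<^sub>i W\<^bsub>ij\<^esub>\<^sup>2\<close>,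
  a random function of \<open>s\<close> built from \<open>W\<close> alone. Invariance is proved through characteristic
  functions; the uniqueness theorem in several dimensions is reduced to the one on the line by
  conditioning on one coordinate at a time (\<open>measure_eqI_same_char\<close>).

  For part (i), the Gumbel condition forces \<open>v w(v) \<longrightarrow> \<infinity>\<close> (\<open>gumbel_MDA_scaling_at_top\<close>), so
  \<open>\<rho>\<^sub>j \<longrightarrow> 1\<close>, the first two terms tend to \<open>- \<lambda>\<^sub>j / 2\<close> and \<open>s\<close>, the third is asymptotically
  \<open>2 w sqrt(v) W\<^bsub>1j\<^esub>\<close> and the last vanishes in probability. A Slutsky argument finishes the proof.

  In part (ii) the conditional limit is given at each fixed shift \<open>s\<close>, but has to be integrated over the random
  exceedance \<open>S = w(v) (\<zeta>\<^sub>1 - v)\<close>, whose law given \<open>\<zeta>\<^sub>1 > v\<close> converges only weakly; this needs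
  convergence along moving shifts \<open>s\<^sub>v \<longrightarrow> s\<close>. It comes from a rigidity property of Gaussian
  variables. Tightness at \<open>s = 0\<close> and \<open>v w(v) \<longrightarrow> \<infinity>\<close> say that the unnormalized risk divided by \<open>v\<close>
  tends to 1 in probability. As \<open>m \<ge> 2\<close>, this risk contains the square of a centered Gaussian
  variable that is independent of all the rest, and adding an independent quantity cannot cancel the spread of
  that square, so \<open>W / sqrt v \<longrightarrow> 0\<close> in probability (\<open>perturbation_negligible\<close>) and then
  \<open>\<rho>\<^sub>j\<^sup>2 \<longrightarrow> 1\<close> (\<open>coefficient_square_tendsto_1\<close>). Therefore moving \<open>s\<close> just translates the limit by
  \<open>s\<close> (\<open>risk_conv_moving_shift\<close>). Finally the exceedances, which converge to the exponential law,
  are realized on one probability space so that they converge pointwise, and dominated convergence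
  gives the joint limit (\<open>exceedance_limit\<close>).
\<close>

section \<open>Characteristic functions determine finite measures on Euclidean spaces\<close>

text \<open>Levy's uniqueness theorem concerns probability measures; dividing by the total mass, which is
  the characteristic function at 0, extends it to finite measures.\<close>
lemma finite_real_measure_eqI_char:
  fixes \<mu> \<nu> :: "real measure"
  assumes "finite_measure \<mu>" "finite_measure \<nu>"
    and [simp, measurable_cong]: "sets \<mu> = sets borel" "sets \<nu> = sets borel"
    and char: "\<And>t. char \<mu> t = char \<nu> t"
  shows "\<mu> = \<nu>"
proof -
  interpret \<mu>: finite_measure \<mu> by fact
  interpret \<nu>: finite_measure \<nu> by fact
  have sp: "space \<mu> = UNIV" "space \<nu> = UNIV"
    using sets_eq_imp_space_eq[of \<mu> borel] sets_eq_imp_space_eq[of \<nu> borel] by auto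
  define c where "c = measure \<mu> UNIV"
  have c: "c = measure \<nu> UNIV"
    using char[of 0] by (simp add: char_def c_def sp)
  have em: "emeasure \<mu> UNIV = ennreal c" "emeasure \<nu> UNIV = ennreal c"
    unfolding c_def by (simp_all add: \<mu>.emeasure_eq_measure \<nu>.emeasure_eq_measure c[unfolded c_def])
  show ?thesis
  proof (cases "c = 0")
    case True
    have "emeasure \<mu> A = 0" "emeasure \<nu> A = 0" for A
      using emeasure_space[of \<mu> A] emeasure_space[of \<nu> A] em True by (auto simp: sp)
    then show ?thesis by (intro measure_eqI) auto
  next
    case False
    then have cpos: "c > 0" by (simp add: c_def zero_less_measure_iff)
    let ?n = "\<lambda>\<mu>::real measure. density \<mu> (\<lambda>_. ennreal (1/c))"
    have cc: "ennreal (1/c) * ennreal c = 1"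
      using cpos by (subst ennreal_mult[symmetric]) (auto simp: ennreal_1[symmetric] simp del: ennreal_1)
    have rd: "real_distribution (?n \<mu>)" "real_distribution (?n \<nu>)"
      unfolding real_distribution_def real_distribution_axioms_def
      using cc by (auto intro!: prob_spaceI simp: emeasure_density_const sp em)
    have "char (?n \<mu>) = char (?n \<nu>)"
    proof
      fix t
      have "char (?n \<mu>) t = (1/c) *\<^sub>R char \<mu> t" "char (?n \<nu>) t = (1/c) *\<^sub>R char \<nu> t"
        using cpos unfolding char_def by (subst integral_density; simp)+
      then show "char (?n \<mu>) t = char (?n \<nu>) t" using char by simp
    qed
    then have eq: "?n \<mu> = ?n \<nu>" by (intro Levy_uniqueness rd)
    show ?thesis
    proof (rule measure_eqI)
      fix A assume "A \<in> sets \<mu>"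
      then have [measurable]: "A \<in> sets borel" by simp
      have "ennreal (1/c) * emeasure \<mu> A = ennreal (1/c) * emeasure \<nu> A"
        using arg_cong[OF eq, of "\<lambda>M. emeasure M A"] by (simp add: emeasure_density_const)
      then have "ennreal c * (ennreal (1/c) * emeasure \<mu> A) = ennreal c * (ennreal (1/c) * emeasure \<nu> A)"
        by simp
      then show "emeasure \<mu> A = emeasure \<nu> A"
        unfolding mult.assoc[symmetric] mult.commute[of "ennreal c"] cc by simp
    qed simp
  qed
qed

text \<open>Finite rather than probability measures are considered, since the induction over the
  coordinates below restricts the measures to slabs.\<close>
definition same_char :: "'a::euclidean_space measure \<Rightarrow> 'a measure \<Rightarrow> bool" where
  "same_char \<mu> \<nu> \<longleftrightarrow> finite_measure \<mu> \<and> finite_measure \<nu> \<and>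
     sets \<mu> = sets borel \<and> sets \<nu> = sets borel \<and>
     (\<forall>t. (CLINT x|\<mu>. iexp (t \<bullet> x)) = (CLINT x|\<nu>. iexp (t \<bullet> x)))"

text \<open>Tilting \<open>\<mu>\<close> by a density of the form \<open>1 + Re (c e\<^bsup>i t x\<^esup>)\<close>, nonnegative for \<open>|c| \<le> 1\<close>, keeps the
  one-dimensional characteristic functions within reach: that of the projection to \<open>b\<close> is a linear
  combination of values of the characteristic function of \<open>\<mu>\<close>. This is what lets the uniqueness
  theorem on the line, which needs nonnegative measures, see oscillating weights.\<close>
lemma
  fixes \<mu> :: "'a::euclidean_space measure" and c :: complex and t b :: 'a
  assumes fin: "finite_measure \<mu>" and [simp, measurable_cong]: "sets \<mu> = sets borel"
    and c: "norm c \<le> 1"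
  defines "g \<equiv> \<lambda>x. 1 + Re (c * iexp (t \<bullet> x))"
  defines "\<nu> \<equiv> distr (density \<mu> (\<lambda>x. ennreal (g x))) borel (\<lambda>x. x \<bullet> b)"
  shows finite_measure_tilted: "finite_measure \<nu>"
    and measure_tilted: "A \<in> sets borel \<Longrightarrow> measure \<nu> A = (LINT x|\<mu>. indicator A (x \<bullet> b) * g x)"
    and char_tilted: "char \<nu> s = (CLINT x|\<mu>. iexp (s *\<^sub>R b \<bullet> x)) +
           c / 2 * (CLINT x|\<mu>. iexp ((s *\<^sub>R b + t) \<bullet> x)) +
           cnj c / 2 * (CLINT x|\<mu>. iexp ((s *\<^sub>R b - t) \<bullet> x))"
proof -
  interpret finite_measure \<mu> by fact
  have g01: "0 \<le> g x" "g x \<le> 2" for x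
    using abs_Re_le_cmod[of "c * iexp (t \<bullet> x)"] c by (auto simp: g_def norm_mult)
  have gm[measurable]: "g \<in> borel_measurable borel" unfolding g_def by measurable
  have "emeasure (density \<mu> (\<lambda>x. ennreal (g x))) (space \<mu>) = (\<integral>\<^sup>+x. ennreal (g x) \<partial>\<mu>)"
    using sets.top[of \<mu>] by (subst emeasure_density) (auto intro!: nn_integral_cong split: split_indicator)
  also have "\<dots> \<le> (\<integral>\<^sup>+x. ennreal 2 \<partial>\<mu>)"
    using g01 by (intro nn_integral_mono ennreal_leI)
  also have "\<dots> < \<infinity>"
    by (simp add: emeasure_eq_measure ennreal_mult_eq_top_iff less_top[symmetric])
  finally show "finite_measure \<nu>"
    unfolding \<nu>_def by (intro finite_measure.finite_measure_distr finite_measureI) auto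
  show "measure \<nu> A = (LINT x|\<mu>. indicator A (x \<bullet> b) * g x)" if [measurable]: "A \<in> sets borel"
  proof -
    have "measure \<nu> A = (LINT z|\<nu>. indicator A z)" by (simp add: \<nu>_def)
    also have "\<dots> = (LINT x|\<mu>. g x *\<^sub>R indicator A (x \<bullet> b))"
      unfolding \<nu>_def using g01 by (subst integral_distr; simp) (subst integral_density; simp)
    finally show ?thesis by (simp add: mult.commute)
  qed
  have int: "integrable \<mu> (\<lambda>x. iexp (u \<bullet> x))" for u :: 'a
    by (rule integrable_const_bound[where B=1]) auto
  have alg: "(1 + (c * e + d * f) / 2) * a = a + c / 2 * (a * e) + d / 2 * (a * f)" for a c d e f :: complex
    by (simp add: field_simps)
  have "char \<nu> s = (CLINT x|\<mu>. g x *\<^sub>R iexp (s * (x \<bullet> b)))"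
    unfolding char_def \<nu>_def using g01 by (subst integral_distr; simp) (subst integral_density; simp)
  also have "\<dots> = (CLINT x|\<mu>. iexp (s *\<^sub>R b \<bullet> x) +
     c / 2 * iexp ((s *\<^sub>R b + t) \<bullet> x) + cnj c / 2 * iexp ((s *\<^sub>R b - t) \<bullet> x))"
  proof (rule Bochner_Integration.integral_cong[OF refl])
    fix x
    have e: "cnj (iexp (t \<bullet> x)) = iexp (- (t \<bullet> x))"
      by (simp add: exp_cnj)
    have 1: "complex_of_real (g x) = 1 + (c * iexp (t \<bullet> x) + cnj c * iexp (- (t \<bullet> x))) / 2"
      using complex_add_cnj[of "c * iexp (t \<bullet> x)"] unfolding complex_cnj_mult e g_def
      by (simp only: of_real_add of_real_1 of_real_mult) simp
    have 2: "iexp ((s *\<^sub>R b + t) \<bullet> x) = iexp (s * (x \<bullet> b)) * iexp (t \<bullet> x)"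
         "iexp ((s *\<^sub>R b - t) \<bullet> x) = iexp (s * (x \<bullet> b)) * iexp (- (t \<bullet> x))"
      by (simp_all only: exp_add[symmetric] inner_add_left inner_minus_left inner_scaleR_left
           inner_commute[of b x] of_real_add of_real_diff of_real_minus distrib_left right_diff_distrib
           diff_conv_add_uminus mult_minus_right)
    have 3: "s *\<^sub>R b \<bullet> x = s * (x \<bullet> b)" by (simp add: inner_commute)
    show "g x *\<^sub>R iexp (s * (x \<bullet> b)) = iexp (s *\<^sub>R b \<bullet> x) +
        c / 2 * iexp ((s *\<^sub>R b + t) \<bullet> x) + cnj c / 2 * iexp ((s *\<^sub>R b - t) \<bullet> x)"
      unfolding scaleR_conv_of_real 1 2 3 by (rule alg)
  qed
  also have "\<dots> = (CLINT x|\<mu>. iexp (s *\<^sub>R b \<bullet> x)) +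
     c / 2 * (CLINT x|\<mu>. iexp ((s *\<^sub>R b + t) \<bullet> x)) +
     cnj c / 2 * (CLINT x|\<mu>. iexp ((s *\<^sub>R b - t) \<bullet> x))"
    using int by (simp only: Bochner_Integration.integral_add integral_mult_right_zero
       Bochner_Integration.integrable_add integrable_mult_right)
  finally show "char \<nu> s = (CLINT x|\<mu>. iexp (s *\<^sub>R b \<bullet> x)) +
           c / 2 * (CLINT x|\<mu>. iexp ((s *\<^sub>R b + t) \<bullet> x)) +
           cnj c / 2 * (CLINT x|\<mu>. iexp ((s *\<^sub>R b - t) \<bullet> x))" .
qed

lemma same_char_tilted:
  fixes \<mu> \<nu> :: "'a::euclidean_space measure"
  assumes sc: "same_char \<mu> \<nu>" and A: "A \<in> sets borel" and c: "norm c \<le> 1"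
  shows "(LINT x|\<mu>. indicator A (x \<bullet> b) * (1 + Re (c * iexp (t \<bullet> x)))) =
         (LINT x|\<nu>. indicator A (x \<bullet> b) * (1 + Re (c * iexp (t \<bullet> x))))"
proof -
  have fin: "finite_measure \<mu>" "finite_measure \<nu>"
    and st: "sets \<mu> = sets borel" "sets \<nu> = sets borel"
    and eq: "\<And>t. (CLINT x|\<mu>. iexp (t \<bullet> x)) = (CLINT x|\<nu>. iexp (t \<bullet> x))"
    using sc by (auto simp: same_char_def)
  let ?p = "\<lambda>\<mu>. distr (density \<mu> (\<lambda>x. ennreal (1 + Re (c * iexp (t \<bullet> x))))) borel (\<lambda>x. x \<bullet> b)"
  have eqp: "?p \<mu> = ?p \<nu>"
  proof (rule finite_real_measure_eqI_char)
    show "finite_measure (?p \<mu>)" "finite_measure (?p \<nu>)"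
      by (rule finite_measure_tilted; fact)+
    show "char (?p \<mu>) s = char (?p \<nu>) s" for s
      unfolding char_tilted[OF fin(1) st(1) c] char_tilted[OF fin(2) st(2) c] by (simp only: eq)
  qed simp_all
  have "measure (?p \<mu>) A = measure (?p \<nu>) A"
    by (simp only: eqp)
  then show ?thesis
    unfolding measure_tilted[OF fin(1) st(1) c A] measure_tilted[OF fin(2) st(2) c A] .
qed

text \<open>The oscillating integrals over a slab are recovered from the tilted masses by subtracting the
  mass for \<open>c = 0\<close>; \<open>c = 1\<close> gives the real part and \<open>c = -i\<close> the imaginary part.\<close>
lemma Re_integral_slab:
  fixes \<mu> :: "'a::euclidean_space measure"
  assumes "finite_measure \<mu>" and [simp, measurable_cong]: "sets \<mu> = sets borel"
    and [measurable]: "A \<in> sets borel"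
  shows "Re (c * (CLINT x|\<mu>. indicator A (x \<bullet> b) *\<^sub>R iexp (t \<bullet> x))) =
    (LINT x|\<mu>. indicator A (x \<bullet> b) * (1 + Re (c * iexp (t \<bullet> x)))) - (LINT x|\<mu>. indicator A (x \<bullet> b))"
proof -
  interpret finite_measure \<mu> by fact
  have int: "integrable \<mu> (\<lambda>x. c * indicator A (x \<bullet> b) *\<^sub>R iexp (t \<bullet> x))"
  proof (rule integrable_const_bound[where B="norm c"], rule AE_I2)
    show "norm (c * indicator A (x \<bullet> b) *\<^sub>R iexp (t \<bullet> x)) \<le> norm c" for x
      by (cases "x \<bullet> b \<in> A") (auto simp: norm_mult)
  qed measurable
  have int1: "integrable \<mu> (\<lambda>x. indicator A (x \<bullet> b) :: real)"
    by (rule integrable_const_bound[where B=1]) auto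
  have "Re (c * (CLINT x|\<mu>. indicator A (x \<bullet> b) *\<^sub>R iexp (t \<bullet> x))) =
        Re (CLINT x|\<mu>. c * indicator A (x \<bullet> b) *\<^sub>R iexp (t \<bullet> x))"
    by (simp only: integral_mult_right_zero)
  also have "\<dots> = (LINT x|\<mu>. Re (c * indicator A (x \<bullet> b) *\<^sub>R iexp (t \<bullet> x)))"
    by (rule integral_Re[OF int, symmetric])
  also have "\<dots> = (LINT x|\<mu>. indicator A (x \<bullet> b) * (1 + Re (c * iexp (t \<bullet> x))) - indicator A (x \<bullet> b))"
    by (intro Bochner_Integration.integral_cong refl) (auto simp: indicator_def)
  also have "\<dots> = (LINT x|\<mu>. indicator A (x \<bullet> b) * (1 + Re (c * iexp (t \<bullet> x)))) - (LINT x|\<mu>. indicator A (x \<bullet> b))"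
  proof (intro Bochner_Integration.integral_diff int1)
    show "integrable \<mu> (\<lambda>x. indicator A (x \<bullet> b) * (1 + Re (c * iexp (t \<bullet> x))))"
    proof (rule integrable_const_bound[where B="1 + norm c"], rule AE_I2)
      show "norm (indicator A (x \<bullet> b) * (1 + Re (c * iexp (t \<bullet> x)))) \<le> 1 + norm c" for x
        using abs_Re_le_cmod[of "c * iexp (t \<bullet> x)"] by (cases "x \<bullet> b \<in> A") (auto simp: norm_mult)
    qed measurable
  qed
  finally show ?thesis .
qed

text \<open>Equality of characteristic functions survives the restriction to a slab orthogonal to \<open>b\<close>: by
  the one-dimensional theorem the tilted measures agree on slabs, for all frequencies \<open>t\<close> of the tilt.\<close>
lemma same_char_density_slab:
  fixes \<mu> \<nu> :: "'a::euclidean_space measure"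
  assumes sc: "same_char \<mu> \<nu>" and A[measurable]: "A \<in> sets borel"
  shows "same_char (density \<mu> (indicator {x. x \<bullet> b \<in> A})) (density \<nu> (indicator {x. x \<bullet> b \<in> A}))"
proof -
  have fin: "finite_measure \<mu>" "finite_measure \<nu>"
    and st: "sets \<mu> = sets borel" "sets \<nu> = sets borel"
    using sc by (auto simp: same_char_def)
  let ?S = "{x. x \<bullet> b \<in> A}"
  have S: "?S \<in> sets borel"
    using measurable_sets[of "\<lambda>x. x \<bullet> b" borel borel A] by (simp add: vimage_def)
  have "Re (c * (CLINT x|\<mu>. indicator A (x \<bullet> b) *\<^sub>R iexp (t \<bullet> x))) =
        Re (c * (CLINT x|\<nu>. indicator A (x \<bullet> b) *\<^sub>R iexp (t \<bullet> x)))" if "norm c \<le> 1" for c t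
    using Re_integral_slab[OF fin(1) st(1) A, of c b t] Re_integral_slab[OF fin(2) st(2) A, of c b t]
      same_char_tilted[OF sc A that, of b t] same_char_tilted[OF sc A, of 0 b t] by simp
  from this[of 1] this[of "-\<i>"]
  have eqS: "(CLINT x|\<mu>. indicator A (x \<bullet> b) *\<^sub>R iexp (t \<bullet> x)) =
             (CLINT x|\<nu>. indicator A (x \<bullet> b) *\<^sub>R iexp (t \<bullet> x))" for t
    by (intro complex_eqI) simp_all
  have fd: "finite_measure (density \<mu> (indicator ?S))" if "finite_measure \<mu>" "sets \<mu> = sets borel" for \<mu> :: "'a measure"
    using that S by (intro finite_measure.finite_measure_restricted) auto
  have cd: "(CLINT x|density \<mu> (indicator ?S). iexp (t \<bullet> x)) = (CLINT x|\<mu>. indicator A (x \<bullet> b) *\<^sub>R iexp (t \<bullet> x))"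
    if [simp, measurable_cong]: "sets \<mu> = sets borel" for \<mu> :: "'a measure" and t
  proof -
    have "density \<mu> (indicator ?S) = density \<mu> (\<lambda>x. ennreal (indicator A (x \<bullet> b)))"
      by (rule arg_cong[where f="density \<mu>"]) (auto simp: indicator_def)
    then show ?thesis by (simp only:) (subst integral_density; simp)
  qed
  show ?thesis
    unfolding same_char_def using fd fin st eqS by (auto simp: cd)
qed

text \<open>Restriction to one slab after another reaches every box, and the value of the characteristic
  function at 0 is the total mass.\<close>
lemma same_char_emeasure_slabs:
  fixes \<mu> \<nu> :: "'a::euclidean_space measure"
  assumes "finite S" "same_char \<mu> \<nu>" "\<And>b. A b \<in> sets borel"
  shows "emeasure \<mu> {x. \<forall>b\<in>S. x \<bullet> b \<in> A b} = emeasure \<nu> {x. \<forall>b\<in>S. x \<bullet> b \<in> A b}"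
  using assms(1,2)
proof (induction S arbitrary: \<mu> \<nu>)
  case empty
  then interpret \<mu>: finite_measure \<mu> + \<nu>: finite_measure \<nu> by (auto simp: same_char_def)
  have "space \<mu> = UNIV" "space \<nu> = UNIV"
    using empty sets_eq_imp_space_eq[of \<mu> borel] sets_eq_imp_space_eq[of \<nu> borel] by (auto simp: same_char_def)
  moreover have "(CLINT x|\<mu>. iexp (0 \<bullet> x)) = (CLINT x|\<nu>. iexp (0 \<bullet> x))"
    using empty unfolding same_char_def by blast
  ultimately show ?case by (simp add: \<mu>.emeasure_eq_measure \<nu>.emeasure_eq_measure)
next
  case (insert b S)
  note [measurable] = assms(3)
  have sb: "{x. x \<bullet> b \<in> A b} \<in> sets borel" for b
    using measurable_sets[of "\<lambda>x. x \<bullet> b" borel borel "A b"] by (simp add: vimage_def)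
  have SS: "{x. \<forall>b\<in>S. x \<bullet> b \<in> A b} \<in> sets borel"
  proof -
    have "{x. \<forall>b\<in>S. x \<bullet> b \<in> A b} = (\<Inter>b\<in>S. {x. x \<bullet> b \<in> A b}) \<inter> UNIV" by auto
    then show ?thesis using sb insert.hyps(1) by (cases "S = {}") (auto intro!: sets.finite_INT)
  qed
  have "emeasure \<mu> {x. \<forall>b\<in>insert b S. x \<bullet> b \<in> A b} =
      emeasure (density \<mu> (indicator {x. x \<bullet> b \<in> A b})) {x. \<forall>b\<in>S. x \<bullet> b \<in> A b}"
    if "sets \<mu> = sets borel" for \<mu> :: "'a measure"
    using SS sb that by (subst emeasure_restricted) (auto intro!: arg_cong[where f="emeasure \<mu>"])
  moreover have "emeasure (density \<mu> (indicator {x. x \<bullet> b \<in> A b})) {x. \<forall>b\<in>S. x \<bullet> b \<in> A b} =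
      emeasure (density \<nu> (indicator {x. x \<bullet> b \<in> A b})) {x. \<forall>b\<in>S. x \<bullet> b \<in> A b}"
    by (intro insert.IH same_char_density_slab insert.prems assms)
  ultimately show ?case using insert.prems by (simp add: same_char_def)
qed

lemma measure_eqI_same_char:
  fixes \<mu> \<nu> :: "'a::euclidean_space measure"
  assumes "same_char \<mu> \<nu>"
  shows "\<mu> = \<nu>"
proof (rule measure_eqI_generator_eq)
  let ?E = "range (\<lambda>(a, b). box a b :: 'a set)"
  let ?A = "\<lambda>n::nat. box (- (real n *\<^sub>R One)) (real n *\<^sub>R One) :: 'a set"
  interpret \<mu>: finite_measure \<mu> using assms by (simp add: same_char_def)
  show "Int_stable ?E" by (auto simp: Int_stable_def box_Int_box)
  show "?E \<subseteq> Pow UNIV" "sets \<mu> = sigma_sets UNIV ?E" "sets \<nu> = sigma_sets UNIV ?E"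
    using assms by (auto simp: same_char_def borel_eq_box)
  show "range ?A \<subseteq> ?E" "(\<Union>i. ?A i) = UNIV" unfolding UN_box_eq_UNIV by auto
  show "emeasure \<mu> (?A i) \<noteq> \<infinity>" for i by simp
  fix B assume "B \<in> ?E"
  then obtain l u where B: "B = box l u" by auto
  have "box l u = {x. \<forall>b\<in>Basis. x \<bullet> b \<in> {l \<bullet> b<..<u \<bullet> b}}" by (auto simp: box_def)
  then show "emeasure \<mu> B = emeasure \<nu> B"
    unfolding B by (simp only:) (rule same_char_emeasure_slabs, auto intro: assms)
qed

section \<open>Convergence in distribution\<close>

lemma conv_in_distribution_cong:
  assumes "conv_in_distribution \<mu> \<nu> F" "\<forall>\<^sub>F v in F. \<mu>' v = \<mu> v"
  shows "conv_in_distribution \<mu>' \<nu> F"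
  unfolding conv_in_distribution_def
proof (intro allI impI)
  fix f :: "'b \<Rightarrow> real" assume f: "continuous_on UNIV f" "bounded (range f)"
  then have "((\<lambda>v. integral\<^sup>L (\<mu> v) f) \<longlongrightarrow> integral\<^sup>L \<nu> f) F"
    using assms(1) by (auto simp: conv_in_distribution_def)
  moreover have "\<forall>\<^sub>F v in F. integral\<^sup>L (\<mu> v) f = integral\<^sup>L (\<mu>' v) f"
    using assms(2) by eventually_elim simp
  ultimately show "((\<lambda>v. integral\<^sup>L (\<mu>' v) f) \<longlongrightarrow> integral\<^sup>L \<nu> f) F"
    by (rule Lim_transform_eventually)
qed

lemma conv_in_distribution_compose:
  assumes "conv_in_distribution \<mu> \<nu> F" "filterlim u F F'"
  shows "conv_in_distribution (\<lambda>n. \<mu> (u n)) \<nu> F'"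
  using assms unfolding conv_in_distribution_def by (auto intro: filterlim_compose)

lemma conv_in_distribution_continuous_image:
  fixes g :: "'b::topological_space \<Rightarrow> 'c::topological_space"
  assumes conv: "conv_in_distribution (\<lambda>v. distr M borel (Y v)) (distr N borel V) F"
    and g: "continuous_on UNIV g"
    and Y: "\<forall>\<^sub>F v in F. Y v \<in> borel_measurable M" and V: "V \<in> borel_measurable N"
  shows "conv_in_distribution (\<lambda>v. distr M borel (\<lambda>\<omega>. g (Y v \<omega>))) (distr N borel (\<lambda>\<omega>. g (V \<omega>))) F"
  unfolding conv_in_distribution_def
proof (intro allI impI)
  fix f :: "'c \<Rightarrow> real" assume f: "continuous_on UNIV f" "bounded (range f)"
  note [measurable] = borel_measurable_continuous_onI[OF f(1)] borel_measurable_continuous_onI[OF g] V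
  have fg: "continuous_on UNIV (\<lambda>x. f (g x))"
    by (intro continuous_on_compose2[OF f(1)] g) auto
  note [measurable] = borel_measurable_continuous_onI[OF fg]
  have b: "bounded (range (\<lambda>x. f (g x)))" by (rule bounded_subset[OF f(2)]) auto
  have "((\<lambda>v. integral\<^sup>L (distr M borel (Y v)) (\<lambda>x. f (g x))) \<longlongrightarrow>
         integral\<^sup>L (distr N borel V) (\<lambda>x. f (g x))) F"
    using conv fg b by (auto simp: conv_in_distribution_def)
  moreover have "\<forall>\<^sub>F v in F. integral\<^sup>L (distr M borel (Y v)) (\<lambda>x. f (g x)) =
      integral\<^sup>L (distr M borel (\<lambda>\<omega>. g (Y v \<omega>))) f"
    using Y
  proof eventually_elim
    fix v assume [measurable]: "Y v \<in> borel_measurable M"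
    show "integral\<^sup>L (distr M borel (Y v)) (\<lambda>x. f (g x)) = integral\<^sup>L (distr M borel (\<lambda>\<omega>. g (Y v \<omega>))) f"
      by (simp add: integral_distr)
  qed
  moreover have "integral\<^sup>L (distr N borel V) (\<lambda>x. f (g x)) = integral\<^sup>L (distr N borel (\<lambda>\<omega>. g (V \<omega>))) f"
    by (simp add: integral_distr)
  ultimately show "((\<lambda>v. integral\<^sup>L (distr M borel (\<lambda>\<omega>. g (Y v \<omega>))) f) \<longlongrightarrow> integral\<^sup>L (distr N borel (\<lambda>\<omega>. g (V \<omega>))) f) F"
    by (simp add: Lim_transform_eventually)
qed

text \<open>Weak convergence to a probability measure entails tightness: the cutoff functions
  \<open>min 1 (max 0 (|x| - n))\<close> are continuous, bounded, dominate the indicator of \<open>|x| > n + 1\<close>, and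
  have small integral under the limit for large \<open>n\<close>.\<close>
lemma conv_in_distribution_tight:
  fixes Y :: "'i \<Rightarrow> 'w \<Rightarrow> 'a::euclidean_space"
  assumes M: "prob_space M" and \<nu>: "prob_space \<nu>" "sets \<nu> = sets borel"
    and Y: "\<forall>\<^sub>F v in F. Y v \<in> borel_measurable M"
    and conv: "conv_in_distribution (\<lambda>v. distr M borel (Y v)) \<nu> F" and "0 < \<epsilon>"
  obtains R where "R > 0" "\<forall>\<^sub>F v in F. measure M {\<omega> \<in> space M. norm (Y v \<omega>) > R} < \<epsilon>"
proof -
  interpret M: prob_space M by fact
  interpret \<nu>: prob_space \<nu> by fact
  note [simp, measurable_cong] = \<nu>(2)
  have sp: "space \<nu> = UNIV" using sets_eq_imp_space_eq[OF \<nu>(2)] by simp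
  define g where "g n x = min 1 (max 0 (norm x - real n))" for n and x :: 'a
  have gc: "continuous_on UNIV (g n)" for n unfolding g_def by (intro continuous_intros)
  have [measurable]: "g n \<in> borel_measurable borel" for n
    by (rule borel_measurable_continuous_onI[OF gc])
  have gb: "bounded (range (g n))" for n
    by (rule boundedI[where B=1]) (auto simp: g_def)
  have "(\<lambda>n. LINT x|\<nu>. g n x) \<longlonglongrightarrow> (LINT x|\<nu>. 0)"
  proof (rule integral_dominated_convergence[where w="\<lambda>_. 1"])
    show "AE x in \<nu>. (\<lambda>n. g n x) \<longlonglongrightarrow> 0"
    proof (rule AE_I2)
      fix x
      have "eventually (\<lambda>n. g n x = 0) sequentially"
        using eventually_ge_at_top[of "nat \<lceil>norm x\<rceil>"]
        by eventually_elim (auto simp: g_def nat_ceiling_le_eq)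
      then show "(\<lambda>n. g n x) \<longlonglongrightarrow> 0" by (rule tendsto_eventually)
    qed
  qed (auto simp: g_def)
  then have "\<forall>\<^sub>F n in sequentially. (LINT x|\<nu>. g n x) < \<epsilon>"
    using \<open>0 < \<epsilon>\<close> by (intro order_tendstoD) auto
  then obtain n where n: "(LINT x|\<nu>. g n x) < \<epsilon>"
    by (auto simp: eventually_sequentially)
  have "((\<lambda>v. integral\<^sup>L (distr M borel (Y v)) (g n)) \<longlongrightarrow> integral\<^sup>L \<nu> (g n)) F"
    using conv gc gb by (auto simp: conv_in_distribution_def)
  then have "\<forall>\<^sub>F v in F. integral\<^sup>L (distr M borel (Y v)) (g n) < \<epsilon>"
    using n by (rule order_tendstoD)
  with Y have "\<forall>\<^sub>F v in F. measure M {\<omega> \<in> space M. norm (Y v \<omega>) > real n + 1} < \<epsilon>"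
  proof eventually_elim
    fix v assume [measurable]: "Y v \<in> borel_measurable M" and less: "integral\<^sup>L (distr M borel (Y v)) (g n) < \<epsilon>"
    have "measure M {\<omega> \<in> space M. norm (Y v \<omega>) > real n + 1} =
          (LINT \<omega>|M. indicator {\<omega> \<in> space M. norm (Y v \<omega>) > real n + 1} \<omega>)"
      by simp
    also have "\<dots> \<le> (LINT \<omega>|M. g n (Y v \<omega>))"
      by (rule integral_mono)
        (auto simp: g_def split: split_indicator intro!: M.integrable_const_bound[where B=1])
    also have "\<dots> = integral\<^sup>L (distr M borel (Y v)) (g n)"
      by (simp add: integral_distr)
    finally show "measure M {\<omega> \<in> space M. norm (Y v \<omega>) > real n + 1} < \<epsilon>"
      using less by simp
  qed
  then show ?thesis by (intro that[of "real n + 1"]) auto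
qed

text \<open>A version of Slutsky's theorem in which \<open>Z - Y\<close> has to be small only where \<open>Y\<close> stays bounded.
  Tightness makes up for the rest, and it allows \<open>Z\<close> to arise from \<open>Y\<close> by multiplication with
  factors that tend to 1.\<close>
lemma conv_in_distribution_slutsky:
  fixes Y Z :: "'i \<Rightarrow> 'w \<Rightarrow> 'a::euclidean_space"
  assumes M: "prob_space M" and \<nu>: "prob_space \<nu>" "sets \<nu> = sets borel"
    and Y: "\<forall>\<^sub>F v in F. Y v \<in> borel_measurable M"
    and Z: "\<forall>\<^sub>F v in F. Z v \<in> borel_measurable M"
    and conv: "conv_in_distribution (\<lambda>v. distr M borel (Y v)) \<nu> F"
    and near: "\<And>R \<epsilon>. 0 < \<epsilon> \<Longrightarrow>
      ((\<lambda>v. measure M {\<omega> \<in> space M. norm (Y v \<omega>) \<le> R \<and> norm (Z v \<omega> - Y v \<omega>) > \<epsilon>}) \<longlongrightarrow> 0) F"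
  shows "conv_in_distribution (\<lambda>v. distr M borel (Z v)) \<nu> F"
  unfolding conv_in_distribution_def
proof (intro allI impI)
  interpret M: prob_space M by fact
  fix f :: "'a \<Rightarrow> real" assume f: "continuous_on UNIV f" "bounded (range f)"
  obtain B where B: "B > 0" "\<And>x. \<bar>f x\<bar> \<le> B"
    using f(2) by (auto simp: bounded_pos)
  note [measurable] = borel_measurable_continuous_onI[OF f(1)]
  have lim: "((\<lambda>v. integral\<^sup>L (distr M borel (Y v)) f) \<longlongrightarrow> integral\<^sup>L \<nu> f) F"
    using conv f by (auto simp: conv_in_distribution_def)
  have diff: "((\<lambda>v. integral\<^sup>L (distr M borel (Z v)) f - integral\<^sup>L (distr M borel (Y v)) f) \<longlongrightarrow> 0) F"
  proof (rule tendstoI)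
    fix e :: real assume "0 < e"
    \<comment> \<open>The error is \<open>e'\<close> from uniform continuity plus \<open>2 B\<close> for each of two events of probability \<open>e'\<close>; \<open>e'\<close> makes this \<open>e / 2\<close>.\<close>
    define e' where "e' = e / (2 * (1 + 4 * B))"
    have eq: "e' * (1 + 4 * B) = e / 2"
      unfolding e'_def using B(1) by (simp add: divide_eq_eq)
    have "e' + 2 * B * (e' + e') = e' * (1 + 4 * B)" by (simp add: algebra_simps)
    then have e': "e' > 0" "e' + 2 * B * (e' + e') < e"
      using \<open>0 < e\<close> B(1) by (simp add: e'_def, simp only: eq)
    obtain R where R: "R > 0" "\<forall>\<^sub>F v in F. measure M {\<omega> \<in> space M. norm (Y v \<omega>) > R} < e'"
      using conv_in_distribution_tight[OF M \<nu> Y conv e'(1)] .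
    have "uniformly_continuous_on (cball 0 (R + 1)) f"
      by (intro compact_uniformly_continuous continuous_on_subset[OF f(1)]) auto
    then obtain d where d: "d > 0"
      "\<And>x y. norm x \<le> R + 1 \<Longrightarrow> norm y \<le> R + 1 \<Longrightarrow> dist y x < d \<Longrightarrow> dist (f y) (f x) < e'"
      using e'(1) unfolding uniformly_continuous_on_def by (metis mem_cball_0)
    define \<delta> where "\<delta> = min (d / 2) 1"
    have \<delta>: "0 < \<delta>" "\<delta> < d" "\<delta> \<le> 1" using d(1) by (auto simp: \<delta>_def)
    have "\<forall>\<^sub>F v in F. measure M {\<omega> \<in> space M. norm (Y v \<omega>) \<le> R \<and> norm (Z v \<omega> - Y v \<omega>) > \<delta>} < e'"
      by (intro order_tendstoD(2)[OF near] \<delta> e')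
    with R(2) Y Z show "\<forall>\<^sub>F v in F. dist (integral\<^sup>L (distr M borel (Z v)) f - integral\<^sup>L (distr M borel (Y v)) f) 0 < e"
    proof eventually_elim
      fix v
      assume [measurable]: "Y v \<in> borel_measurable M" "Z v \<in> borel_measurable M"
        and less: "measure M {\<omega> \<in> space M. norm (Y v \<omega>) > R} < e'"
          "measure M {\<omega> \<in> space M. norm (Y v \<omega>) \<le> R \<and> norm (Z v \<omega> - Y v \<omega>) > \<delta>} < e'"
      let ?S = "{\<omega> \<in> space M. norm (Y v \<omega>) > R}"
      let ?T = "{\<omega> \<in> space M. norm (Y v \<omega>) \<le> R \<and> norm (Z v \<omega> - Y v \<omega>) > \<delta>}"
      have int: "integrable M (\<lambda>\<omega>. f (Z v \<omega>))" "integrable M (\<lambda>\<omega>. f (Y v \<omega>))"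
        using B by (auto intro!: M.integrable_const_bound[where B=B])
      have int2: "integrable M (indicator ?S :: _ \<Rightarrow> real)" "integrable M (indicator ?T :: _ \<Rightarrow> real)"
        by (auto intro!: M.integrable_const_bound[where B=1])
      have "\<bar>f (Z v \<omega>) - f (Y v \<omega>)\<bar> \<le> e' + 2 * B * (indicator ?S \<omega> + indicator ?T \<omega>)" if "\<omega> \<in> space M" for \<omega>
      proof (cases "\<omega> \<in> ?S \<union> ?T")
        case True
        then have "1 \<le> indicator ?S \<omega> + (indicator ?T \<omega> :: real)" by (auto split: split_indicator)
        then have "2 * B * 1 \<le> 2 * B * (indicator ?S \<omega> + indicator ?T \<omega>)"
          using B(1) by (intro mult_left_mono) auto
        moreover have "\<bar>f (Z v \<omega>) - f (Y v \<omega>)\<bar> \<le> 2 * B"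
          using B(2)[of "Z v \<omega>"] B(2)[of "Y v \<omega>"] by linarith
        ultimately show ?thesis using e'(1) by linarith
      next
        case False
        then have "norm (Y v \<omega>) \<le> R" "norm (Z v \<omega> - Y v \<omega>) \<le> \<delta>" using that by auto
        moreover from this have "norm (Z v \<omega>) \<le> R + 1"
          using norm_triangle_ineq[of "Y v \<omega>" "Z v \<omega> - Y v \<omega>"] \<delta>(3) by simp
        ultimately have "dist (f (Z v \<omega>)) (f (Y v \<omega>)) < e'"
          using \<delta> by (intro d(2)) (auto simp: dist_norm)
        moreover have "0 \<le> 2 * B * (indicator ?S \<omega> + indicator ?T \<omega>)" using B(1) by auto
        ultimately show ?thesis by (simp add: dist_real_def)
      qed
      then have "(LINT \<omega>|M. \<bar>f (Z v \<omega>) - f (Y v \<omega>)\<bar>) \<le>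
                 (LINT \<omega>|M. e' + 2 * B * (indicator ?S \<omega> + indicator ?T \<omega>))"
        using int int2 by (intro integral_mono) auto
      also have "\<dots> = e' + 2 * B * (measure M ?S + measure M ?T)"
        using int2 by (subst Bochner_Integration.integral_add) (simp_all add: M.prob_space)
      also have "\<dots> < e"
      proof -
        have "2 * B * (measure M ?S + measure M ?T) \<le> 2 * B * (e' + e')"
          using B(1) less by (intro mult_left_mono) auto
        with e'(2) show ?thesis by linarith
      qed
      finally have "(LINT \<omega>|M. \<bar>f (Z v \<omega>) - f (Y v \<omega>)\<bar>) < e" .
      moreover have "\<bar>LINT \<omega>|M. f (Z v \<omega>) - f (Y v \<omega>)\<bar> \<le> (LINT \<omega>|M. \<bar>f (Z v \<omega>) - f (Y v \<omega>)\<bar>)"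
        by (rule integral_abs_bound)
      ultimately show "dist (integral\<^sup>L (distr M borel (Z v)) f - integral\<^sup>L (distr M borel (Y v)) f) 0 < e"
        using int by (simp add: integral_distr)
    qed
  qed
  from tendsto_add[OF lim diff] show "((\<lambda>v. integral\<^sup>L (distr M borel (Z v)) f) \<longlongrightarrow> integral\<^sup>L \<nu> f) F"
    by simp
qed

section \<open>Rotation invariance of matrices with iid Gaussian rows\<close>

text \<open>Degenerate and nondegenerate projections are treated alike as multiples, possibly with factor 0,
  of a standard normal variable.\<close>
lemma centered_gaussian_vector_projection:
  assumes M: "prob_space M" and Y: "centered_gaussian_vector M Y"
  obtains \<sigma> where "\<sigma> \<ge> 0" "distr M borel (\<lambda>\<omega>. a \<bullet> Y \<omega>) = distr std_normal_distribution borel (\<lambda>z. \<sigma> * z)"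
proof -
  interpret prob_space M by fact
  interpret N: real_distribution std_normal_distribution by (rule real_dist_normal_dist)
  have [measurable]: "Y \<in> borel_measurable M" using Y by (simp add: centered_gaussian_vector_def)
  consider \<sigma> where "\<sigma> > 0" "distributed M lborel (\<lambda>\<omega>. a \<bullet> Y \<omega>) (normal_density 0 \<sigma>)" | "AE \<omega> in M. a \<bullet> Y \<omega> = 0"
    using Y by (auto simp: centered_gaussian_vector_def)
  then show ?thesis
  proof cases
    case 1
    then have "distributed M lborel (\<lambda>\<omega>. (a \<bullet> Y \<omega> - 0) / \<sigma>) std_normal_density"
      by (subst normal_standard_normal_convert[symmetric]) auto
    then have "distr M lborel (\<lambda>\<omega>. (a \<bullet> Y \<omega>) / \<sigma>) = std_normal_distribution"
      by (simp add: distributed_def)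
    moreover have "distr M lborel (\<lambda>\<omega>. (a \<bullet> Y \<omega>) / \<sigma>) = distr M borel (\<lambda>\<omega>. (a \<bullet> Y \<omega>) / \<sigma>)"
      by (rule distr_cong) auto
    ultimately have "distr std_normal_distribution borel (\<lambda>z. \<sigma> * z) = distr (distr M borel (\<lambda>\<omega>. (a \<bullet> Y \<omega>) / \<sigma>)) borel (\<lambda>z. \<sigma> * z)"
      by simp
    also have "\<dots> = distr M borel (\<lambda>\<omega>. a \<bullet> Y \<omega>)"
      using 1(1) by (subst distr_distr) (auto simp: comp_def)
    finally show ?thesis using 1(1) by (intro that[of \<sigma>]) auto
  next
    case 2
    have "distr M borel (\<lambda>\<omega>. a \<bullet> Y \<omega>) = distr M borel (\<lambda>\<omega>. 0)"
      using 2 by (intro distr_cong_AE) auto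
    also have "\<dots> = distr std_normal_distribution borel (\<lambda>z. 0 * z)"
    proof -
      have "\<And>N. prob_space N \<Longrightarrow> distr N borel (\<lambda>\<omega>. 0) = return borel (0::real)"
        by (rule prob_space.distr_const) auto
      then show ?thesis using M N.prob_space_axioms by simp
    qed
    finally show ?thesis by (intro that[of 0]) auto
  qed
qed

lemma centered_gaussian_vector_moments:
  assumes M: "prob_space M" and Y: "centered_gaussian_vector M Y"
  shows integrable_gaussian_square: "integrable M (\<lambda>\<omega>. (a \<bullet> Y \<omega>)\<^sup>2)"
    and gaussian_char: "(CLINT \<omega>|M. iexp (a \<bullet> Y \<omega>)) = of_real (exp (- (LINT \<omega>|M. (a \<bullet> Y \<omega>)\<^sup>2) / 2))"
proof -
  interpret prob_space M by fact
  have [measurable]: "Y \<in> borel_measurable M" using Y by (simp add: centered_gaussian_vector_def)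
  obtain \<sigma> where d: "distr M borel (\<lambda>\<omega>. a \<bullet> Y \<omega>) = distr std_normal_distribution borel (\<lambda>z. \<sigma> * z)"
    using centered_gaussian_vector_projection[OF M Y] .
  have "integrable std_normal_distribution (\<lambda>z. \<sigma>\<^sup>2 * z\<^sup>2)"
    by (intro integrable_mult_right integrable_std_normal_distribution_moment)
  then have "integrable (distr M borel (\<lambda>\<omega>. a \<bullet> Y \<omega>)) (\<lambda>z. z\<^sup>2)"
    unfolding d by (simp add: integrable_distr_eq power_mult_distrib)
  then show "integrable M (\<lambda>\<omega>. (a \<bullet> Y \<omega>)\<^sup>2)"
    by (simp add: integrable_distr_eq)
  have "(LINT \<omega>|M. (a \<bullet> Y \<omega>)\<^sup>2) = (LINT z|distr M borel (\<lambda>\<omega>. a \<bullet> Y \<omega>). z\<^sup>2)"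
    by (simp add: integral_distr)
  also have "\<dots> = (LINT z|std_normal_distribution. \<sigma>\<^sup>2 * z\<^sup>2)"
    unfolding d by (simp add: integral_distr power_mult_distrib)
  also have "\<dots> = \<sigma>\<^sup>2"
    using std_normal_distribution_even_moments(1)[of 1] by simp
  finally have v: "(LINT \<omega>|M. (a \<bullet> Y \<omega>)\<^sup>2) = \<sigma>\<^sup>2" .
  have "(CLINT \<omega>|M. iexp (a \<bullet> Y \<omega>)) = (CLINT z|distr M borel (\<lambda>\<omega>. a \<bullet> Y \<omega>). iexp z)"
    by (simp add: integral_distr)
  also have "\<dots> = char std_normal_distribution \<sigma>"
    unfolding d char_def by (simp add: integral_distr)
  also have "\<dots> = of_real (exp (- \<sigma>\<^sup>2 / 2))"
    unfolding char_std_normal_distribution by simp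
  finally show "(CLINT \<omega>|M. iexp (a \<bullet> Y \<omega>)) = of_real (exp (- (LINT \<omega>|M. (a \<bullet> Y \<omega>)\<^sup>2) / 2))"
    using v by simp
qed

definition iid_gaussian_rows :: "'a measure \<Rightarrow> ('a \<Rightarrow> real^'k^'m) \<Rightarrow> bool" where
  "iid_gaussian_rows M W \<longleftrightarrow> W \<in> borel_measurable M \<and>
     prob_space.indep_vars M (\<lambda>i. borel) (\<lambda>i \<omega>. W \<omega> $ i) UNIV \<and>
     (\<forall>i i'. distr M borel (\<lambda>\<omega>. W \<omega> $ i) = distr M borel (\<lambda>\<omega>. W \<omega> $ i')) \<and>
     (\<forall>i. centered_gaussian_vector M (\<lambda>\<omega>. W \<omega> $ i))"

text \<open>The characteristic function at \<open>S\<close> depends on \<open>S\<close> only through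
  \<open>\<Sum>\<^sub>i (S\<^sub>i \<bullet> u)\<^sup>2\<close>, \<open>u\<close> a copy of a row; this is the quantity that \<open>sum_inner_rotate_rows\<close> shows to be
  invariant under rotations of the row index.\<close>
lemma iid_gaussian_rows_char:
  fixes W :: "'a \<Rightarrow> real^'k^'m"
  assumes M: "prob_space M" and W: "iid_gaussian_rows M W"
  shows "(CLINT \<omega>|M. iexp (S \<bullet> W \<omega>)) =
    of_real (exp (- (LINT \<omega>|M. (\<Sum>i\<in>UNIV. (S $ i \<bullet> W \<omega> $ first)\<^sup>2)) / 2))"
proof -
  interpret prob_space M by fact
  have [measurable]: "W \<in> borel_measurable M" using W by (simp add: iid_gaussian_rows_def)
  have g: "centered_gaussian_vector M (\<lambda>\<omega>. W \<omega> $ i)" for i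
    using W by (simp add: iid_gaussian_rows_def)
  have d: "distr M borel (\<lambda>\<omega>. W \<omega> $ i) = distr M borel (\<lambda>\<omega>. W \<omega> $ first)" for i
    using W unfolding iid_gaussian_rows_def by blast
  have ind: "indep_vars (\<lambda>i. borel) (\<lambda>i \<omega>. W \<omega> $ i) UNIV"
    using W by (simp add: iid_gaussian_rows_def)
  have indS: "indep_vars (\<lambda>i. borel) (\<lambda>i \<omega>. iexp (S $ i \<bullet> W \<omega> $ i)) UNIV"
    by (rule indep_vars_compose2[OF ind]) auto
  have "(CLINT \<omega>|M. iexp (S \<bullet> W \<omega>)) = (CLINT \<omega>|M. (\<Prod>i\<in>UNIV. iexp (S $ i \<bullet> W \<omega> $ i)))"
    by (simp add: inner_vec_def exp_sum[symmetric] sum_distrib_left)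
  also have "\<dots> = (\<Prod>i\<in>UNIV. CLINT \<omega>|M. iexp (S $ i \<bullet> W \<omega> $ i))"
    by (intro indep_vars_lebesgue_integral indS) (auto intro!: integrable_const_bound[where B=1])
  also have "\<dots> = (\<Prod>i\<in>UNIV. of_real (exp (- (LINT \<omega>|M. (S $ i \<bullet> W \<omega> $ first)\<^sup>2) / 2)))"
  proof (rule prod.cong[OF refl])
    fix i
    have "(LINT \<omega>|M. (S $ i \<bullet> W \<omega> $ i)\<^sup>2) = (LINT z|distr M borel (\<lambda>\<omega>. W \<omega> $ i). (S $ i \<bullet> z)\<^sup>2)"
      by (simp add: integral_distr)
    also have "\<dots> = (LINT \<omega>|M. (S $ i \<bullet> W \<omega> $ first)\<^sup>2)"
      unfolding d[of i] by (simp add: integral_distr)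
    finally show "(CLINT \<omega>|M. iexp (S $ i \<bullet> W \<omega> $ i)) = of_real (exp (- (LINT \<omega>|M. (S $ i \<bullet> W \<omega> $ first)\<^sup>2) / 2))"
      using gaussian_char[OF M g, of "S $ i" i] by simp
  qed
  also have "\<dots> = of_real (exp (\<Sum>i\<in>UNIV. - (LINT \<omega>|M. (S $ i \<bullet> W \<omega> $ first)\<^sup>2) / 2))"
    by (simp add: exp_sum)
  also have "(\<Sum>i\<in>UNIV. - (LINT \<omega>|M. (S $ i \<bullet> W \<omega> $ first)\<^sup>2) / 2) = - (LINT \<omega>|M. (\<Sum>i\<in>UNIV. (S $ i \<bullet> W \<omega> $ first)\<^sup>2)) / 2"
    using integrable_gaussian_square[OF M g]
    by (subst Bochner_Integration.integral_sum) (auto simp: sum_negf sum_divide_distrib)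
  finally show ?thesis .
qed

definition rotate_rows :: "real^'m^'m \<Rightarrow> real^'k^'m \<Rightarrow> real^'k^'m" where
  "rotate_rows R B = (\<chi> i. \<Sum>l\<in>UNIV. R $ i $ l *\<^sub>R B $ l)"

lemma rotate_rows_nth: "rotate_rows R B $ i $ j = (R *v (\<chi> l. B $ l $ j)) $ i"
  by (simp add: rotate_rows_def matrix_vector_mult_def)

lemma inner_rotate_rows: "S \<bullet> rotate_rows R B = rotate_rows (transpose R) S \<bullet> B"
  unfolding inner_vec_def[of S] inner_vec_def[of _ B] rotate_rows_def
  by (simp add: inner_sum_left inner_sum_right transpose_def) (rule sum.swap)

lemma borel_measurable_rotate_rows [measurable]: "rotate_rows R \<in> borel_measurable borel"
  unfolding rotate_rows_def by (intro borel_measurable_continuous_onI continuous_intros)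

lemma sum_inner_rotate_rows:
  assumes "orthogonal_matrix R"
  shows "(\<Sum>i\<in>UNIV. (rotate_rows R S $ i \<bullet> u)\<^sup>2) = (\<Sum>i\<in>UNIV. (S $ i \<bullet> u)\<^sup>2)"
proof -
  let ?s = "\<chi> l. S $ l \<bullet> u"
  have "orthogonal_transformation ((*v) R)"
    using assms by (simp add: orthogonal_transformation_matrix)
  then have "norm (R *v ?s) = norm ?s"
    by (simp add: orthogonal_transformation)
  then have "(R *v ?s) \<bullet> (R *v ?s) = ?s \<bullet> ?s"
    by (simp add: power2_norm_eq_inner[symmetric])
  moreover have "rotate_rows R S $ i \<bullet> u = (R *v ?s) $ i" for i
    by (simp add: rotate_rows_def matrix_vector_mult_def inner_sum_left)
  ultimately show ?thesis
    by (simp add: inner_vec_def power2_eq_square)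
qed

lemma distr_rotate_rows:
  fixes W :: "'a \<Rightarrow> real^'k^'m"
  assumes M: "prob_space M" and W: "iid_gaussian_rows M W" and R: "orthogonal_matrix R"
  shows "distr M borel (\<lambda>\<omega>. rotate_rows R (W \<omega>)) = distr M borel W"
proof (rule measure_eqI_same_char)
  interpret prob_space M by fact
  have [measurable]: "W \<in> borel_measurable M" using W by (simp add: iid_gaussian_rows_def)
  have R': "orthogonal_matrix (transpose R)" using R by simp
  show "same_char (distr M borel (\<lambda>\<omega>. rotate_rows R (W \<omega>))) (distr M borel W)"
    unfolding same_char_def
  proof (intro conjI allI)
    fix S :: "real^'k^'m"
    have "(CLINT \<omega>|M. iexp (S \<bullet> rotate_rows R (W \<omega>))) = (CLINT \<omega>|M. iexp (S \<bullet> W \<omega>))"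
      unfolding inner_rotate_rows
        iid_gaussian_rows_char[OF M W, of _ undefined] sum_inner_rotate_rows[OF R'] ..
    then show "(CLINT x|distr M borel (\<lambda>\<omega>. rotate_rows R (W \<omega>)). iexp (S \<bullet> x)) =
               (CLINT x|distr M borel W. iexp (S \<bullet> x))"
      by (simp add: integral_distr)
  qed (auto intro!: finite_measure_distr)
qed

text \<open>The \<open>j\<close>-th risk is the squared norm of the vector \<open>r\<^sub>j x\<close> plus the \<open>j\<close>-th column of \<open>B\<close>.\<close>
lemma perturbed_chi_square_rotate:
  assumes "orthogonal_matrix R"
  shows "perturbed_chi_square r (R *v x) (rotate_rows R B) = perturbed_chi_square r x B"
proof (rule vec_eq_iff[THEN iffD2, rule_format])
  fix j
  let ?u = "r $ j *\<^sub>R x + (\<chi> l. B $ l $ j)"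
  have "orthogonal_transformation ((*v) R)"
    using assms by (simp add: orthogonal_transformation_matrix)
  then have "norm (R *v ?u) = norm ?u"
    by (simp add: orthogonal_transformation)
  then have "(R *v ?u) \<bullet> (R *v ?u) = ?u \<bullet> ?u"
    by (simp add: power2_norm_eq_inner[symmetric])
  moreover have "R *v ?u = r $ j *\<^sub>R (R *v x) + R *v (\<chi> l. B $ l $ j)"
    by (simp add: matrix_vector_right_distrib scaleR_matrix_vector_assoc[symmetric] matrix_vector_mult_scaleR)
  ultimately show "perturbed_chi_square r (R *v x) (rotate_rows R B) $ j = perturbed_chi_square r x B $ j"
    by (simp add: perturbed_chi_square_def rotate_rows_nth inner_vec_def power2_eq_square)
qed

lemma borel_measurable_perturbed_chi_square_fixed [measurable]:
  "perturbed_chi_square r x \<in> borel_measurable borel"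
  unfolding perturbed_chi_square_def
  by (intro borel_measurable_continuous_onI continuous_intros)

text \<open>Some orthogonal map carries \<open>x\<close> to \<open>y\<close>; it preserves the risks and the law of \<open>W\<close>.\<close>
lemma distr_perturbed_chi_square_eq:
  fixes W :: "'a \<Rightarrow> real^'k^'m" and x y :: "real^'m"
  assumes M: "prob_space M" and W: "iid_gaussian_rows M W" and n: "norm x = norm y"
  shows "distr M borel (\<lambda>\<omega>. perturbed_chi_square r x (W \<omega>)) =
         distr M borel (\<lambda>\<omega>. perturbed_chi_square r y (W \<omega>))"
proof -
  have [measurable]: "W \<in> borel_measurable M" using W by (simp add: iid_gaussian_rows_def)
  obtain f where f: "orthogonal_transformation f" "f x = y"
    using orthogonal_transformation_exists[OF n] .
  define R where "R = matrix f"
  have R: "orthogonal_matrix R" "R *v x = y"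
    using f by (auto simp: R_def orthogonal_transformation_matrix matrix_works)
  have "distr M borel (\<lambda>\<omega>. perturbed_chi_square r x (W \<omega>)) =
        distr M borel (\<lambda>\<omega>. perturbed_chi_square r y (rotate_rows R (W \<omega>)))"
    using perturbed_chi_square_rotate[OF R(1), of r x] by (simp add: R(2))
  also have "\<dots> = distr (distr M borel (\<lambda>\<omega>. rotate_rows R (W \<omega>))) borel (perturbed_chi_square r y)"
    by (subst distr_distr) (auto simp: comp_def)
  also have "\<dots> = distr M borel (\<lambda>\<omega>. perturbed_chi_square r y (W \<omega>))"
    unfolding distr_rotate_rows[OF M W R(1)] by (subst distr_distr) (auto simp: comp_def)
  finally show ?thesis .
qed

lemma chi_square_eq_norm: "chi_square x = (norm x)\<^sup>2"
  unfolding chi_square_def power2_norm_eq_inner inner_vec_def by (simp add: power2_eq_square)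

lemma norm_axis_sqrt: "0 \<le> y \<Longrightarrow> norm (axis i (sqrt y)) = sqrt y"
  by (simp add: norm_eq_sqrt_inner inner_axis_axis)

text \<open>On the fibre \<open>\<zeta>\<^sub>1 = y\<close> all points have norm \<open>sqrt y\<close>, so by rotation invariance the integrand of the
  mixture over the fibre is constant. This eliminates the kernel \<open>Q\<close>.\<close>
lemma cond_risk_law_eq_distr:
  fixes W :: "'a \<Rightarrow> real^'k^'m" and first :: 'm
  assumes M: "prob_space M" and W: "iid_gaussian_rows M W"
    and Q: "fibre_cond_distribution M X Q" and y: "y \<ge> 0"
  shows "cond_risk_law M Q W r y = distr M borel (\<lambda>\<omega>. perturbed_chi_square r (axis first (sqrt y)) (W \<omega>))"
proof -
  interpret prob_space M by fact
  have Wm[measurable]: "W \<in> borel_measurable M" using W by (simp add: iid_gaussian_rows_def)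
  have "Q \<in> borel \<rightarrow>\<^sub>M prob_algebra borel"
    using Q by (simp add: fibre_cond_distribution_def regular_cond_distribution_def)
  from measurable_space[OF this, of y] have Qs[measurable_cong]: "sets (Q y) = sets borel" and Qp: "prob_space (Q y)"
    by (auto simp: space_prob_algebra)
  interpret Q: prob_space "Q y" by (rule Qp)
  interpret L: prob_space "distr M borel W" by (rule prob_space_distr) simp
  interpret QL: pair_sigma_finite "Q y" "distr M borel W" ..
  have spQ: "space (Q y) = UNIV" using sets_eq_imp_space_eq[OF Qs] by simp
  have f[measurable]: "(\<lambda>(x, B). perturbed_chi_square r x B) \<in> borel_measurable (Q y \<Otimes>\<^sub>M distr M borel W)"
  proof -
    have "sets (Q y \<Otimes>\<^sub>M distr M borel W) = sets (borel \<Otimes>\<^sub>M borel)"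
      by (intro sets_pair_measure_cong) (auto simp: Qs)
    then show ?thesis
      using borel_measurable_perturbed_chi_square measurable_cong_sets by blast
  qed
  show ?thesis
  proof (rule measure_eqI)
    fix A assume "A \<in> sets (cond_risk_law M Q W r y)"
    then have [measurable]: "A \<in> sets borel" by (simp add: cond_risk_law_def)
    have "emeasure (cond_risk_law M Q W r y) A =
        emeasure (Q y \<Otimes>\<^sub>M distr M borel W) ((\<lambda>(x, B). perturbed_chi_square r x B) -` A \<inter> space (Q y \<Otimes>\<^sub>M distr M borel W))"
      unfolding cond_risk_law_def by (rule emeasure_distr) auto
    also have "\<dots> = (\<integral>\<^sup>+x. emeasure (distr M borel W) (Pair x -` ((\<lambda>(x, B). perturbed_chi_square r x B) -` A \<inter> space (Q y \<Otimes>\<^sub>M distr M borel W))) \<partial>Q y)"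
      by (rule L.emeasure_pair_measure_alt) measurable
    also have "\<dots> = (\<integral>\<^sup>+x. emeasure (distr M borel (\<lambda>\<omega>. perturbed_chi_square r x (W \<omega>))) A \<partial>Q y)"
    proof (intro nn_integral_cong)
      fix x
      have "Pair x -` ((\<lambda>(x, B). perturbed_chi_square r x B) -` A \<inter> space (Q y \<Otimes>\<^sub>M distr M borel W)) = perturbed_chi_square r x -` A"
        by (auto simp: space_pair_measure spQ)
      moreover have "perturbed_chi_square r x -` A \<in> sets borel"
        using measurable_sets[OF borel_measurable_perturbed_chi_square_fixed, of A r x] by simp
      ultimately show "emeasure (distr M borel W) (Pair x -` ((\<lambda>(x, B). perturbed_chi_square r x B) -` A \<inter> space (Q y \<Otimes>\<^sub>M distr M borel W))) =
        emeasure (distr M borel (\<lambda>\<omega>. perturbed_chi_square r x (W \<omega>))) A"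
        by (simp add: emeasure_distr vimage_def)
    qed
    also have "\<dots> = (\<integral>\<^sup>+x. emeasure (distr M borel (\<lambda>\<omega>. perturbed_chi_square r (axis first (sqrt y)) (W \<omega>))) A \<partial>Q y)"
    proof (rule nn_integral_cong_AE)
      have "AE x in Q y. chi_square x = y" using Q y by (simp add: fibre_cond_distribution_def)
      then show "AE x in Q y. emeasure (distr M borel (\<lambda>\<omega>. perturbed_chi_square r x (W \<omega>))) A =
          emeasure (distr M borel (\<lambda>\<omega>. perturbed_chi_square r (axis first (sqrt y)) (W \<omega>))) A"
      proof eventually_elim
        fix x :: "real^'m" assume "chi_square x = y"
        then have "norm x = norm (axis first (sqrt y) :: real^'m)"
          unfolding norm_axis_sqrt[OF y] by (auto simp: chi_square_eq_norm)
        then show "emeasure (distr M borel (\<lambda>\<omega>. perturbed_chi_square r x (W \<omega>))) A =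
          emeasure (distr M borel (\<lambda>\<omega>. perturbed_chi_square r (axis first (sqrt y)) (W \<omega>))) A"
          by (simp only: distr_perturbed_chi_square_eq[OF M W, of x _ r])
      qed
    qed
    also have "\<dots> = emeasure (distr M borel (\<lambda>\<omega>. perturbed_chi_square r (axis first (sqrt y)) (W \<omega>))) A"
      by (simp add: Q.emeasure_space_1)
    finally show "emeasure (cond_risk_law M Q W r y) A = \<dots>" .
  qed (simp add: cond_risk_law_def)
qed

section \<open>Gaussian spread, independence and Gumbel tails\<close>

lemma measure_std_normal_interval_pos:
  assumes "a < b" "{a..b} \<subseteq> A" "A \<in> sets borel"
  shows "0 < measure std_normal_distribution A"
proof -
  interpret N: real_distribution std_normal_distribution by (rule real_dist_normal_dist)
  have "measure std_normal_distribution {a..b} \<noteq> 0"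
  proof
    assume "measure std_normal_distribution {a..b} = 0"
    then have "{a..b} \<in> null_sets std_normal_distribution"
      by (intro null_setsI) (auto simp: N.emeasure_eq_measure)
    then have "AE x in lborel. x \<notin> {a..b}"
      by (simp add: null_sets_density_iff normal_density_def)
    then have "emeasure lborel {a..b} = 0"
      by (simp add: AE_iff_null_sets null_setsD1)
    then show False using \<open>a < b\<close> by simp
  qed
  then have "0 < measure std_normal_distribution {a..b}" by (simp add: zero_less_measure_iff)
  also have "\<dots> \<le> measure std_normal_distribution A"
    using assms by (intro N.finite_measure_mono) auto
  finally show ?thesis .
qed

text \<open>The square of a centered Gaussian variable \<open>A\<close> is at most \<open>\<sigma>\<^sup>2/4\<close> and at least \<open>\<sigma>\<^sup>2\<close> with fixed positive
  probabilities. If the gap \<open>3\<sigma>\<^sup>2/4\<close> between these values exceeds the width \<open>2\<delta>\<close> of the window around \<open>c\<close>,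
  then for each value of the independent variable \<open>C\<close> at least one of the two alternatives throws
  \<open>A\<^sup>2 + C\<close> out of the window: the large one if \<open>C > t\<close> and the small one otherwise.\<close>
lemma gaussian_square_spread:
  assumes M: "prob_space M"
    and A[measurable]: "A \<in> borel_measurable M" and ind: "prob_space.indep_var M borel (\<lambda>\<omega>. (A \<omega>)\<^sup>2) borel C"
    and A_law: "distr M borel A = distr std_normal_distribution borel (\<lambda>z. \<sigma> * z)"
    and big: "8 * \<delta> < 3 * \<sigma>\<^sup>2"
  shows "min (measure std_normal_distribution {z. z\<^sup>2 \<le> 1/4}) (measure std_normal_distribution {z. 1 \<le> z\<^sup>2})
     \<le> measure M {\<omega> \<in> space M. \<delta> < \<bar>(A \<omega>)\<^sup>2 + C \<omega> - c\<bar>}" (is "min ?p0 ?p1 \<le> _")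
proof -
  interpret prob_space M by fact
  interpret N: real_distribution std_normal_distribution by (rule real_dist_normal_dist)
  have C[measurable]: "C \<in> borel_measurable M" using indep_var_rv2[OF ind] .
  \<comment> \<open>Above \<open>t\<close> the event \<open>A\<^sup>2 \<ge> \<sigma>\<^sup>2\<close> overshoots \<open>c + \<delta>\<close>.\<close>
  define t where "t = c + \<delta> - \<sigma>\<^sup>2"
  have A_prob: "prob {\<omega> \<in> space M. (A \<omega>)\<^sup>2 \<in> S} = measure std_normal_distribution {z. (\<sigma> * z)\<^sup>2 \<in> S}"
    if [measurable]: "S \<in> sets borel" for S
  proof -
    have "prob {\<omega> \<in> space M. (A \<omega>)\<^sup>2 \<in> S} = measure (distr M borel A) {x. x\<^sup>2 \<in> S}"
      by (subst measure_distr) (auto intro!: arg_cong[where f=prob])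
    also have "\<dots> = measure std_normal_distribution {z. (\<sigma> * z)\<^sup>2 \<in> S}"
      unfolding A_law by (subst measure_distr) (auto intro!: arg_cong[where f="measure _"])
    finally show ?thesis .
  qed
  have prod: "prob {\<omega> \<in> space M. (A \<omega>)\<^sup>2 \<in> S \<and> C \<omega> \<in> T} =
      prob {\<omega> \<in> space M. (A \<omega>)\<^sup>2 \<in> S} * prob {\<omega> \<in> space M. C \<omega> \<in> T}"
    if "S \<in> sets borel" "T \<in> sets borel" for S T
    using indep_varD[OF ind that] by (simp add: vimage_def Int_def conj_commute conj_left_commute)
  let ?E1 = "{\<omega> \<in> space M. (A \<omega>)\<^sup>2 \<in> {\<sigma>\<^sup>2..} \<and> C \<omega> \<in> {t<..}}"
  let ?E0 = "{\<omega> \<in> space M. (A \<omega>)\<^sup>2 \<in> {..\<sigma>\<^sup>2/4} \<and> C \<omega> \<in> {..t}}"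
  have p1: "?p1 \<le> prob {\<omega> \<in> space M. (A \<omega>)\<^sup>2 \<in> {\<sigma>\<^sup>2..}}"
  proof -
    have "?p1 \<le> measure std_normal_distribution {z. (\<sigma> * z)\<^sup>2 \<in> {\<sigma>\<^sup>2..}}"
      by (intro N.finite_measure_mono)
        (auto simp: power_mult_distrib intro: order_trans[OF _ mult_left_mono[of 1]])
    then show ?thesis by (subst A_prob) auto
  qed
  have p0: "?p0 \<le> prob {\<omega> \<in> space M. (A \<omega>)\<^sup>2 \<in> {..\<sigma>\<^sup>2/4}}"
  proof -
    have "(\<sigma> * z)\<^sup>2 \<le> \<sigma>\<^sup>2/4" if "z\<^sup>2 \<le> 1/4" for z
      using mult_left_mono[OF that, of "\<sigma>\<^sup>2"] by (simp add: power_mult_distrib)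
    then have "?p0 \<le> measure std_normal_distribution {z. (\<sigma> * z)\<^sup>2 \<in> {..\<sigma>\<^sup>2/4}}"
      by (intro N.finite_measure_mono) auto
    then show ?thesis by (subst A_prob) auto
  qed
  have "min ?p0 ?p1 = min ?p0 ?p1 * prob {\<omega> \<in> space M. C \<omega> \<in> {t<..}} + min ?p0 ?p1 * prob {\<omega> \<in> space M. C \<omega> \<in> {..t}}"
  proof -
    have "prob {\<omega> \<in> space M. C \<omega> \<in> {t<..}} + prob {\<omega> \<in> space M. C \<omega> \<in> {..t}} =
          prob ({\<omega> \<in> space M. C \<omega> \<in> {t<..}} \<union> {\<omega> \<in> space M. C \<omega> \<in> {..t}})"
      by (intro finite_measure_Union[symmetric]) auto
    also have "{\<omega> \<in> space M. C \<omega> \<in> {t<..}} \<union> {\<omega> \<in> space M. C \<omega> \<in> {..t}} = space M" by auto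
    finally show ?thesis by (simp add: distrib_left[symmetric] prob_space del: mult_minus_left min_mult_distrib_right)
  qed
  also have "\<dots> \<le> prob {\<omega> \<in> space M. (A \<omega>)\<^sup>2 \<in> {\<sigma>\<^sup>2..}} * prob {\<omega> \<in> space M. C \<omega> \<in> {t<..}} +
      prob {\<omega> \<in> space M. (A \<omega>)\<^sup>2 \<in> {..\<sigma>\<^sup>2/4}} * prob {\<omega> \<in> space M. C \<omega> \<in> {..t}}"
    using p0 p1 by (intro add_mono mult_right_mono) auto
  also have "\<dots> = prob ?E1 + prob ?E0"
    by (subst (1 2) prod) auto
  also have "\<dots> = prob (?E1 \<union> ?E0)"
    by (intro finite_measure_Union[symmetric]) auto
  also have "\<dots> \<le> prob {\<omega> \<in> space M. \<delta> < \<bar>(A \<omega>)\<^sup>2 + C \<omega> - c\<bar>}"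
    using big by (intro finite_measure_mono) (auto simp: t_def abs_if)
  finally show ?thesis .
qed

text \<open>Fubini's theorem for independent variables with different ranges.\<close>
lemma independent_variables_integral:
  fixes X :: "'a \<Rightarrow> 'b::second_countable_topology" and Y :: "'a \<Rightarrow> 'c::second_countable_topology"
    and \<phi> :: "'b \<Rightarrow> 'c \<Rightarrow> real"
  assumes M: "prob_space M" and ind: "independent_variables M X Y"
    and \<phi>: "(\<lambda>(x, y). \<phi> x y) \<in> borel_measurable (borel \<Otimes>\<^sub>M borel)" and bd: "\<And>x y. \<bar>\<phi> x y\<bar> \<le> B"
  shows "(LINT \<omega>|M. \<phi> (X \<omega>) (Y \<omega>)) = (LINT \<omega>|M. (LINT \<omega>'|M. \<phi> (X \<omega>) (Y \<omega>')))"
proof -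
  interpret prob_space M by fact
  have X[measurable]: "X \<in> borel_measurable M" and Y[measurable]: "Y \<in> borel_measurable M"
    using ind by (auto simp: independent_variables_def)
  let ?PX = "distr M borel X" and ?PY = "distr M borel Y"
  interpret PX: prob_space ?PX by (rule prob_space_distr) simp
  interpret PY: prob_space ?PY by (rule prob_space_distr) simp
  interpret XY: pair_prob_space ?PX ?PY ..
  have joint: "?PX \<Otimes>\<^sub>M ?PY = distr M (borel \<Otimes>\<^sub>M borel) (\<lambda>\<omega>. (X \<omega>, Y \<omega>))"
  proof (rule pair_measure_eqI)
    fix A' B' assume "A' \<in> sets ?PX" "B' \<in> sets ?PY"
    then have [measurable]: "A' \<in> sets borel" "B' \<in> sets borel" by auto
    have "prob ((X -` A' \<inter> space M) \<inter> (Y -` B' \<inter> space M)) =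
          prob (X -` A' \<inter> space M) * prob (Y -` B' \<inter> space M)"
      using ind by (intro indep_setD) (auto simp: independent_variables_def)
    moreover have "(\<lambda>\<omega>. (X \<omega>, Y \<omega>)) -` (A' \<times> B') \<inter> space M =
          (X -` A' \<inter> space M) \<inter> (Y -` B' \<inter> space M)"
      by auto
    ultimately show "emeasure ?PX A' * emeasure ?PY B' =
          emeasure (distr M (borel \<Otimes>\<^sub>M borel) (\<lambda>\<omega>. (X \<omega>, Y \<omega>))) (A' \<times> B')"
      by (subst (1 2 3) emeasure_distr) (simp_all add: emeasure_eq_measure ennreal_mult)
  qed (auto intro: PX.sigma_finite_measure_axioms PY.sigma_finite_measure_axioms)
  have \<phi>'[measurable]: "(\<lambda>(x, y). \<phi> x y) \<in> borel_measurable (?PX \<Otimes>\<^sub>M ?PY)"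
    using \<phi> by (simp cong: measurable_cong_sets)
  have slice[measurable]: "\<phi> x \<in> borel_measurable borel" for x
    using measurable_Pair2[OF \<phi>, of x] by simp
  have "(LINT \<omega>|M. \<phi> (X \<omega>) (Y \<omega>)) = (LINT p|distr M (borel \<Otimes>\<^sub>M borel) (\<lambda>\<omega>. (X \<omega>, Y \<omega>)). (\<lambda>(x, y). \<phi> x y) p)"
    using \<phi> by (subst integral_distr) auto
  also have "\<dots> = (LINT x|?PX. LINT y|?PY. \<phi> x y)"
    unfolding joint[symmetric]
    using XY.integral_fst'[of "\<lambda>p. (\<lambda>(x, y). \<phi> x y) p"] bd
    by (simp add: XY.P.integrable_const_bound[where B=B] split_beta)
  also have "\<dots> = (LINT \<omega>|M. (LINT \<omega>'|M. \<phi> (X \<omega>) (Y \<omega>')))"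
    using PY.borel_measurable_lebesgue_integral[OF \<phi>']
    by (subst integral_distr) (auto simp: integral_distr)
  finally show ?thesis .
qed

lemma conv_in_probability_components:
  fixes Y :: "'i \<Rightarrow> 'w \<Rightarrow> 'b::euclidean_space^'n"
  assumes M: "prob_space M" and meas: "\<forall>\<^sub>F v in F. Y v \<in> borel_measurable M"
    and comp: "\<And>l. conv_in_probability M (\<lambda>v \<omega>. Y v \<omega> $ l) 0 F"
  shows "conv_in_probability M Y 0 F"
  unfolding conv_in_probability_def
proof (intro allI impI)
  interpret prob_space M by fact
  fix \<epsilon> :: real assume "\<epsilon> > 0"
  define d where "d = \<epsilon> / CARD('n)"
  have "d > 0" using \<open>\<epsilon> > 0\<close> by (simp add: d_def)
  have "((\<lambda>v. \<Sum>l\<in>UNIV. prob {\<omega> \<in> space M. norm (Y v \<omega> $ l - 0) > d}) \<longlongrightarrow> (\<Sum>l\<in>(UNIV::'n set). 0)) F"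
    using comp \<open>d > 0\<close> unfolding conv_in_probability_def by (intro tendsto_sum) blast
  then have lim: "((\<lambda>v. \<Sum>l\<in>UNIV. prob {\<omega> \<in> space M. norm (Y v \<omega> $ l - 0) > d}) \<longlongrightarrow> 0) F" by simp
  show "((\<lambda>v. prob {\<omega> \<in> space M. norm (Y v \<omega> - 0) > \<epsilon>}) \<longlongrightarrow> 0) F"
  proof (rule tendsto_sandwich[OF _ _ tendsto_const lim])
    show "\<forall>\<^sub>F v in F. prob {\<omega> \<in> space M. norm (Y v \<omega> - 0) > \<epsilon>} \<le> (\<Sum>l\<in>UNIV. prob {\<omega> \<in> space M. norm (Y v \<omega> $ l - 0) > d})"
      using meas
    proof eventually_elim
      fix v assume [measurable]: "Y v \<in> borel_measurable M"
      have "{\<omega> \<in> space M. norm (Y v \<omega> - 0) > \<epsilon>} \<subseteq> (\<Union>l\<in>UNIV. {\<omega> \<in> space M. norm (Y v \<omega> $ l - 0) > d})"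
      proof
        fix \<omega> assume \<omega>: "\<omega> \<in> {\<omega> \<in> space M. norm (Y v \<omega> - 0) > \<epsilon>}"
        have "\<exists>l. norm (Y v \<omega> $ l) > d"
        proof (rule ccontr)
          assume "\<not> ?thesis"
          then have le: "norm (Y v \<omega> $ l) \<le> d" for l by (auto simp: not_less)
          have "norm (Y v \<omega>) \<le> (\<Sum>l\<in>UNIV. norm (Y v \<omega> $ l))"
            unfolding norm_vec_def by (rule L2_set_le_sum) auto
          also have "\<dots> \<le> (\<Sum>l\<in>(UNIV::'n set). d)" using le by (intro sum_mono) auto
          also have "\<dots> = \<epsilon>" by (simp add: d_def)
          finally show False using \<omega> by simp
        qed
        then show "\<omega> \<in> (\<Union>l\<in>UNIV. {\<omega> \<in> space M. norm (Y v \<omega> $ l - 0) > d})" using \<omega> by auto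
      qed
      then have "prob {\<omega> \<in> space M. norm (Y v \<omega> - 0) > \<epsilon>} \<le> prob (\<Union>l\<in>UNIV. {\<omega> \<in> space M. norm (Y v \<omega> $ l - 0) > d})"
        by (intro finite_measure_mono) auto
      also have "\<dots> \<le> (\<Sum>l\<in>UNIV. prob {\<omega> \<in> space M. norm (Y v \<omega> $ l - 0) > d})"
        by (intro finite_measure_subadditive_finite) auto
      finally show "prob {\<omega> \<in> space M. norm (Y v \<omega> - 0) > \<epsilon>} \<le> (\<Sum>l\<in>UNIV. prob {\<omega> \<in> space M. norm (Y v \<omega> $ l - 0) > d})" .
    qed
  qed auto
qed

text \<open>At \<open>x = 0\<close> the Gumbel condition says that \<open>(1 - G(v)) / (1 - G(v))\<close> tends to 1; if \<open>G\<close> reached 1,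
  this quotient would be \<open>0 / 0 = 0\<close> for all large \<open>v\<close>.\<close>
lemma gumbel_MDA_tail_pos:
  assumes "real_distribution \<mu>" and G: "gumbel_MDA (cdf \<mu>) w"
  shows "cdf \<mu> v < 1"
proof -
  interpret real_distribution \<mu> by fact
  have "((\<lambda>v. (1 - cdf \<mu> (v + 0 / w v)) / (1 - cdf \<mu> v)) \<longlongrightarrow> exp (- 0)) at_top"
    using G unfolding gumbel_MDA_def by blast
  then have "\<forall>\<^sub>F v in at_top. 0 < (1 - cdf \<mu> (v + 0 / w v)) / (1 - cdf \<mu> v)"
    by (rule order_tendstoD) simp
  then obtain u where u: "u \<ge> v" "0 < (1 - cdf \<mu> (u + 0 / w u)) / (1 - cdf \<mu> u)"
    by (metis (no_types, lifting) eventually_at_top_linorder linorder_linear)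
  then have "cdf \<mu> u \<noteq> 1" by auto
  with cdf_bounded_prob[of u] cdf_nondecreasing[OF u(1)] show ?thesis by linarith
qed

text \<open>Where \<open>v w(v) \<le> C\<close>, the point \<open>v - C / w(v)\<close> is nonpositive. If this happened for arbitrarily large
  \<open>v\<close>, the ratio \<open>(1 - G(v - C / w(v))) / (1 - G(v)) \<ge> (1 - G(0)) / (1 - G(v))\<close> would be unbounded
  instead of converging to \<open>exp C\<close>.\<close>
lemma gumbel_MDA_scaling_at_top:
  assumes "real_distribution \<mu>" and G: "gumbel_MDA (cdf \<mu>) w"
  shows "filterlim (\<lambda>v. v * w v) at_top at_top"
  unfolding filterlim_at_top
proof
  interpret real_distribution \<mu> by fact
  fix C
  note pos = gumbel_MDA_tail_pos[OF assms]
  have "((\<lambda>v. (1 - cdf \<mu> (v + (-C) / w v)) / (1 - cdf \<mu> v)) \<longlongrightarrow> exp (- (-C))) at_top"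
    using G unfolding gumbel_MDA_def by blast
  then have 1: "\<forall>\<^sub>F v in at_top. (1 - cdf \<mu> (v + (-C) / w v)) / (1 - cdf \<mu> v) < exp C + 1"
    by (rule order_tendstoD) simp
  have "(1 - (1 - cdf \<mu> 0) / (exp C + 1)) < 1"
    using pos[of 0] by (simp add: add_pos_pos)
  then have 2: "\<forall>\<^sub>F v in at_top. cdf \<mu> v > 1 - (1 - cdf \<mu> 0) / (exp C + 1)"
    by (intro order_tendstoD[OF cdf_lim_at_top_prob])
  show "\<forall>\<^sub>F v in at_top. C \<le> v * w v"
    using 1 2 eventually_gt_at_top[of 0]
  proof eventually_elim
    fix v assume A: "(1 - cdf \<mu> (v + (-C) / w v)) / (1 - cdf \<mu> v) < exp C + 1"
      and B: "cdf \<mu> v > 1 - (1 - cdf \<mu> 0) / (exp C + 1)" and "v > 0"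
    have w: "w v > 0" using G \<open>v > 0\<close> by (simp add: gumbel_MDA_def)
    show "C \<le> v * w v"
    proof (rule ccontr)
      assume "\<not> C \<le> v * w v"
      then have "v + (-C) / w v \<le> 0" using w by (simp add: field_simps)
      then have "1 - cdf \<mu> 0 \<le> 1 - cdf \<mu> (v + (-C) / w v)" using cdf_nondecreasing by simp
      also have "\<dots> < (exp C + 1) * (1 - cdf \<mu> v)" using A pos[of v] by (simp add: divide_less_eq)
      also have "\<dots> < 1 - cdf \<mu> 0"
      proof -
        have "1 - cdf \<mu> v < (1 - cdf \<mu> 0) / (exp C + 1)" using B by simp
        then show ?thesis using less_divide_eq[of "1 - cdf \<mu> v" "1 - cdf \<mu> 0" "exp C + 1"] add_pos_pos[of "exp C" 1]
          by (simp add: mult.commute)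
      qed
      finally show False .
    qed
  qed
qed

lemma cdf_scaled_exceedance:
  assumes M: "prob_space M" and Z[measurable]: "Z \<in> borel_measurable M"
    and pos: "cdf (distr M borel Z) v < 1" and c: "c > 0"
  shows "cdf (distr (uniform_measure M {\<omega> \<in> space M. Z \<omega> > v}) borel (\<lambda>\<omega>. c * (Z \<omega> - v))) x =
    (if x < 0 then 0 else 1 - (1 - cdf (distr M borel Z) (v + x / c)) / (1 - cdf (distr M borel Z) v))"
proof -
  interpret prob_space M by fact
  let ?A = "{\<omega> \<in> space M. Z \<omega> > v}"
  let ?G = "cdf (distr M borel Z)"
  have G: "?G y = prob {\<omega> \<in> space M. Z \<omega> \<le> y}" for y
    unfolding cdf_def by (subst measure_distr) (auto intro!: arg_cong[where f=prob])
  have A: "prob ?A = 1 - ?G v"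
    unfolding G by (subst prob_compl[symmetric]) (auto intro!: arg_cong[where f=prob])
  have "cdf (distr (uniform_measure M ?A) borel (\<lambda>\<omega>. c * (Z \<omega> - v))) x =
        measure (uniform_measure M ?A) {\<omega> \<in> space M. c * (Z \<omega> - v) \<le> x}"
    unfolding cdf_def by (subst measure_distr) (auto intro!: arg_cong[where f="measure _"])
  also have "\<dots> = prob (?A \<inter> {\<omega> \<in> space M. c * (Z \<omega> - v) \<le> x}) / prob ?A"
    using pos by (intro measure_uniform_measure) (auto simp: emeasure_eq_measure A)
  also have "?A \<inter> {\<omega> \<in> space M. c * (Z \<omega> - v) \<le> x} = {\<omega> \<in> space M. Z \<omega> \<le> v + x / c} - {\<omega> \<in> space M. Z \<omega> \<le> v}"
    using c by (auto simp: field_simps)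
  also have "prob \<dots> = (if x < 0 then 0 else ?G (v + x / c) - ?G v)"
  proof (cases "x < 0")
    case True
    then have "x / c < 0" using c by (simp add: divide_neg_pos)
    then have "{\<omega> \<in> space M. Z \<omega> \<le> v + x / c} - {\<omega> \<in> space M. Z \<omega> \<le> v} = {}" by auto
    then show ?thesis using True by (simp only:) simp
  next
    case False
    then have "0 \<le> x / c" using c by simp
    then have "{\<omega> \<in> space M. Z \<omega> \<le> v} \<subseteq> {\<omega> \<in> space M. Z \<omega> \<le> v + x / c}" by auto
    then show ?thesis using False unfolding G by (subst finite_measure_Diff) auto
  qed
  finally show ?thesis using pos unfolding A by (auto simp: field_simps)
qed

section \<open>Normalized risks at a fixed shift\<close>

text \<open>The risks \<open>c (\<zeta>\<^bsub>j+1\<^esub> - v)\<close> given \<open>\<zeta>\<^sub>1 = v + s / c\<close>, with the vector of squared norm \<open>\<zeta>\<^sub>1\<close> placed on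
  the \<open>i\<close>-th axis.\<close>
definition normalized_risk ::
    "'m \<Rightarrow> real \<Rightarrow> real \<Rightarrow> real^'k \<Rightarrow> real \<Rightarrow> real^'k^'m \<Rightarrow> real^'k" where
  "normalized_risk i c v r s B =
     (\<chi> j. c * (perturbed_chi_square r (axis i (sqrt (v + s / c))) B $ j - v))"

lemma perturbed_chi_square_axis:
  "perturbed_chi_square r (axis i a) B $ j = (r $ j)\<^sup>2 * a\<^sup>2 + 2 * r $ j * a * B $ i $ j + (\<Sum>l\<in>UNIV. (B $ l $ j)\<^sup>2)"
proof -
  have "perturbed_chi_square r (axis i a) B $ j =
      (\<Sum>l\<in>UNIV. (if l = i then (r $ j)\<^sup>2 * a\<^sup>2 + 2 * r $ j * a * B $ l $ j else 0) + (B $ l $ j)\<^sup>2)"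
    unfolding perturbed_chi_square_def
    by (simp add: axis_def power2_eq_square algebra_simps cong: if_cong) (intro sum.cong refl, simp add: algebra_simps)
  then show ?thesis by (simp add: sum.distrib)
qed

lemma normalized_risk_nth:
  assumes "0 \<le> v + s / c" "c \<noteq> 0"
  shows "normalized_risk i c v r s B $ j =
    c * v * ((r $ j)\<^sup>2 - 1) + (r $ j)\<^sup>2 * s + 2 * r $ j * (c * sqrt (v + s / c)) * B $ i $ j +
    c * (\<Sum>l\<in>UNIV. (B $ l $ j)\<^sup>2)"
  using assms by (simp add: normalized_risk_def perturbed_chi_square_axis field_simps)

lemma continuous_normalized_risk:
  "continuous_on UNIV (\<lambda>(s, B). normalized_risk i c v r s B)"
  unfolding normalized_risk_def perturbed_chi_square_axis split_beta divide_inverse by (intro continuous_intros)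

lemma borel_measurable_normalized_risk [measurable]:
  "(\<lambda>(s, B). normalized_risk i c v r s B) \<in> borel_measurable (borel \<Otimes>\<^sub>M borel)"
  unfolding borel_prod by (rule borel_measurable_continuous_onI[OF continuous_normalized_risk])

lemma borel_measurable_normalized_risk_snd [measurable]:
  "normalized_risk i c v r s \<in> borel_measurable borel"
  using measurable_Pair2[OF borel_measurable_normalized_risk, of s] by simp

lemma sum_squares_matrix: "(\<Sum>j\<in>UNIV. \<Sum>l\<in>UNIV. (B $ l $ j)\<^sup>2) = (norm (B :: real^'k^'m))\<^sup>2"
  unfolding power2_norm_eq_inner inner_vec_def by (subst sum.swap) (simp add: power2_eq_square)

locale perturbed_risks =
  fixes M :: "'a measure" and W :: "real \<Rightarrow> 'a \<Rightarrow> real^'k^'m"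
    and \<rho> :: "real \<Rightarrow> real^'k" and w :: "real \<Rightarrow> real" and first :: 'm
  assumes M: "prob_space M"
    and W: "\<And>v. 0 < v \<Longrightarrow> iid_gaussian_rows M (W v)"
    and w_pos: "\<And>v. 0 < v \<Longrightarrow> 0 < w v"
    and scaling: "filterlim (\<lambda>v. v * w v) at_top at_top"
begin

sublocale prob_space M by (rule M)

abbreviation "risk v s \<omega> \<equiv> normalized_risk first (w v) v (\<rho> v) s (W v \<omega>)"

lemma W_measurable: "0 < v \<Longrightarrow> W v \<in> borel_measurable M"
  using W by (simp add: iid_gaussian_rows_def)

lemma W_row_law: "0 < v \<Longrightarrow> distr M borel (\<lambda>\<omega>. W v \<omega> $ l) = distr M borel (\<lambda>\<omega>. W v \<omega> $ l')"
  using W unfolding iid_gaussian_rows_def by blast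

lemma risk_measurable: "0 < v \<Longrightarrow> (\<lambda>\<omega>. risk v s \<omega>) \<in> borel_measurable M"
  by (rule measurable_compose[OF W_measurable borel_measurable_normalized_risk_snd])

lemma shift_negligible:
  assumes "filterlim v at_top F" "(s \<longlongrightarrow> s0) F"
  shows "((\<lambda>n. s n / (v n * w (v n))) \<longlongrightarrow> 0) F"
  by (rule tendsto_divide_0[OF assms(2)])
     (rule filterlim_at_top_imp_at_infinity[OF filterlim_compose[OF scaling assms(1)]])

lemma shift_eq: "0 < v \<Longrightarrow> v + s / w v = v * (1 + s / (v * w v))"
  by (simp add: field_simps)

lemma eventually_shift_pos:
  assumes "filterlim v at_top F" "(s \<longlongrightarrow> s0) F"
  shows "\<forall>\<^sub>F n in F. 0 < v n \<and> 0 < v n + s n / w (v n)"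
proof -
  have "\<forall>\<^sub>F n in F. -1 < s n / (v n * w (v n))"
    by (rule order_tendstoD(1)[OF shift_negligible[OF assms]]) simp
  moreover have "\<forall>\<^sub>F n in F. 0 < v n"
    using assms(1) by (simp add: filterlim_at_top_dense)
  ultimately show ?thesis
    by eventually_elim (simp add: shift_eq)
qed

lemma conv_in_probability_all_rows:
  assumes small: "conv_in_probability M (\<lambda>v \<omega>. c v *\<^sub>R (W v \<omega> $ first)) 0 at_top"
  shows "conv_in_probability M (\<lambda>v \<omega>. c v *\<^sub>R W v \<omega>) 0 at_top"
proof (rule conv_in_probability_components[OF M])
  show "\<forall>\<^sub>F v in at_top. (\<lambda>\<omega>. c v *\<^sub>R W v \<omega>) \<in> borel_measurable M"
    using eventually_gt_at_top[of 0] by eventually_elim (auto intro: borel_measurable_scaleR W_measurable)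
  fix l
  show "conv_in_probability M (\<lambda>v \<omega>. (c v *\<^sub>R W v \<omega>) $ l) 0 at_top"
    unfolding conv_in_probability_def
  proof (intro allI impI)
    fix \<epsilon> :: real assume "\<epsilon> > 0"
    then have "((\<lambda>v. prob {\<omega> \<in> space M. norm (c v *\<^sub>R (W v \<omega> $ first) - 0) > \<epsilon>}) \<longlongrightarrow> 0) at_top"
      using small by (simp only: conv_in_probability_def)
    moreover have "\<forall>\<^sub>F v in at_top. prob {\<omega> \<in> space M. norm (c v *\<^sub>R (W v \<omega> $ first) - 0) > \<epsilon>} =
        prob {\<omega> \<in> space M. norm ((c v *\<^sub>R W v \<omega>) $ l - 0) > \<epsilon>}"
      using eventually_gt_at_top[of 0]
    proof eventually_elim
      fix v :: real assume v: "0 < v"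
      note [measurable] = W_measurable[OF v]
      have "prob {\<omega> \<in> space M. norm (c v *\<^sub>R (W v \<omega> $ i) - 0) > \<epsilon>} =
          measure (distr M borel (\<lambda>\<omega>. W v \<omega> $ i)) {x. norm (c v *\<^sub>R x) > \<epsilon>}" for i
        by (subst measure_distr) (auto intro!: arg_cong[where f=prob])
      then show "prob {\<omega> \<in> space M. norm (c v *\<^sub>R (W v \<omega> $ first) - 0) > \<epsilon>} =
        prob {\<omega> \<in> space M. norm ((c v *\<^sub>R W v \<omega>) $ l - 0) > \<epsilon>}"
        using W_row_law[OF v, of l first] by (simp only: vector_scaleR_component)
    qed
    ultimately show "((\<lambda>v. prob {\<omega> \<in> space M. norm ((c v *\<^sub>R W v \<omega>) $ l - 0) > \<epsilon>}) \<longlongrightarrow> 0) at_top"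
      by (rule Lim_transform_eventually)
  qed
qed

text \<open>Up to terms that vanish in probability, the normalized \<open>j\<close>-th risk is
  \<open>2 w sqrt(v) W\<^bsub>1j\<^esub> - \<lambda>\<^sub>j / 2 + x\<close>, which converges by the continuous mapping theorem.\<close>
lemma risk_conv_in_distribution:
  assumes N: "prob_space N" and U[measurable]: "U \<in> borel_measurable N"
    and lam: "\<And>j. 0 \<le> lam $ j"
    and lim: "\<And>j. ((\<lambda>v. 4 * v * w v * (1 - \<rho> v $ j)) \<longlongrightarrow> lam $ j) at_top"
    and conv: "conv_in_distribution (\<lambda>v. distr M borel (\<lambda>\<omega>. (w v * sqrt v) *\<^sub>R (W v \<omega> $ first))) (distr N borel U) at_top"
    and small: "conv_in_probability M (\<lambda>v \<omega>. sqrt (w v) *\<^sub>R (W v \<omega> $ first)) 0 at_top"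
  shows "conv_in_distribution (\<lambda>v. distr M borel (\<lambda>\<omega>. risk v x \<omega>))
      (distr N borel (\<lambda>\<omega>. \<chi> j. 2 * U \<omega> $ j - lam $ j / 2 + x)) at_top"
proof -
  let ?g = "\<lambda>u. (\<chi> j. 2 * u $ j - lam $ j / 2 + x) :: real^'k"
  let ?Y = "\<lambda>v \<omega>. ?g ((w v * sqrt v) *\<^sub>R (W v \<omega> $ first))"
  have g: "continuous_on UNIV ?g" by (intro continuous_intros)
  note gm[measurable] = borel_measurable_continuous_onI[OF g]
  have rho1: "((\<lambda>v. \<rho> v $ j) \<longlongrightarrow> 1) at_top" for j
  proof -
    have "filterlim (\<lambda>v. 4 * (v * w v)) at_infinity at_top"
      by (intro filterlim_at_top_imp_at_infinity filterlim_tendsto_pos_mult_at_top[OF tendsto_const _ scaling]) simp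
    from tendsto_divide_0[OF lim this]
    have "((\<lambda>v. 4 * v * w v * (1 - \<rho> v $ j) / (4 * (v * w v))) \<longlongrightarrow> 0) at_top" .
    moreover have "\<forall>\<^sub>F v in at_top. 4 * v * w v * (1 - \<rho> v $ j) / (4 * (v * w v)) = 1 - \<rho> v $ j"
      using eventually_gt_at_top[of 0]
    proof eventually_elim
      fix v :: real assume "0 < v" with w_pos[OF this]
      show "4 * v * w v * (1 - \<rho> v $ j) / (4 * (v * w v)) = 1 - \<rho> v $ j" by simp
    qed
    ultimately have "((\<lambda>v. 1 - \<rho> v $ j) \<longlongrightarrow> 0) at_top" by (rule Lim_transform_eventually)
    from tendsto_diff[OF tendsto_const[of 1] this] show ?thesis by simp
  qed
  have drift: "((\<lambda>v. w v * v * ((\<rho> v $ j)\<^sup>2 - 1)) \<longlongrightarrow> - (lam $ j / 2)) at_top" for j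
  proof -
    have "((\<lambda>v. - (4 * v * w v * (1 - \<rho> v $ j)) * (1 + \<rho> v $ j) / 4) \<longlongrightarrow> - (lam $ j) * (1 + 1) / 4) at_top"
      by (intro tendsto_intros lim rho1) simp
    moreover have "- (4 * v * w v * (1 - \<rho> v $ j)) * (1 + \<rho> v $ j) / 4 = w v * v * ((\<rho> v $ j)\<^sup>2 - 1)" for v
      by (simp add: power2_eq_square field_simps)
    ultimately show ?thesis by simp
  qed
  have sc: "((\<lambda>v. x / (v * w v)) \<longlongrightarrow> 0) at_top"
    by (rule shift_negligible[OF filterlim_ident tendsto_const])
  \<comment> \<open>The deterministic part of the distance between \<open>risk v x\<close> and \<open>?Y v\<close> where \<open>norm (?Y v) \<le> R\<close>; there \<open>|w sqrt(v) W\<^bsub>1j\<^esub>| \<le> |R| + \<lambda>\<^sub>j + |x|\<close>.\<close>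
  define A where "A R v = (\<Sum>j\<in>UNIV. \<bar>w v * v * ((\<rho> v $ j)\<^sup>2 - 1) + lam $ j / 2\<bar> + \<bar>((\<rho> v $ j)\<^sup>2 - 1) * x\<bar> +
      \<bar>2 * \<rho> v $ j * sqrt (1 + x / (v * w v)) - 2\<bar> * (\<bar>R\<bar> + lam $ j + \<bar>x\<bar>))" for R v
  have A: "(A R \<longlongrightarrow> 0) at_top" for R
  proof -
    have "(A R \<longlongrightarrow> (\<Sum>j\<in>UNIV. \<bar>- (lam $ j / 2) + lam $ j / 2\<bar> + \<bar>(1\<^sup>2 - 1) * x\<bar> +
      \<bar>2 * 1 * sqrt (1 + 0) - 2\<bar> * (\<bar>R\<bar> + lam $ j + \<bar>x\<bar>))) at_top"
      unfolding A_def by (intro tendsto_intros drift rho1 sc)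
    then show ?thesis by simp
  qed
  show ?thesis
  proof (rule conv_in_distribution_slutsky[where Y="?Y"])
    show "prob_space M" by (rule M)
    show "prob_space (distr N borel (\<lambda>\<omega>. ?g (U \<omega>)))"
      by (rule prob_space.prob_space_distr[OF N]) measurable
    show "sets (distr N borel (\<lambda>\<omega>. ?g (U \<omega>))) = sets borel" by simp
    show Ym: "\<forall>\<^sub>F v in at_top. ?Y v \<in> borel_measurable M"
      using eventually_gt_at_top[of 0]
    proof eventually_elim
      fix v :: real assume "0 < v"
      note [measurable] = W_measurable[OF this]
      show "?Y v \<in> borel_measurable M" by (rule measurable_compose[OF _ gm]) measurable
    qed
    show "\<forall>\<^sub>F v in at_top. (\<lambda>\<omega>. risk v x \<omega>) \<in> borel_measurable M"
      using eventually_gt_at_top[of 0] by eventually_elim (rule risk_measurable)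
    show "conv_in_distribution (\<lambda>v. distr M borel (?Y v)) (distr N borel (\<lambda>\<omega>. ?g (U \<omega>))) at_top"
    proof (rule conv_in_distribution_continuous_image[OF conv g _ U])
      show "\<forall>\<^sub>F v in at_top. (\<lambda>\<omega>. (w v * sqrt v) *\<^sub>R (W v \<omega> $ first)) \<in> borel_measurable M"
        using eventually_gt_at_top[of 0]
      proof eventually_elim
        fix v :: real assume "0 < v"
        note [measurable] = W_measurable[OF this]
        show "(\<lambda>\<omega>. (w v * sqrt v) *\<^sub>R (W v \<omega> $ first)) \<in> borel_measurable M" by measurable
      qed
    qed
    fix R \<epsilon> :: real assume "0 < \<epsilon>"
    have "((\<lambda>v. prob {\<omega> \<in> space M. norm (sqrt (w v) *\<^sub>R W v \<omega> - 0) > sqrt (\<epsilon> / 2)}) \<longlongrightarrow> 0) at_top"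
      using conv_in_probability_all_rows[OF small] \<open>0 < \<epsilon>\<close> unfolding conv_in_probability_def by simp
    note lim0 = this
    show "((\<lambda>v. prob {\<omega> \<in> space M. norm (?Y v \<omega>) \<le> R \<and> norm (risk v x \<omega> - ?Y v \<omega>) > \<epsilon>}) \<longlongrightarrow> 0) at_top"
    proof (rule tendsto_sandwich[OF _ _ tendsto_const lim0])
      have "\<forall>\<^sub>F v in at_top. A R v < \<epsilon> / 2"
        using \<open>0 < \<epsilon>\<close> by (intro order_tendstoD[OF A]) auto
      then show "\<forall>\<^sub>F v in at_top. prob {\<omega> \<in> space M. norm (?Y v \<omega>) \<le> R \<and> norm (risk v x \<omega> - ?Y v \<omega>) > \<epsilon>}
          \<le> prob {\<omega> \<in> space M. norm (sqrt (w v) *\<^sub>R W v \<omega> - 0) > sqrt (\<epsilon> / 2)}"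
        using eventually_shift_pos[OF filterlim_ident tendsto_const[of x]]
      proof eventually_elim
        fix v assume Av: "A R v < \<epsilon> / 2" and "0 < v \<and> 0 < v + x / w v"
        then have v: "0 < v" and p: "0 \<le> v + x / w v" by auto
        have wv: "w v > 0" using w_pos v .
        note [measurable] = W_measurable[OF v]
        show "prob {\<omega> \<in> space M. norm (?Y v \<omega>) \<le> R \<and> norm (risk v x \<omega> - ?Y v \<omega>) > \<epsilon>}
          \<le> prob {\<omega> \<in> space M. norm (sqrt (w v) *\<^sub>R W v \<omega> - 0) > sqrt (\<epsilon> / 2)}"
        proof (rule finite_measure_mono, rule subsetI)
          show "{\<omega> \<in> space M. norm (sqrt (w v) *\<^sub>R W v \<omega> - 0) > sqrt (\<epsilon> / 2)} \<in> sets M" by measurable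
          fix \<omega> assume "\<omega> \<in> {\<omega> \<in> space M. norm (?Y v \<omega>) \<le> R \<and> norm (risk v x \<omega> - ?Y v \<omega>) > \<epsilon>}"
          then have \<omega>: "\<omega> \<in> space M" "norm (?Y v \<omega>) \<le> R" "norm (risk v x \<omega> - ?Y v \<omega>) > \<epsilon>" by auto
          let ?B = "W v \<omega>"
          have comp: "\<bar>(risk v x \<omega> - ?Y v \<omega>) $ j\<bar> \<le>
             (\<bar>w v * v * ((\<rho> v $ j)\<^sup>2 - 1) + lam $ j / 2\<bar> + \<bar>((\<rho> v $ j)\<^sup>2 - 1) * x\<bar> +
              \<bar>2 * \<rho> v $ j * sqrt (1 + x / (v * w v)) - 2\<bar> * (\<bar>R\<bar> + lam $ j + \<bar>x\<bar>)) + w v * (\<Sum>l\<in>UNIV. (?B $ l $ j)\<^sup>2)" for j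
          proof -
            define u where "u = w v * sqrt v * ?B $ first $ j"
            have sq: "w v * sqrt (v + x / w v) * ?B $ first $ j = sqrt (1 + x / (v * w v)) * u"
              unfolding shift_eq[OF v] real_sqrt_mult u_def by simp
            have "\<bar>2 * u - lam $ j / 2 + x\<bar> \<le> R"
              using component_le_norm_cart[of "?Y v \<omega>" j] \<omega>(2) by (simp add: u_def)
            then have u: "\<bar>u\<bar> \<le> \<bar>R\<bar> + lam $ j + \<bar>x\<bar>" using lam[of j] by linarith
            have "(risk v x \<omega> - ?Y v \<omega>) $ j =
              (w v * v * ((\<rho> v $ j)\<^sup>2 - 1) + lam $ j / 2) + ((\<rho> v $ j)\<^sup>2 - 1) * x +
              (2 * \<rho> v $ j * sqrt (1 + x / (v * w v)) - 2) * u + w v * (\<Sum>l\<in>UNIV. (?B $ l $ j)\<^sup>2)"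
            proof -
              have "risk v x \<omega> $ j = w v * v * ((\<rho> v $ j)\<^sup>2 - 1) + (\<rho> v $ j)\<^sup>2 * x +
                  2 * \<rho> v $ j * (sqrt (1 + x / (v * w v)) * u) + w v * (\<Sum>l\<in>UNIV. (?B $ l $ j)\<^sup>2)"
                unfolding sq[symmetric] using normalized_risk_nth[OF p, of first "\<rho> v" ?B j] wv
                by (simp add: mult.assoc)
              moreover have "?Y v \<omega> $ j = 2 * u - lam $ j / 2 + x" by (simp add: u_def)
              ultimately show ?thesis unfolding vector_minus_component by (simp add: algebra_simps)
            qed
            moreover have "\<bar>(2 * \<rho> v $ j * sqrt (1 + x / (v * w v)) - 2) * u\<bar> \<le>
                \<bar>2 * \<rho> v $ j * sqrt (1 + x / (v * w v)) - 2\<bar> * (\<bar>R\<bar> + lam $ j + \<bar>x\<bar>)"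
              unfolding abs_mult using u by (intro mult_left_mono) auto
            moreover have "0 \<le> w v * (\<Sum>l\<in>UNIV. (?B $ l $ j)\<^sup>2)" using wv by (simp add: sum_nonneg)
            ultimately show ?thesis by linarith
          qed
          have "norm (risk v x \<omega> - ?Y v \<omega>) \<le> (\<Sum>j\<in>UNIV. \<bar>(risk v x \<omega> - ?Y v \<omega>) $ j\<bar>)"
            by (rule norm_le_l1_cart)
          also have "\<dots> \<le> A R v + (\<Sum>j\<in>UNIV. w v * (\<Sum>l\<in>UNIV. (?B $ l $ j)\<^sup>2))"
            unfolding A_def sum.distrib[symmetric] by (intro sum_mono comp)
          also have "(\<Sum>j\<in>UNIV. w v * (\<Sum>l\<in>UNIV. (?B $ l $ j)\<^sup>2)) = (norm (sqrt (w v) *\<^sub>R ?B))\<^sup>2"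
            using wv by (simp add: sum_distrib_left[symmetric] sum_squares_matrix power_mult_distrib)
          finally have "\<epsilon> / 2 < (norm (sqrt (w v) *\<^sub>R ?B))\<^sup>2" using \<omega>(3) Av by linarith
          then have "sqrt (\<epsilon> / 2) < norm (sqrt (w v) *\<^sub>R ?B)" by (intro real_less_lsqrt) auto
          then show "\<omega> \<in> {\<omega> \<in> space M. norm (sqrt (w v) *\<^sub>R W v \<omega> - 0) > sqrt (\<epsilon> / 2)}"
            using \<omega>(1) by simp
        qed
      qed
    qed auto
  qed
qed

text \<open>A deviation of the unnormalized risk from \<open>v\<close> by \<open>\<delta> v\<close> means that the normalized risk exceeds
  \<open>\<delta> v w(v)\<close>; this tends to infinity, while the normalized risks are tight.\<close>
lemma threshold_deviation:
  assumes \<nu>: "prob_space \<nu>" "sets \<nu> = sets borel"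
    and conv: "conv_in_distribution (\<lambda>v. distr M borel (\<lambda>\<omega>. risk v 0 \<omega>)) \<nu> at_top" and "0 < \<delta>"
  shows "((\<lambda>v. prob {\<omega> \<in> space M. \<delta> * v <
     \<bar>perturbed_chi_square (\<rho> v) (axis first (sqrt v)) (W v \<omega>) $ j - v\<bar>}) \<longlongrightarrow> 0) at_top"
proof (rule tendstoI)
  fix e :: real assume "0 < e"
  have meas: "\<forall>\<^sub>F v in at_top. (\<lambda>\<omega>. risk v 0 \<omega>) \<in> borel_measurable M"
    using eventually_gt_at_top[of 0] by eventually_elim (rule risk_measurable)
  obtain R where R: "R > 0" "\<forall>\<^sub>F v in at_top. prob {\<omega> \<in> space M. norm (risk v 0 \<omega>) > R} < e"
    using conv_in_distribution_tight[OF M \<nu> meas conv \<open>0 < e\<close>] .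
  have "\<forall>\<^sub>F v in at_top. R / \<delta> \<le> v * w v" using scaling by (simp add: filterlim_at_top)
  with R(2) meas show "\<forall>\<^sub>F v in at_top. dist (prob {\<omega> \<in> space M. \<delta> * v <
     \<bar>perturbed_chi_square (\<rho> v) (axis first (sqrt v)) (W v \<omega>) $ j - v\<bar>}) 0 < e"
    using eventually_gt_at_top[of 0]
  proof eventually_elim
    fix v assume less: "prob {\<omega> \<in> space M. norm (risk v 0 \<omega>) > R} < e" and "R / \<delta> \<le> v * w v"
      and "0 < v" and [measurable]: "(\<lambda>\<omega>. risk v 0 \<omega>) \<in> borel_measurable M"
    then have Rv: "R \<le> w v * (\<delta> * v)" using \<open>0 < \<delta>\<close> by (simp add: field_simps)
    have "prob {\<omega> \<in> space M. \<delta> * v < \<bar>perturbed_chi_square (\<rho> v) (axis first (sqrt v)) (W v \<omega>) $ j - v\<bar>} \<le>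
          prob {\<omega> \<in> space M. norm (risk v 0 \<omega>) > R}"
    proof (rule finite_measure_mono, rule subsetI)
      fix \<omega> assume \<omega>: "\<omega> \<in> {\<omega> \<in> space M. \<delta> * v < \<bar>perturbed_chi_square (\<rho> v) (axis first (sqrt v)) (W v \<omega>) $ j - v\<bar>}"
      have "R < w v * \<bar>perturbed_chi_square (\<rho> v) (axis first (sqrt v)) (W v \<omega>) $ j - v\<bar>"
        using Rv \<omega> w_pos[OF \<open>0 < v\<close>] by (intro le_less_trans[OF Rv] mult_strict_left_mono) auto
      also have "\<dots> = \<bar>risk v 0 \<omega> $ j\<bar>"
        using w_pos[OF \<open>0 < v\<close>] by (simp add: normalized_risk_def abs_mult)
      also have "\<dots> \<le> norm (risk v 0 \<omega>)" by (rule component_le_norm_cart)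
      finally show "\<omega> \<in> {\<omega> \<in> space M. norm (risk v 0 \<omega>) > R}" using \<omega> by simp
    qed measurable
    with less show "dist (prob {\<omega> \<in> space M. \<delta> * v <
     \<bar>perturbed_chi_square (\<rho> v) (axis first (sqrt v)) (W v \<omega>) $ j - v\<bar>}) 0 < e" by (simp add: dist_real_def)
  qed
qed

text \<open>The row \<open>i\<close> chosen different from \<open>first\<close> enters the risk as the square of a centered Gaussian variable
  that is independent of the remaining summands. By \<open>gaussian_square_spread\<close>, a risk concentrated
  within \<open>\<delta> v\<close> of \<open>v\<close> requires a variance of at most \<open>8 \<delta> v / 3\<close>. All rows have the same variance,
  so Markov's inequality applies to every entry of \<open>W\<close>.\<close>
lemma perturbation_negligible:
  assumes \<nu>: "prob_space \<nu>" "sets \<nu> = sets borel" and m: "CARD('m) \<ge> 2"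
    and conv: "conv_in_distribution (\<lambda>v. distr M borel (\<lambda>\<omega>. risk v 0 \<omega>)) \<nu> at_top"
  shows "conv_in_probability M (\<lambda>v \<omega>. (1 / sqrt v) *\<^sub>R W v \<omega>) 0 at_top"
proof (intro conv_in_probability_components[OF M])
  show 1: "\<forall>\<^sub>F v in at_top. (\<lambda>\<omega>. (1 / sqrt v) *\<^sub>R W v \<omega>) \<in> borel_measurable M"
    using eventually_gt_at_top[of 0] by eventually_elim (auto intro: borel_measurable_scaleR W_measurable)
  show "\<forall>\<^sub>F v in at_top. (\<lambda>\<omega>. ((1 / sqrt v) *\<^sub>R W v \<omega>) $ l) \<in> borel_measurable M" for l
    using 1 by eventually_elim (rule measurable_compose[OF _ borel_measurable_vec_nth])
  fix l :: 'm and j :: 'k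
  obtain i :: 'm where i: "i \<noteq> first"
  proof -
    have "UNIV \<noteq> {first}"
    proof
      assume "UNIV = {first}"
      then have "CARD('m) = card {first}" by (rule arg_cong)
      then show False using m by simp
    qed
    then show ?thesis using that by blast
  qed
  let ?p = "min (measure std_normal_distribution {z. z\<^sup>2 \<le> 1/4}) (measure std_normal_distribution {z. 1 \<le> z\<^sup>2})"
  have "{1..2} \<subseteq> {z::real. 1 \<le> z\<^sup>2}" by (auto simp: one_le_power)
  moreover have "{-1/2..1/2} \<subseteq> {z::real. z\<^sup>2 \<le> 1/4}"
  proof
    fix z :: real assume "z \<in> {-1/2..1/2}"
    then have "\<bar>z\<bar>\<^sup>2 \<le> (1/2)\<^sup>2" by (intro power_mono) auto
    then show "z \<in> {z. z\<^sup>2 \<le> 1/4}" by (simp add: power_divide)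
  qed
  ultimately have p: "0 < ?p"
    using measure_std_normal_interval_pos[of 1 2 "{z. 1 \<le> z\<^sup>2}"]
      measure_std_normal_interval_pos[of "-1/2" "1/2" "{z. z\<^sup>2 \<le> 1/4}"] by simp
  show "conv_in_probability M (\<lambda>v \<omega>. ((1 / sqrt v) *\<^sub>R W v \<omega>) $ l $ j) 0 at_top"
    unfolding conv_in_probability_def
  proof (intro allI impI tendstoI)
    fix \<epsilon> e :: real assume "0 < \<epsilon>" "0 < e"
    \<comment> \<open>Markov's inequality will give the bound \<open>8 \<delta> / (3 \<epsilon>\<^sup>2) = e / 3\<close>.\<close>
    define \<delta> where "\<delta> = \<epsilon>\<^sup>2 * e / 8"
    have "0 < \<delta>" using \<open>0 < \<epsilon>\<close> \<open>0 < e\<close> by (simp add: \<delta>_def)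
    have "\<forall>\<^sub>F v in at_top. prob {\<omega> \<in> space M. \<delta> * v <
        \<bar>perturbed_chi_square (\<rho> v) (axis first (sqrt v)) (W v \<omega>) $ j - v\<bar>} < ?p"
      by (rule order_tendstoD(2)[OF threshold_deviation[OF \<nu> conv \<open>0 < \<delta>\<close>] p])
    then show "\<forall>\<^sub>F v in at_top. dist (prob {\<omega> \<in> space M. norm (((1 / sqrt v) *\<^sub>R W v \<omega>) $ l $ j - 0) > \<epsilon>}) 0 < e"
      using eventually_gt_at_top[of 0]
    proof eventually_elim
      fix v :: real assume dev: "prob {\<omega> \<in> space M. \<delta> * v <
        \<bar>perturbed_chi_square (\<rho> v) (axis first (sqrt v)) (W v \<omega>) $ j - v\<bar>} < ?p" and v: "0 < v"
      note [measurable] = W_measurable[OF v]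
      have g: "centered_gaussian_vector M (\<lambda>\<omega>. W v \<omega> $ i)" for i
        using W[OF v] by (simp add: iid_gaussian_rows_def)
      obtain \<sigma> where d: "distr M borel (\<lambda>\<omega>. axis j 1 \<bullet> W v \<omega> $ i) = distr std_normal_distribution borel (\<lambda>z. \<sigma> * z)"
        using centered_gaussian_vector_projection[OF M g] .
      then have di: "distr M borel (\<lambda>\<omega>. W v \<omega> $ i $ j) = distr std_normal_distribution borel (\<lambda>z. \<sigma> * z)"
        by (simp add: inner_axis')
      let ?X = "\<lambda>l \<omega>. (\<rho> v $ j * axis first (sqrt v) $ l + W v \<omega> $ l $ j)\<^sup>2"
      have "indep_vars (\<lambda>_. borel) (\<lambda>l \<omega>. W v \<omega> $ l) UNIV"
        using W[OF v] by (simp add: iid_gaussian_rows_def)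
      then have "indep_vars (\<lambda>_. borel) ?X UNIV"
        by (rule indep_vars_compose2[where Y="\<lambda>l b. (\<rho> v $ j * axis first (sqrt v) $ l + b $ j)\<^sup>2"]) simp
      then have ind: "indep_var borel (?X i) borel (\<lambda>\<omega>. \<Sum>l\<in>UNIV - {i}. ?X l \<omega>)"
        by (intro indep_vars_sum) (simp_all add: insert_absorb)
      have Xi: "?X i = (\<lambda>\<omega>. (W v \<omega> $ i $ j)\<^sup>2)" using i by (simp add: axis_def)
      have "perturbed_chi_square (\<rho> v) (axis first (sqrt v)) (W v \<omega>) $ j =
          (W v \<omega> $ i $ j)\<^sup>2 + (\<Sum>l\<in>UNIV - {i}. ?X l \<omega>)" for \<omega>
        unfolding perturbed_chi_square_def using fun_cong[OF Xi, of \<omega>] by (simp add: sum.remove[of UNIV i])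
      then have "\<not> 8 * (\<delta> * v) < 3 * \<sigma>\<^sup>2"
        using dev gaussian_square_spread[OF M _ ind[unfolded Xi] di, of "\<delta> * v" v] by auto
      then have \<sigma>: "\<sigma>\<^sup>2 / (\<epsilon>\<^sup>2 * v) < e"
        using v \<open>0 < \<epsilon>\<close> \<open>0 < e\<close> unfolding \<delta>_def by (simp add: divide_less_eq not_less mult_ac) (smt (verit) mult_pos_pos zero_less_power)
      have sq: "(LINT \<omega>|M. (axis j 1 \<bullet> W v \<omega> $ l)\<^sup>2) = \<sigma>\<^sup>2"
      proof -
        have "(LINT \<omega>|M. (axis j 1 \<bullet> W v \<omega> $ l)\<^sup>2) = (LINT y|distr M borel (\<lambda>\<omega>. W v \<omega> $ l). (axis j 1 \<bullet> y)\<^sup>2)"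
          by (simp add: integral_distr)
        also have "\<dots> = (LINT \<omega>|M. (axis j 1 \<bullet> W v \<omega> $ i)\<^sup>2)"
          unfolding W_row_law[OF v, of l i] by (simp add: integral_distr)
        also have "\<dots> = (LINT y|distr M borel (\<lambda>\<omega>. axis j 1 \<bullet> W v \<omega> $ i). y\<^sup>2)"
          by (simp add: integral_distr)
        also have "\<dots> = \<sigma>\<^sup>2"
          unfolding d using std_normal_distribution_even_moments(1)[of 1] by (simp add: integral_distr power_mult_distrib)
        finally show ?thesis .
      qed
      have "prob {\<omega> \<in> space M. norm (((1 / sqrt v) *\<^sub>R W v \<omega>) $ l $ j - 0) > \<epsilon>} \<le>
            prob {\<omega> \<in> space M. (axis j 1 \<bullet> W v \<omega> $ l)\<^sup>2 \<ge> \<epsilon>\<^sup>2 * v}"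
      proof (rule finite_measure_mono, rule subsetI)
        fix \<omega> assume \<omega>: "\<omega> \<in> {\<omega> \<in> space M. norm (((1 / sqrt v) *\<^sub>R W v \<omega>) $ l $ j - 0) > \<epsilon>}"
        then have "\<epsilon> * sqrt v \<le> \<bar>W v \<omega> $ l $ j\<bar>" using v by (simp add: abs_mult field_simps)
        then have "(\<epsilon> * sqrt v)\<^sup>2 \<le> \<bar>W v \<omega> $ l $ j\<bar>\<^sup>2"
          using \<open>0 < \<epsilon>\<close> v by (intro power_mono) auto
        then show "\<omega> \<in> {\<omega> \<in> space M. (axis j 1 \<bullet> W v \<omega> $ l)\<^sup>2 \<ge> \<epsilon>\<^sup>2 * v}"
          using \<omega> v by (simp add: inner_axis' power_mult_distrib)
      qed measurable
      also have "\<dots> \<le> \<sigma>\<^sup>2 / (\<epsilon>\<^sup>2 * v)"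
        using integral_Markov_inequality_measure[where u="\<lambda>\<omega>. (axis j 1 \<bullet> W v \<omega> $ l)\<^sup>2" and A="{}" and c="\<epsilon>\<^sup>2 * v",
            OF integrable_gaussian_square[OF M g]] v \<open>0 < \<epsilon>\<close>
        by (simp add: sq)
      also note \<sigma>
      finally show "dist (prob {\<omega> \<in> space M. norm (((1 / sqrt v) *\<^sub>R W v \<omega>) $ l $ j - 0) > \<epsilon>}) 0 < e"
        by (simp add: dist_real_def)
    qed
  qed
qed

text \<open>The risk divided by \<open>v\<close> is close to 1 and \<open>W / sqrt v\<close> is close to 0, each with probability more
  than one half, hence both at some common point \<open>\<omega>\<close>. At that point the expansion of the square becomes a deterministic
  estimate of \<open>\<rho>\<^sub>j\<^sup>2 - 1\<close>.\<close>
lemma coefficient_square_tendsto_1: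
  assumes \<nu>: "prob_space \<nu>" "sets \<nu> = sets borel" and m: "CARD('m) \<ge> 2"
    and conv: "conv_in_distribution (\<lambda>v. distr M borel (\<lambda>\<omega>. risk v 0 \<omega>)) \<nu> at_top"
  shows "((\<lambda>v. (\<rho> v $ j)\<^sup>2) \<longlongrightarrow> 1) at_top"
proof (rule tendstoI)
  fix e :: real assume "0 < e"
  \<comment> \<open>The estimates below give \<open>|\<rho>\<^sub>j\<^sup>2 - 1| \<le> 7 \<eta>\<close>; \<open>\<eta> \<le> 1/2\<close> allows \<open>\<eta> |\<rho>\<^sub>j\<^sup>2 - 1|\<close> to be absorbed on the left.\<close>
  define \<eta> where "\<eta> = min (e / 16) (1/2)"
  have \<eta>: "0 < \<eta>" "\<eta> \<le> 1/2" "16 * \<eta> \<le> e" using \<open>0 < e\<close> by (auto simp: \<eta>_def)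
  have 1: "\<forall>\<^sub>F v in at_top. prob {\<omega> \<in> space M. \<eta> * v <
        \<bar>perturbed_chi_square (\<rho> v) (axis first (sqrt v)) (W v \<omega>) $ j - v\<bar>} < 1/2"
    by (rule order_tendstoD(2)[OF threshold_deviation[OF \<nu> conv \<eta>(1)]]) simp
  have "((\<lambda>v. prob {\<omega> \<in> space M. norm ((1 / sqrt v) *\<^sub>R W v \<omega> - 0) > \<eta>}) \<longlongrightarrow> 0) at_top"
    using perturbation_negligible[OF \<nu> m conv] \<eta>(1) unfolding conv_in_probability_def by blast
  then have 2: "\<forall>\<^sub>F v in at_top. prob {\<omega> \<in> space M. norm ((1 / sqrt v) *\<^sub>R W v \<omega> - 0) > \<eta>} < 1/2"
    by (rule order_tendstoD) simp
  show "\<forall>\<^sub>F v in at_top. dist ((\<rho> v $ j)\<^sup>2) 1 < e"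
    using 1 2 eventually_gt_at_top[of 0]
  proof eventually_elim
    fix v :: real
    let ?S = "{\<omega> \<in> space M. \<eta> * v < \<bar>perturbed_chi_square (\<rho> v) (axis first (sqrt v)) (W v \<omega>) $ j - v\<bar>}"
    let ?T = "{\<omega> \<in> space M. norm ((1 / sqrt v) *\<^sub>R W v \<omega> - 0) > \<eta>}"
    assume S: "prob ?S < 1/2" and T: "prob ?T < 1/2" and v: "0 < v"
    note [measurable] = W_measurable[OF v]
    have "prob (?S \<union> ?T) \<le> prob ?S + prob ?T" by (intro measure_Un_le) auto
    then have "?S \<union> ?T \<noteq> space M" using S T prob_space by auto
    then obtain \<omega> where "\<omega> \<in> space M" "\<omega> \<notin> ?S" "\<omega> \<notin> ?T" by blast
    then have \<omega>: "\<bar>perturbed_chi_square (\<rho> v) (axis first (sqrt v)) (W v \<omega>) $ j - v\<bar> \<le> \<eta> * v"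
        "norm ((1 / sqrt v) *\<^sub>R W v \<omega>) \<le> \<eta>"
      by (simp_all add: not_less)
    define B where "B = (1 / sqrt v) *\<^sub>R W v \<omega>"
    define D where "D = (\<Sum>l\<in>UNIV. (B $ l $ j)\<^sup>2)"
    have WB: "W v \<omega> = sqrt v *\<^sub>R B" using v by (simp add: B_def)
    let ?r = "\<rho> v $ j"
    have "perturbed_chi_square (\<rho> v) (axis first (sqrt v)) (W v \<omega>) $ j = v * (?r\<^sup>2 + 2 * ?r * B $ first $ j + D)"
      using v unfolding perturbed_chi_square_axis WB D_def
      by (simp add: power_mult_distrib sum_distrib_left[symmetric] algebra_simps)
    then have "perturbed_chi_square (\<rho> v) (axis first (sqrt v)) (W v \<omega>) $ j - v =
        v * (?r\<^sup>2 + 2 * ?r * B $ first $ j + D - 1)"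
      by (simp only: right_diff_distrib mult_1_right)
    then have "v * \<bar>?r\<^sup>2 + 2 * ?r * B $ first $ j + D - 1\<bar> \<le> v * \<eta>"
      using \<omega>(1) v by (simp only: abs_mult abs_of_pos mult.commute)
    then have main: "\<bar>?r\<^sup>2 + 2 * ?r * B $ first $ j + D - 1\<bar> \<le> \<eta>"
      using v by simp
    have b: "\<bar>B $ first $ j\<bar> \<le> \<eta>"
      using component_le_norm_cart[of "B $ first" j] Finite_Cartesian_Product.norm_nth_le[of B first] \<omega>(2) by (simp add: B_def[symmetric])
    have "D \<le> (\<Sum>j\<in>UNIV. \<Sum>l\<in>UNIV. (B $ l $ j)\<^sup>2)"
      unfolding D_def by (rule member_le_sum) (auto intro: sum_nonneg)
    also have "\<dots> \<le> \<eta>\<^sup>2"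
      unfolding sum_squares_matrix using \<omega>(2) by (intro power_mono) (auto simp: B_def)
    also have "\<dots> \<le> \<eta> / 2" using \<eta> by (simp add: power2_eq_square)
    finally have D: "D \<le> \<eta> / 2" .
    have D0: "0 \<le> D" unfolding D_def by (simp add: sum_nonneg)
    have "2 * \<bar>?r\<bar> \<le> 1 + ?r\<^sup>2"
      using zero_le_power2[of "\<bar>?r\<bar> - 1"] by (simp add: power2_diff)
    then have "(2 * \<bar>?r\<bar>) * \<bar>B $ first $ j\<bar> \<le> (1 + ?r\<^sup>2) * \<eta>"
      using b by (intro mult_mono) auto
    then have "\<bar>2 * ?r * B $ first $ j\<bar> \<le> \<eta> * (1 + ?r\<^sup>2)" by (simp add: abs_mult mult.commute)
    moreover have "\<eta> * (1 + ?r\<^sup>2) \<le> \<eta> * (2 + \<bar>?r\<^sup>2 - 1\<bar>)" using \<eta> by (intro mult_left_mono) auto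
    moreover have "\<eta> * \<bar>?r\<^sup>2 - 1\<bar> \<le> 1/2 * \<bar>?r\<^sup>2 - 1\<bar>" using \<eta> by (intro mult_right_mono) auto
    ultimately have "\<bar>?r\<^sup>2 - 1\<bar> \<le> \<eta> + \<eta> / 2 + 2 * \<eta> + 1/2 * \<bar>?r\<^sup>2 - 1\<bar>"
      using main D D0 unfolding distrib_left mult_1_right by linarith
    then have "\<bar>?r\<^sup>2 - 1\<bar> \<le> 7 * \<eta>" by simp
    also have "\<dots> < e" using \<eta> by linarith
    finally show "dist (?r\<^sup>2) 1 < e" by (simp add: dist_real_def)
  qed
qed

end

section \<open>Moving shifts and exceedances\<close>

lemma sqrt_increment_bound:
  fixes v c s :: real
  assumes "0 < v" "0 < c" "0 \<le> v + s / c"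
  shows "\<bar>c * sqrt (v + s / c) - c * sqrt v\<bar> \<le> \<bar>s\<bar> / sqrt v"
proof -
  let ?d = "c * sqrt (v + s / c) - c * sqrt v"
  have "?d * (sqrt (v + s / c) + sqrt v) = c * ((v + s / c) - v)"
    using assms by (simp add: algebra_simps)
  also have "\<dots> = s" using assms by simp
  finally have eq: "\<bar>?d\<bar> * (sqrt (v + s / c) + sqrt v) = \<bar>s\<bar>"
    using assms by (metis abs_mult abs_of_nonneg add_nonneg_nonneg less_imp_le real_sqrt_ge_zero)
  have "\<bar>?d\<bar> * sqrt v \<le> \<bar>?d\<bar> * (sqrt (v + s / c) + sqrt v)"
    using assms by (intro mult_left_mono) auto
  then show ?thesis unfolding eq using assms by (simp add: pos_le_divide_eq)
qed

context perturbed_risks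
begin

text \<open>Changing the shift from 0 to \<open>s\<close> adds
  \<open>\<rho>\<^sub>j\<^sup>2 s + 2 \<rho>\<^sub>j w (sqrt(v + s/w) - sqrt v) W\<^bsub>1j\<^esub>\<close> to the \<open>j\<close>-th risk. The second term is at most
  \<open>2 |\<rho>\<^sub>j| |s| |W\<^bsub>1j\<^esub>| / sqrt v\<close> and the coefficients satisfy \<open>\<rho>\<^sub>j\<^sup>2 \<longrightarrow> 1\<close>, so the increment is
  asymptotically \<open>s\<close>, locally uniformly in \<open>s\<close>.\<close>
lemma risk_conv_moving_shift:
  assumes N: "prob_space N" and V[measurable]: "V \<in> borel_measurable N" and m: "CARD('m) \<ge> 2"
    and conv: "conv_in_distribution (\<lambda>v. distr M borel (\<lambda>\<omega>. risk v 0 \<omega>)) (distr N borel V) at_top"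
    and v: "filterlim v at_top F" and s: "(s \<longlongrightarrow> s0) F"
  shows "conv_in_distribution (\<lambda>n. distr M borel (\<lambda>\<omega>. (s n, risk (v n) (s n) \<omega>)))
           (distr N borel (\<lambda>\<omega>. (s0, \<chi> j. V \<omega> $ j + s0))) F"
proof -
  let ?g = "\<lambda>u::real^'k. (s0, (\<chi> j. u $ j + s0)::real^'k)"
  let ?Y = "\<lambda>n \<omega>. ?g (risk (v n) 0 \<omega>)"
  let ?Z = "\<lambda>n \<omega>. (s n, risk (v n) (s n) \<omega>)"
  have g: "continuous_on UNIV ?g" by (intro continuous_intros)
  note gm[measurable] = borel_measurable_continuous_onI[OF g]
  have \<nu>: "prob_space (distr N borel V)" "sets (distr N borel V) = sets borel"
    using prob_space.prob_space_distr[OF N V] by auto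
  have vpos: "\<forall>\<^sub>F n in F. 0 < v n" using v by (simp add: filterlim_at_top_dense)
  have rho: "((\<lambda>n. (\<rho> (v n) $ j)\<^sup>2) \<longlongrightarrow> 1) F" for j
    by (rule filterlim_compose[OF coefficient_square_tendsto_1[OF \<nu> m conv] v])
  have absrho: "((\<lambda>n. \<bar>\<rho> (v n) $ j\<bar>) \<longlongrightarrow> 1) F" for j
    using tendsto_real_sqrt[OF rho] by simp
  \<comment> \<open>The distance between \<open>?Z n\<close> and \<open>?Y n\<close> is at most \<open>A n + b n * norm (W / sqrt v)\<close>.\<close>
  define A where "A n = \<bar>s n - s0\<bar> + (\<Sum>j\<in>UNIV. \<bar>(\<rho> (v n) $ j)\<^sup>2 - 1\<bar> * \<bar>s n\<bar> + \<bar>s n - s0\<bar>)" for n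
  define b where "b n = (\<Sum>j\<in>UNIV. 2 * \<bar>\<rho> (v n) $ j\<bar> * \<bar>s n\<bar>)" for n
  define b0 where "b0 = (\<Sum>j\<in>(UNIV::'k set). 2 * 1 * \<bar>s0\<bar>)"
  have "(A \<longlongrightarrow> \<bar>s0 - s0\<bar> + (\<Sum>j\<in>(UNIV::'k set). \<bar>1 - 1\<bar> * \<bar>s0\<bar> + \<bar>s0 - s0\<bar>)) F"
    unfolding A_def by (intro tendsto_intros rho s)
  then have A: "(A \<longlongrightarrow> 0) F" by simp
  have b: "(b \<longlongrightarrow> b0) F"
    unfolding b_def b0_def by (intro tendsto_intros absrho s)
  have b0: "0 \<le> b0" unfolding b0_def by (intro sum_nonneg) auto
  show ?thesis
  proof (rule conv_in_distribution_slutsky[where Y="?Y"])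
    show "prob_space M" by (rule M)
    show "prob_space (distr N borel (\<lambda>\<omega>. ?g (V \<omega>)))"
      by (rule prob_space.prob_space_distr[OF N]) measurable
    show "sets (distr N borel (\<lambda>\<omega>. ?g (V \<omega>))) = sets borel" by simp
    show "\<forall>\<^sub>F n in F. ?Y n \<in> borel_measurable M"
      using vpos by eventually_elim (rule measurable_compose[OF risk_measurable gm])
    show "\<forall>\<^sub>F n in F. ?Z n \<in> borel_measurable M"
      using vpos by eventually_elim (rule borel_measurable_Pair[OF borel_measurable_const risk_measurable])
    show "conv_in_distribution (\<lambda>n. distr M borel (?Y n)) (distr N borel (\<lambda>\<omega>. ?g (V \<omega>))) F"
    proof (rule conv_in_distribution_continuous_image[OF conv_in_distribution_compose[OF conv v] g _ V])
      show "\<forall>\<^sub>F n in F. (\<lambda>\<omega>. risk (v n) 0 \<omega>) \<in> borel_measurable M"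
        using vpos by eventually_elim (rule risk_measurable)
    qed
    fix R \<epsilon> :: real assume \<epsilon>: "0 < \<epsilon>"
    define d where "d = \<epsilon> / 2 / (b0 + 1)"
    have "b0 + 1 \<noteq> 0" using b0 by linarith
    then have "(b0 + 1) * d = \<epsilon> / 2"
      by (metis d_def mult.commute nonzero_eq_divide_eq)
    moreover have "0 < d" using \<epsilon> b0 by (simp add: d_def)
    ultimately have d: "0 < d" "(b0 + 1) * d = \<epsilon> / 2" by auto
    have "((\<lambda>v. prob {\<omega> \<in> space M. norm ((1 / sqrt v) *\<^sub>R W v \<omega> - 0) > d}) \<longlongrightarrow> 0) at_top"
      using perturbation_negligible[OF \<nu> m conv] d(1) unfolding conv_in_probability_def by blast
    note lim0 = filterlim_compose[OF this v]
    show "((\<lambda>n. prob {\<omega> \<in> space M. norm (?Y n \<omega>) \<le> R \<and> norm (?Z n \<omega> - ?Y n \<omega>) > \<epsilon>}) \<longlongrightarrow> 0) F"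
    proof (rule tendsto_sandwich[OF _ _ tendsto_const lim0])
      have "\<forall>\<^sub>F n in F. A n < \<epsilon> / 2" using \<epsilon> by (intro order_tendstoD[OF A]) auto
      moreover have "\<forall>\<^sub>F n in F. b n < b0 + 1" by (intro order_tendstoD[OF b]) auto
      ultimately show "\<forall>\<^sub>F n in F. prob {\<omega> \<in> space M. norm (?Y n \<omega>) \<le> R \<and> norm (?Z n \<omega> - ?Y n \<omega>) > \<epsilon>}
          \<le> prob {\<omega> \<in> space M. norm ((1 / sqrt (v n)) *\<^sub>R W (v n) \<omega> - 0) > d}"
        using eventually_shift_pos[OF v s]
      proof eventually_elim
        fix n assume An: "A n < \<epsilon> / 2" and bn: "b n < b0 + 1" and "0 < v n \<and> 0 < v n + s n / w (v n)"
        then have vn: "0 < v n" and p: "0 \<le> v n + s n / w (v n)" by auto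
        have wv: "w (v n) > 0" using w_pos vn .
        note [measurable] = W_measurable[OF vn]
        show "prob {\<omega> \<in> space M. norm (?Y n \<omega>) \<le> R \<and> norm (?Z n \<omega> - ?Y n \<omega>) > \<epsilon>}
          \<le> prob {\<omega> \<in> space M. norm ((1 / sqrt (v n)) *\<^sub>R W (v n) \<omega> - 0) > d}"
        proof (rule finite_measure_mono, rule subsetI)
          show "{\<omega> \<in> space M. norm ((1 / sqrt (v n)) *\<^sub>R W (v n) \<omega> - 0) > d} \<in> sets M" by measurable
          fix \<omega> assume \<omega>: "\<omega> \<in> {\<omega> \<in> space M. norm (?Y n \<omega>) \<le> R \<and> norm (?Z n \<omega> - ?Y n \<omega>) > \<epsilon>}"
          let ?B = "W (v n) \<omega>"
          let ?t = "norm ((1 / sqrt (v n)) *\<^sub>R ?B)"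
          let ?D = "risk (v n) (s n) \<omega> - (\<chi> j. risk (v n) 0 \<omega> $ j + s0)"
          have comp: "\<bar>?D $ j\<bar> \<le> (\<bar>(\<rho> (v n) $ j)\<^sup>2 - 1\<bar> * \<bar>s n\<bar> + \<bar>s n - s0\<bar>) + 2 * \<bar>\<rho> (v n) $ j\<bar> * \<bar>s n\<bar> * ?t" for j
          proof -
            let ?r = "\<rho> (v n) $ j"
            let ?e = "w (v n) * sqrt (v n + s n / w (v n)) - w (v n) * sqrt (v n)"
            have r1: "risk (v n) (s n) \<omega> $ j = w (v n) * v n * (?r\<^sup>2 - 1) + ?r\<^sup>2 * s n +
                2 * ?r * (w (v n) * sqrt (v n + s n / w (v n))) * ?B $ first $ j + w (v n) * (\<Sum>l\<in>UNIV. (?B $ l $ j)\<^sup>2)"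
              using p wv by (intro normalized_risk_nth) auto
            have r0: "risk (v n) 0 \<omega> $ j = w (v n) * v n * (?r\<^sup>2 - 1) +
                2 * ?r * (w (v n) * sqrt (v n)) * ?B $ first $ j + w (v n) * (\<Sum>l\<in>UNIV. (?B $ l $ j)\<^sup>2)"
              using normalized_risk_nth[of "v n" 0 "w (v n)" first "\<rho> (v n)" ?B j] vn wv by simp
            have D: "?D $ j = (?r\<^sup>2 - 1) * s n + (s n - s0) + 2 * ?r * ?e * ?B $ first $ j"
              unfolding vector_minus_component vec_lambda_beta r1 r0 by (simp add: algebra_simps)
            have "\<bar>?e * ?B $ first $ j\<bar> \<le> \<bar>s n\<bar> / sqrt (v n) * norm ?B"
              unfolding abs_mult
              using sqrt_increment_bound[OF vn wv p] component_le_norm_cart[of "?B $ first" j]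
                Finite_Cartesian_Product.norm_nth_le[of ?B first] vn
              by (intro mult_mono) auto
            also have "\<dots> = \<bar>s n\<bar> * ?t" using vn by simp
            finally have "2 * \<bar>?r\<bar> * \<bar>?e * ?B $ first $ j\<bar> \<le> 2 * \<bar>?r\<bar> * (\<bar>s n\<bar> * ?t)"
              by (intro mult_left_mono) auto
            then have "\<bar>2 * ?r * ?e * ?B $ first $ j\<bar> \<le> 2 * \<bar>?r\<bar> * \<bar>s n\<bar> * ?t"
              by (simp only: abs_mult mult.assoc abs_numeral)
            moreover have "\<bar>(?r\<^sup>2 - 1) * s n\<bar> = \<bar>?r\<^sup>2 - 1\<bar> * \<bar>s n\<bar>" by (rule abs_mult)
            ultimately show ?thesis unfolding D by linarith
          qed
          have "norm ?D \<le> (\<Sum>j\<in>UNIV. \<bar>?D $ j\<bar>)" by (rule norm_le_l1_cart)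
          also have "\<dots> \<le> (\<Sum>j\<in>UNIV. (\<bar>(\<rho> (v n) $ j)\<^sup>2 - 1\<bar> * \<bar>s n\<bar> + \<bar>s n - s0\<bar>) + 2 * \<bar>\<rho> (v n) $ j\<bar> * \<bar>s n\<bar> * ?t)"
            by (intro sum_mono comp)
          also have "\<dots> = (A n - \<bar>s n - s0\<bar>) + b n * ?t"
            unfolding A_def b_def by (simp only: sum.distrib sum_distrib_right)
          finally have "norm ?D \<le> (A n - \<bar>s n - s0\<bar>) + b n * ?t" .
          moreover have "norm (?Z n \<omega> - ?Y n \<omega>) \<le> \<bar>s n - s0\<bar> + norm ?D"
            using norm_Pair_le[of "s n - s0" ?D] by simp
          ultimately have "\<epsilon> < A n + b n * ?t" using \<omega> by simp
          then have "\<epsilon> / 2 < b n * ?t" using An by linarith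
          also have "\<dots> \<le> (b0 + 1) * ?t" using bn by (intro mult_right_mono) auto
          finally have "(b0 + 1) * d < (b0 + 1) * ?t" unfolding d(2) .
          then have "d < ?t" by (rule mult_left_less_imp_less) (use b0 in simp)
          then show "\<omega> \<in> {\<omega> \<in> space M. norm ((1 / sqrt (v n)) *\<^sub>R W (v n) \<omega> - 0) > d}"
            using \<omega> by simp
        qed
      qed
    qed auto
  qed
qed

lemma cond_risk_limit_iff:
  assumes Q: "fibre_cond_distribution M X Q"
  shows "cond_risk_limit M Q W \<rho> w N U lam x \<longleftrightarrow>
    conv_in_distribution (\<lambda>v. distr M borel (\<lambda>\<omega>. risk v x \<omega>))
      (distr N borel (\<lambda>\<omega>. \<chi> j. 2 * U \<omega> $ j - lam $ j / 2 + x)) at_top"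
proof -
  have ev: "\<forall>\<^sub>F v in at_top. distr (cond_risk_law M Q (W v) (\<rho> v) (v + x / w v)) borel (\<lambda>z. \<chi> j. w v * (z $ j - v)) =
      distr M borel (\<lambda>\<omega>. risk v x \<omega>)"
    using eventually_shift_pos[OF filterlim_ident tendsto_const[of x]]
  proof eventually_elim
    fix v assume "0 < v \<and> 0 < v + x / w v"
    then have v: "0 < v" and p: "0 \<le> v + x / w v" by auto
    note [measurable] = W_measurable[OF v]
    have [measurable]: "(\<lambda>z::real^'k. \<chi> j. w v * (z $ j - v)) \<in> borel_measurable borel"
      by (intro borel_measurable_continuous_onI continuous_intros)
    show "distr (cond_risk_law M Q (W v) (\<rho> v) (v + x / w v)) borel (\<lambda>z. \<chi> j. w v * (z $ j - v)) =
      distr M borel (\<lambda>\<omega>. risk v x \<omega>)"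
      unfolding cond_risk_law_eq_distr[OF M W[OF v] Q p, of _ first]
      by (subst distr_distr) (auto simp: comp_def normalized_risk_def)
  qed
  then have ev': "\<forall>\<^sub>F v in at_top. distr M borel (\<lambda>\<omega>. risk v x \<omega>) =
      distr (cond_risk_law M Q (W v) (\<rho> v) (v + x / w v)) borel (\<lambda>z. \<chi> j. w v * (z $ j - v))"
    by eventually_elim simp
  show ?thesis
    unfolding cond_risk_limit_def
    using conv_in_distribution_cong[OF _ ev] conv_in_distribution_cong[OF _ ev'] by blast
qed

end

lemma integral_uniform_measure:
  fixes g :: "'a \<Rightarrow> real"
  assumes M: "prob_space M" and S: "S \<in> sets M" and pos: "0 < measure M S" and g: "g \<in> borel_measurable M"
  shows "integral\<^sup>L (uniform_measure M S) g = (LINT \<omega>|M. indicator S \<omega> / measure M S * g \<omega>)"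
proof -
  interpret prob_space M by fact
  have "uniform_measure M S = density M (\<lambda>\<omega>. ennreal (indicator S \<omega> / measure M S))"
    unfolding uniform_measure_def
    by (intro arg_cong[where f="density M"] ext)
      (auto simp: emeasure_eq_measure divide_ennreal[symmetric] pos ennreal_1[symmetric] split: split_indicator simp del: ennreal_1)
  then show ?thesis using S g by (simp add: integral_density)
qed

text \<open>Conditioning on \<open>\<zeta>\<^sub>1 > v\<close> restricts \<open>X\<close> but leaves the independent \<open>W\<close> untouched; integrating \<open>W\<close>
  out first and rotating \<open>X\<close> onto the axis leaves a function of the exceedance alone.\<close>
lemma exceedance_risk_integral:
  fixes X :: "'a \<Rightarrow> real^'m" and W :: "'a \<Rightarrow> real^'k^'m" and f :: "real \<times> (real^'k) \<Rightarrow> real"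
  assumes M: "prob_space M" and W: "iid_gaussian_rows M W" and ind: "independent_variables M X W"
    and f[measurable]: "f \<in> borel_measurable borel" and bd: "\<And>z. \<bar>f z\<bar> \<le> K"
    and c: "0 < c" and pos: "0 < measure M {\<omega> \<in> space M. chi_square (X \<omega>) > v}"
  shows "integral\<^sup>L (distr (uniform_measure M {\<omega> \<in> space M. chi_square (X \<omega>) > v}) borel
            (\<lambda>\<omega>. (c * (chi_square (X \<omega>) - v), \<chi> j. c * (perturbed_chi_square r (X \<omega>) (W \<omega>) $ j - v)))) f =
         (LINT s|distr (uniform_measure M {\<omega> \<in> space M. chi_square (X \<omega>) > v}) borel (\<lambda>\<omega>. c * (chi_square (X \<omega>) - v)).
            LINT \<omega>|M. f (s, normalized_risk first c v r s (W \<omega>)))"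
proof -
  interpret prob_space M by fact
  have X[measurable]: "X \<in> borel_measurable M" and Wm[measurable]: "W \<in> borel_measurable M"
    using ind by (auto simp: independent_variables_def)
  let ?A = "{\<omega> \<in> space M. chi_square (X \<omega>) > v}"
  let ?P = "measure M ?A"
  have A[measurable]: "?A \<in> sets M" by measurable
  define T where "T x B = (c * (chi_square x - v), \<chi> j. c * (perturbed_chi_square r x B $ j - v))"
    for x :: "real^'m" and B :: "real^'k^'m"
  define H where "H s = (LINT \<omega>|M. f (s, normalized_risk first c v r s (W \<omega>)))" for s
  have "continuous_on UNIV (\<lambda>p. T (fst p) (snd p))"
    unfolding T_def chi_square_def perturbed_chi_square_def by (intro continuous_intros)
  then have T[measurable]: "(\<lambda>p. T (fst p) (snd p)) \<in> borel_measurable (borel \<Otimes>\<^sub>M borel)"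
    unfolding borel_prod by (rule borel_measurable_continuous_onI)
  have TXW[measurable]: "(\<lambda>\<omega>. T (X \<omega>) (W \<omega>)) \<in> borel_measurable M"
    using measurable_compose[OF measurable_Pair[OF X Wm] T] by simp
  have rm[measurable]: "(\<lambda>p. normalized_risk first c v r (fst p) (snd p)) \<in> borel_measurable (borel \<Otimes>\<^sub>M borel)"
    using borel_measurable_normalized_risk[of first c v r] by (simp add: split_beta)
  have rm'[measurable]: "(\<lambda>p. normalized_risk first c v r (fst p) (W (snd p))) \<in> borel_measurable (borel \<Otimes>\<^sub>M M)"
    using measurable_compose[OF _ rm, of "\<lambda>p. (fst p, W (snd p))" "borel \<Otimes>\<^sub>M M"] by simp
  have Hm[measurable]: "H \<in> borel_measurable borel"
    unfolding H_def by (rule borel_measurable_lebesgue_integral) (simp add: split_beta)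
  have inner: "(LINT \<omega>'|M. f (T x (W \<omega>'))) = H (c * (chi_square x - v))" for x
  proof -
    have sq: "sqrt (v + c * (chi_square x - v) / c) = norm x"
      using c by (simp add: chi_square_eq_norm)
    have [measurable]: "(\<lambda>z::real^'k. f (c * (chi_square x - v), \<chi> j. c * (z $ j - v))) \<in> borel_measurable borel"
      by (rule measurable_compose[OF _ f]) (intro borel_measurable_continuous_onI continuous_intros)
    have "(LINT \<omega>'|M. f (T x (W \<omega>'))) =
      (LINT z|distr M borel (\<lambda>\<omega>. perturbed_chi_square r x (W \<omega>)). f (c * (chi_square x - v), \<chi> j. c * (z $ j - v)))"
      unfolding T_def by (subst integral_distr) auto
    also have "distr M borel (\<lambda>\<omega>. perturbed_chi_square r x (W \<omega>)) =
        distr M borel (\<lambda>\<omega>. perturbed_chi_square r (axis first (norm x)) (W \<omega>))"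
      by (rule distr_perturbed_chi_square_eq[OF M W]) (simp add: norm_eq_sqrt_inner inner_axis_axis)
    also have "(LINT z|\<dots>. f (c * (chi_square x - v), \<chi> j. c * (z $ j - v))) = H (c * (chi_square x - v))"
      unfolding H_def normalized_risk_def sq by (subst integral_distr) auto
    finally show ?thesis .
  qed
  let ?\<phi> = "\<lambda>x B. indicator {v<..} (chi_square x) / ?P * f (T x B)"
  have "integral\<^sup>L (distr (uniform_measure M ?A) borel (\<lambda>\<omega>. T (X \<omega>) (W \<omega>))) f =
        integral\<^sup>L (uniform_measure M ?A) (\<lambda>\<omega>. f (T (X \<omega>) (W \<omega>)))"
    by (rule integral_distr) auto
  also have "\<dots> = (LINT \<omega>|M. indicator ?A \<omega> / ?P * f (T (X \<omega>) (W \<omega>)))"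
    by (rule integral_uniform_measure[OF M A pos]) measurable
  also have "\<dots> = (LINT \<omega>|M. ?\<phi> (X \<omega>) (W \<omega>))"
    by (intro Bochner_Integration.integral_cong) (auto simp: indicator_def)
  also have "\<dots> = (LINT \<omega>|M. LINT \<omega>'|M. ?\<phi> (X \<omega>) (W \<omega>'))"
  proof (rule independent_variables_integral[OF M ind, where B="1 / ?P * K"])
    show "(\<lambda>(x, B). ?\<phi> x B) \<in> borel_measurable (borel \<Otimes>\<^sub>M borel)"
      unfolding split_beta by measurable
    show "\<bar>?\<phi> x B\<bar> \<le> 1 / ?P * K" for x B
      unfolding abs_mult using pos bd by (intro mult_mono) (auto split: split_indicator)
  qed
  also have "\<dots> = (LINT \<omega>|M. indicator ?A \<omega> / ?P * H (c * (chi_square (X \<omega>) - v)))"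
    by (intro Bochner_Integration.integral_cong) (auto simp: indicator_def inner)
  also have "\<dots> = integral\<^sup>L (uniform_measure M ?A) (\<lambda>\<omega>. H (c * (chi_square (X \<omega>) - v)))"
    by (rule integral_uniform_measure[OF M A pos, symmetric]) measurable
  also have "\<dots> = (LINT s|distr (uniform_measure M ?A) borel (\<lambda>\<omega>. c * (chi_square (X \<omega>) - v)). H s)"
    by (rule integral_distr[symmetric]) auto
  finally show ?thesis unfolding T_def H_def .
qed

text \<open>Integrals of varying functions against weakly convergent laws converge if the functions converge
  along all convergent sequences of arguments: Skorohod's representation turns weak convergence
  into pointwise convergence.\<close>
lemma weak_conv_integral_continuous_convergence:
  fixes \<mu> :: "nat \<Rightarrow> real measure" and H :: "nat \<Rightarrow> real \<Rightarrow> real"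
  assumes \<mu>: "\<And>n. real_distribution (\<mu> n)" and \<nu>: "real_distribution \<nu>" and wc: "weak_conv_m \<mu> \<nu>"
    and H: "\<And>n. H n \<in> borel_measurable borel" and bd: "\<And>n s. \<bar>H n s\<bar> \<le> K"
    and H0: "H0 \<in> borel_measurable borel"
    and lim: "\<And>s s0. s \<longlonglongrightarrow> s0 \<Longrightarrow> (\<lambda>n. H n (s n)) \<longlonglongrightarrow> H0 s0"
  shows "(\<lambda>n. LINT s|\<mu> n. H n s) \<longlonglongrightarrow> (LINT s|\<nu>. H0 s)"
proof -
  note [measurable] = H H0
  obtain \<Omega> :: "real measure" and Y_seq :: "nat \<Rightarrow> real \<Rightarrow> real" and Y :: "real \<Rightarrow> real"
    where \<Omega>: "prob_space \<Omega>" and Y_seq[measurable]: "\<And>n. Y_seq n \<in> borel_measurable \<Omega>"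
      and d: "\<And>n. distr \<Omega> borel (Y_seq n) = \<mu> n" and Y[measurable]: "Y \<in> borel_measurable \<Omega>"
      and dY: "distr \<Omega> borel Y = \<nu>" and conv: "\<And>x. x \<in> space \<Omega> \<Longrightarrow> (\<lambda>n. Y_seq n x) \<longlonglongrightarrow> Y x"
    using Skorohod[OF \<mu> \<nu> wc] by force
  interpret prob_space \<Omega> by fact
  have "(\<lambda>n. LINT x|\<Omega>. H n (Y_seq n x)) \<longlonglongrightarrow> (LINT x|\<Omega>. H0 (Y x))"
  proof (rule integral_dominated_convergence[where w="\<lambda>_. K"])
    show "AE x in \<Omega>. (\<lambda>n. H n (Y_seq n x)) \<longlonglongrightarrow> H0 (Y x)"
      by (intro AE_I2 lim conv)
  qed (use bd in auto)
  then show ?thesis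
    unfolding d[symmetric] dY[symmetric] by (simp add: integral_distr)
qed

text \<open>The Gumbel condition is precisely the convergence of the tail function of the scaled exceedance to
  \<open>exp (- x)\<close> for \<open>x \<ge> 0\<close>.\<close>
lemma weak_conv_exceedance:
  assumes M: "prob_space M" and Z[measurable]: "Z \<in> borel_measurable M"
    and G: "gumbel_MDA (cdf (distr M borel Z)) w"
    and N: "prob_space N" and E: "distributed N lborel E (exponential_density 1)"
    and u: "filterlim u at_top sequentially" "\<And>n. 0 < u n"
  shows "weak_conv_m (\<lambda>n. distr (uniform_measure M {\<omega> \<in> space M. Z \<omega> > u n}) borel (\<lambda>\<omega>. w (u n) * (Z \<omega> - u n)))
           (distr N borel E)"
  unfolding weak_conv_m_def weak_conv_def
proof (intro allI impI)
  interpret N: prob_space N by fact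
  have [measurable]: "E \<in> borel_measurable N" using distributed_measurable[OF E] by simp
  fix x :: real
  let ?G = "cdf (distr M borel Z)"
  have rd: "real_distribution (distr M borel Z)"
    using M by (simp add: prob_space.real_distribution_distr)
  have cdfE: "cdf (distr N borel E) x = N.prob {\<omega> \<in> space N. E \<omega> \<le> x}" for x
    unfolding cdf_def by (subst measure_distr) (auto intro!: arg_cong[where f="measure N"])
  have E_le: "N.prob {\<omega> \<in> space N. E \<omega> \<le> a} = 1 - exp (- a)" if "0 \<le> a" for a
    using N.exponential_distributedD_le[OF E that] by simp
  have lim: "cdf (distr N borel E) x = (if x < 0 then 0 else 1 - exp (- x))"
  proof (cases "x < 0")
    case True
    have "N.prob {\<omega> \<in> space N. E \<omega> \<le> x} \<le> N.prob {\<omega> \<in> space N. E \<omega> \<le> 0}"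
      using True by (intro N.finite_measure_mono) auto
    then show ?thesis using True E_le[of 0] by (simp add: cdfE antisym)
  qed (simp add: cdfE E_le)
  have eq: "cdf (distr (uniform_measure M {\<omega> \<in> space M. Z \<omega> > u n}) borel (\<lambda>\<omega>. w (u n) * (Z \<omega> - u n))) x =
     (if x < 0 then 0 else 1 - (1 - ?G (u n + x / w (u n))) / (1 - ?G (u n)))" for n
    using u(2)[of n] G by (intro cdf_scaled_exceedance[OF M Z gumbel_MDA_tail_pos[OF rd G]]) (simp add: gumbel_MDA_def)
  have "((\<lambda>v. (1 - ?G (v + x / w v)) / (1 - ?G v)) \<longlongrightarrow> exp (- x)) at_top"
    using G unfolding gumbel_MDA_def by blast
  from tendsto_diff[OF tendsto_const[of 1] filterlim_compose[OF this u(1)]]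
  show "(\<lambda>n. cdf (distr (uniform_measure M {\<omega> \<in> space M. Z \<omega> > u n}) borel (\<lambda>\<omega>. w (u n) * (Z \<omega> - u n))) x)
     \<longlonglongrightarrow> cdf (distr N borel E) x"
    unfolding eq lim by auto
qed

section \<open>The limit theorem\<close>

text \<open>Let \<open>H v s\<close> be the expectation of the test function at shift \<open>s\<close>. The convergence along moving
  shifts says that \<open>H v\<close> converges continuously to \<open>H0\<close>, and the exceedance laws converge weakly to
  the exponential law, so the integrals of \<open>H v\<close> converge to that of \<open>H0\<close>; independence of \<open>E\<close> and
  \<open>U\<close> identifies the limit. Sequences \<open>v\<^sub>n \<longrightarrow> \<infinity>\<close> suffice, and \<open>u\<^sub>n = max 1 v\<^sub>n\<close> makes all
  thresholds positive.\<close>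
lemma (in perturbed_risks) exceedance_limit:
  fixes X :: "'a \<Rightarrow> real^'m" and U :: "'b \<Rightarrow> real^'k" and lam :: "real^'k"
  assumes N: "prob_space N" and U[measurable]: "U \<in> borel_measurable N" and m: "CARD('m) \<ge> 2"
    and ind: "\<And>v. 0 < v \<Longrightarrow> independent_variables M X (W v)"
    and G: "gumbel_MDA (cdf (distr M borel (\<lambda>\<omega>. chi_square (X \<omega>)))) w"
    and conv: "conv_in_distribution (\<lambda>v. distr M borel (\<lambda>\<omega>. risk v 0 \<omega>))
      (distr N borel (\<lambda>\<omega>. \<chi> j. 2 * U \<omega> $ j - lam $ j / 2)) at_top"
    and E: "distributed N lborel E (exponential_density 1)" and indE: "independent_variables N E U"
  shows "conv_in_distribution
          (\<lambda>v. distr (uniform_measure M {\<omega> \<in> space M. chi_square (X \<omega>) > v}) borel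
                 (\<lambda>\<omega>. (w v * (chi_square (X \<omega>) - v),
                       \<chi> j. w v * (perturbed_chi_square (\<rho> v) (X \<omega>) (W v \<omega>) $ j - v))))
          (distr N borel (\<lambda>\<omega>. (E \<omega>, \<chi> j. E \<omega> + 2 * U \<omega> $ j - lam $ j / 2))) at_top"
  unfolding conv_in_distribution_def
proof (intro allI impI)
  fix f :: "real \<times> (real^'k) \<Rightarrow> real" assume f: "continuous_on UNIV f" "bounded (range f)"
  obtain K where K: "\<And>z. \<bar>f z\<bar> \<le> K" using f(2) by (auto simp: bounded_iff)
  have K0: "0 \<le> K" using K[of "(0, 0)"] by linarith
  note fm[measurable] = borel_measurable_continuous_onI[OF f(1)]
  interpret N: prob_space N by fact
  have Xm[measurable]: "X \<in> borel_measurable M" using ind[of 1] by (simp add: independent_variables_def)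
  have Em[measurable]: "E \<in> borel_measurable N" using distributed_measurable[OF E] by simp
  let ?Z = "\<lambda>\<omega>. chi_square (X \<omega>)"
  have Zm[measurable]: "?Z \<in> borel_measurable M" by (rule measurable_compose[OF Xm borel_measurable_chi_square])
  have rd: "real_distribution (distr M borel ?Z)" by (rule real_distribution_distr[OF Zm])
  let ?V = "\<lambda>\<omega>. (\<chi> j. 2 * U \<omega> $ j - lam $ j / 2) :: real^'k"
  have "continuous_on UNIV (\<lambda>u::real^'k. (\<chi> j. 2 * u $ j - lam $ j / 2) :: real^'k)"
    by (intro continuous_intros)
  then have Vm[measurable]: "?V \<in> borel_measurable N"
    by (intro measurable_compose[OF U] borel_measurable_continuous_onI)
  define H where "H v s = (LINT \<omega>|M. f (s, risk v s \<omega>))" for v s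
  define H0 where "H0 s = (LINT \<omega>|N. f (s, \<chi> j. ?V \<omega> $ j + s))" for s
  have tail: "0 < prob {\<omega> \<in> space M. v < ?Z \<omega>}" for v
  proof -
    have "cdf (distr M borel ?Z) v = prob {\<omega> \<in> space M. ?Z \<omega> \<le> v}"
      unfolding cdf_def by (subst measure_distr) (auto intro!: arg_cong[where f=prob])
    also have "\<dots> = 1 - prob {\<omega> \<in> space M. v < ?Z \<omega>}"
      by (subst prob_compl[symmetric]) (auto intro!: arg_cong[where f=prob])
    finally show ?thesis using gumbel_MDA_tail_pos[OF rd G, of v] by simp
  qed
  have Hm: "H v \<in> borel_measurable borel" if "0 < v" for v
  proof -
    note [measurable] = W_measurable[OF that]
    have rm: "(\<lambda>p. normalized_risk first (w v) v (\<rho> v) (fst p) (snd p)) \<in> borel_measurable (borel \<Otimes>\<^sub>M borel)"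
      using borel_measurable_normalized_risk[of first "w v" v "\<rho> v"] by (simp add: split_beta)
    have [measurable]: "(\<lambda>p. risk v (fst p) (snd p)) \<in> borel_measurable (borel \<Otimes>\<^sub>M M)"
      using measurable_compose[OF _ rm, of "\<lambda>p. (fst p, W v (snd p))" "borel \<Otimes>\<^sub>M M"] by simp
    show ?thesis
      unfolding H_def by (rule borel_measurable_lebesgue_integral) (simp add: split_beta)
  qed
  have phi: "(\<lambda>(s, u). f (s, \<chi> j. (2 * u $ j - lam $ j / 2) + s)) \<in> borel_measurable (borel \<Otimes>\<^sub>M borel)"
    unfolding borel_prod split_beta
    by (intro borel_measurable_continuous_onI continuous_on_compose2[OF f(1)] continuous_intros) auto
  have H0m: "H0 \<in> borel_measurable borel"
  proof -
    have "(\<lambda>p. f (fst p, \<chi> j. (2 * U (snd p) $ j - lam $ j / 2) + fst p)) \<in> borel_measurable (borel \<Otimes>\<^sub>M N)"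
      using measurable_compose[OF _ phi, of "\<lambda>p. (fst p, U (snd p))" "borel \<Otimes>\<^sub>M N"] by simp
    then show ?thesis
      unfolding H0_def by (intro N.borel_measurable_lebesgue_integral) (simp add: split_beta)
  qed
  have limit: "integral\<^sup>L (distr N borel (\<lambda>\<omega>. (E \<omega>, \<chi> j. E \<omega> + 2 * U \<omega> $ j - lam $ j / 2))) f =
      (LINT s|distr N borel E. H0 s)"
  proof -
    have "(\<lambda>p. (fst p, \<chi> j. fst p + 2 * snd p $ j - lam $ j / 2) :: real \<times> (real^'k)) \<in> borel_measurable (borel \<Otimes>\<^sub>M borel)"
      unfolding borel_prod by (intro borel_measurable_continuous_onI continuous_intros)
    from measurable_compose[OF measurable_Pair[OF Em U] this]
    have "(\<lambda>\<omega>. (E \<omega>, \<chi> j. E \<omega> + 2 * U \<omega> $ j - lam $ j / 2) :: real \<times> (real^'k)) \<in> borel_measurable N"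
      by simp
    then have "integral\<^sup>L (distr N borel (\<lambda>\<omega>. (E \<omega>, \<chi> j. E \<omega> + 2 * U \<omega> $ j - lam $ j / 2))) f =
        (LINT \<omega>|N. f (E \<omega>, \<chi> j. E \<omega> + 2 * U \<omega> $ j - lam $ j / 2))"
      by (rule integral_distr) measurable
    also have "\<dots> = (LINT \<omega>|N. f (E \<omega>, \<chi> j. (2 * U \<omega> $ j - lam $ j / 2) + E \<omega>))"
      by (simp add: algebra_simps)
    also have "\<dots> = (LINT \<omega>|N. LINT \<omega>'|N. f (E \<omega>, \<chi> j. (2 * U \<omega>' $ j - lam $ j / 2) + E \<omega>))"
      by (rule independent_variables_integral[OF N indE phi K])
    also have "\<dots> = (LINT \<omega>|N. H0 (E \<omega>))" by (simp add: H0_def)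
    also have "\<dots> = (LINT s|distr N borel E. H0 s)" using H0m by (simp add: integral_distr)
    finally show ?thesis .
  qed
  let ?I = "\<lambda>v. integral\<^sup>L (distr (uniform_measure M {\<omega> \<in> space M. v < ?Z \<omega>}) borel
                 (\<lambda>\<omega>. (w v * (?Z \<omega> - v), \<chi> j. w v * (perturbed_chi_square (\<rho> v) (X \<omega>) (W v \<omega>) $ j - v)))) f"
  let ?\<mu> = "\<lambda>v. distr (uniform_measure M {\<omega> \<in> space M. v < ?Z \<omega>}) borel (\<lambda>\<omega>. w v * (?Z \<omega> - v))"
  show "(?I \<longlongrightarrow> integral\<^sup>L (distr N borel (\<lambda>\<omega>. (E \<omega>, \<chi> j. E \<omega> + 2 * U \<omega> $ j - lam $ j / 2))) f) at_top"
    unfolding limit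
  proof (rule tendsto_at_topI_sequentially)
    fix v :: "nat \<Rightarrow> real" assume v: "filterlim v at_top sequentially"
    define u where "u n = max 1 (v n)" for n
    have upos: "0 < u n" for n by (simp add: u_def)
    have u: "filterlim u at_top sequentially"
      by (rule filterlim_at_top_mono[OF v]) (simp add: u_def)
    have I: "?I (u n) = (LINT s|?\<mu> (u n). H (u n) s)" for n
      unfolding H_def
      by (rule exceedance_risk_integral[OF M W[OF upos] ind[OF upos] fm K w_pos[OF upos] tail])
    have "(\<lambda>n. LINT s|?\<mu> (u n). H (u n) s) \<longlonglongrightarrow> (LINT s|distr N borel E. H0 s)"
    proof (rule weak_conv_integral_continuous_convergence)
      show "real_distribution (?\<mu> (u n))" for n
      proof (rule prob_space.real_distribution_distr)
        show "prob_space (uniform_measure M {\<omega> \<in> space M. u n < ?Z \<omega>})"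
          using tail[of "u n"] by (intro prob_space_uniform_measure) (auto simp: emeasure_eq_measure)
      qed simp
      show "real_distribution (distr N borel E)" by (rule N.real_distribution_distr[OF Em])
      show "weak_conv_m (\<lambda>n. ?\<mu> (u n)) (distr N borel E)"
        by (rule weak_conv_exceedance[OF M Zm G N E u upos])
      show "H (u n) \<in> borel_measurable borel" for n by (rule Hm[OF upos])
      show "H0 \<in> borel_measurable borel" by (rule H0m)
      show "\<bar>H (u n) s\<bar> \<le> K" for n s
      proof -
        have "\<bar>H (u n) s\<bar> \<le> (LINT \<omega>|M. \<bar>f (s, risk (u n) s \<omega>)\<bar>)"
          unfolding H_def by (rule integral_abs_bound)
        also have "\<dots> \<le> (LINT \<omega>|M. K)"
          using K K0 risk_measurable[OF upos]
          by (intro integral_mono integrable_const_bound[where B=K]) auto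
        finally show ?thesis by (simp add: prob_space)
      qed
      fix s :: "nat \<Rightarrow> real" and s0 assume s: "s \<longlonglongrightarrow> s0"
      have "conv_in_distribution (\<lambda>n. distr M borel (\<lambda>\<omega>. (s n, risk (u n) (s n) \<omega>)))
           (distr N borel (\<lambda>\<omega>. (s0, \<chi> j. ?V \<omega> $ j + s0))) sequentially"
        by (rule risk_conv_moving_shift[OF N Vm m conv u s])
      then have "(\<lambda>n. integral\<^sup>L (distr M borel (\<lambda>\<omega>. (s n, risk (u n) (s n) \<omega>))) f) \<longlonglongrightarrow>
          integral\<^sup>L (distr N borel (\<lambda>\<omega>. (s0, \<chi> j. ?V \<omega> $ j + s0))) f"
        using f unfolding conv_in_distribution_def by blast
      moreover have "integral\<^sup>L (distr M borel (\<lambda>\<omega>. (s n, risk (u n) (s n) \<omega>))) f = H (u n) (s n)" for n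
        unfolding H_def using risk_measurable[OF upos] by (intro integral_distr) auto
      moreover have "integral\<^sup>L (distr N borel (\<lambda>\<omega>. (s0, \<chi> j. ?V \<omega> $ j + s0))) f = H0 s0"
      proof -
        have "(\<lambda>z::real^'k. (s0, \<chi> j. z $ j + s0) :: real \<times> (real^'k)) \<in> borel_measurable borel"
          by (intro borel_measurable_continuous_onI continuous_intros)
        from integral_distr[OF measurable_compose[OF Vm this] fm] show ?thesis by (simp add: H0_def)
      qed
      ultimately show "(\<lambda>n. H (u n) (s n)) \<longlonglongrightarrow> H0 s0" by simp
    qed
    then have "(\<lambda>n. ?I (u n)) \<longlonglongrightarrow> (LINT s|distr N borel E. H0 s)"
      unfolding I .
    moreover have "\<forall>\<^sub>F n in sequentially. ?I (u n) = ?I (v n)"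
    proof -
      have "\<forall>\<^sub>F n in sequentially. 1 \<le> v n" using v by (simp add: filterlim_at_top)
      then show ?thesis by eventually_elim (simp add: u_def max_absorb2)
    qed
    ultimately show "(\<lambda>n. ?I (v n)) \<longlonglongrightarrow> (LINT s|distr N borel E. H0 s)"
      by (rule Lim_transform_eventually)
  qed
qed

theorem theorem2p3:
  fixes M :: "'a measure" and N :: "'b measure"
    and X :: "'a \<Rightarrow> real^'m" and W :: "real \<Rightarrow> 'a \<Rightarrow> real^'k^'m"
    and \<rho> :: "real \<Rightarrow> real^'k" and w :: "real \<Rightarrow> real"
    and Q :: "real \<Rightarrow> (real^'m) measure"
    and U :: "'b \<Rightarrow> real^'k" and lam :: "real^'k" and first :: 'm
  assumes "prob_space M" and "prob_space N"
    and "CARD('m) \<ge> 2"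
    and "\<forall>v>0. \<forall>j. \<rho> v $ j \<noteq> 0"
    and "\<forall>v>0. assumption_A M X (W v)"
    and "gumbel_MDA (cdf (distr M borel (\<lambda>\<omega>. chi_square (X \<omega>)))) w"
    and "fibre_cond_distribution M X Q"
    and "U \<in> borel_measurable N"
    and "\<forall>j. 0 \<le> lam $ j"
  shows
    "((\<forall>j. ((\<lambda>v. 4 * v * w v * (1 - \<rho> v $ j)) \<longlongrightarrow> lam $ j) at_top) \<longrightarrow>
      conv_in_distribution
        (\<lambda>v. distr M borel (\<lambda>\<omega>. (w v * sqrt v) *\<^sub>R (W v \<omega> $ first))) (distr N borel U) at_top \<longrightarrow>
      conv_in_probability M (\<lambda>v \<omega>. sqrt (w v) *\<^sub>R (W v \<omega> $ first)) 0 at_top \<longrightarrow>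
      (\<forall>x. cond_risk_limit M Q W \<rho> w N U lam x))
     \<and>
     ((\<forall>x\<ge>0. cond_risk_limit M Q W \<rho> w N U lam x) \<longrightarrow>
      (\<forall>E. distributed N lborel E (exponential_density 1) \<longrightarrow>
           independent_variables N E U \<longrightarrow>
        conv_in_distribution
          (\<lambda>v. distr (uniform_measure M {\<omega> \<in> space M. chi_square (X \<omega>) > v}) borel
                 (\<lambda>\<omega>. (w v * (chi_square (X \<omega>) - v),
                       \<chi> j. w v * (perturbed_chi_square (\<rho> v) (X \<omega>) (W v \<omega>) $ j - v))))
          (distr N borel (\<lambda>\<omega>. (E \<omega>, \<chi> j. E \<omega> + 2 * U \<omega> $ j - lam $ j / 2)))
          at_top))"
proof -
  interpret M: prob_space M by fact
  have A: "assumption_A M X (W v)" if "0 < v" for v using assms(5) that by blast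
  have ind: "independent_variables M X (W v)" if "0 < v" for v
    using A[OF that] by (simp add: assumption_A_def)
  have [measurable]: "X \<in> borel_measurable M" using ind[of 1] by (simp add: independent_variables_def)
  have rd: "real_distribution (distr M borel (\<lambda>\<omega>. chi_square (X \<omega>)))"
    by (rule M.real_distribution_distr) measurable
  interpret perturbed_risks M W \<rho> w first
  proof (rule perturbed_risks.intro)
    show "prob_space M" by fact
    show "iid_gaussian_rows M (W v)" if "0 < v" for v
      using A[OF that] unfolding assumption_A_def iid_gaussian_rows_def independent_variables_def by blast
    show "0 < w v" if "0 < v" for v using assms(6) that by (simp add: gumbel_MDA_def)
    show "filterlim (\<lambda>v. v * w v) at_top at_top" by (rule gumbel_MDA_scaling_at_top[OF rd assms(6)])
  qed
  show ?thesis
  proof (intro conjI impI allI)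
    fix x
    assume "\<forall>j. ((\<lambda>v. 4 * v * w v * (1 - \<rho> v $ j)) \<longlongrightarrow> lam $ j) at_top"
      and "conv_in_distribution
        (\<lambda>v. distr M borel (\<lambda>\<omega>. (w v * sqrt v) *\<^sub>R (W v \<omega> $ first))) (distr N borel U) at_top"
      and "conv_in_probability M (\<lambda>v \<omega>. sqrt (w v) *\<^sub>R (W v \<omega> $ first)) 0 at_top"
    then show "cond_risk_limit M Q W \<rho> w N U lam x"
      unfolding cond_risk_limit_iff[OF assms(7)]
      using assms(2,8,9) by (intro risk_conv_in_distribution) auto
  next
    fix E
    assume "\<forall>x\<ge>0. cond_risk_limit M Q W \<rho> w N U lam x"
      and E: "distributed N lborel E (exponential_density 1)" "independent_variables N E U"
    then have "cond_risk_limit M Q W \<rho> w N U lam 0" by simp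
    then have "conv_in_distribution (\<lambda>v. distr M borel (\<lambda>\<omega>. risk v 0 \<omega>))
      (distr N borel (\<lambda>\<omega>. \<chi> j. 2 * U \<omega> $ j - lam $ j / 2)) at_top"
      unfolding cond_risk_limit_iff[OF assms(7)] by simp
    then show "conv_in_distribution
          (\<lambda>v. distr (uniform_measure M {\<omega> \<in> space M. chi_square (X \<omega>) > v}) borel
                 (\<lambda>\<omega>. (w v * (chi_square (X \<omega>) - v),
                       \<chi> j. w v * (perturbed_chi_square (\<rho> v) (X \<omega>) (W v \<omega>) $ j - v))))
          (distr N borel (\<lambda>\<omega>. (E \<omega>, \<chi> j. E \<omega> + 2 * U \<omega> $ j - lam $ j / 2))) at_top"
      by (intro exceedance_limit[OF assms(2,8,3) ind assms(6)] E)
  qed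
qed

end
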